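(* Let $K$ be a field, let $\mathcal{C}$ be a generalized $X$-pentomino and let $D$ be the central cell of $\mathcal{C}$. Let $S=K[x_v : v\in V(\mathcal{C})]$ and let $I_{\rm adj}(\mathcal{C})\subset S$ be the ideal generated by the adjacent $2$-minors $f_C$, $C\in\mathcal{C}$. Then the following hold: (i) $\operatorname{depth}(S/I_{\rm adj}(\mathcal{C}))=|V(\mathcal{C})|-|\mathcal{C}|$. (ii) Suppose that $C$ is a cell of $\mathcal{C}$ which is adjacent to $D$ and has two free vertices $i,j$. Then for every associated prime $\mathfrak{p}\in\operatorname{Ass}(S/I_{\rm adj}(\mathcal{C}))$, one has $x_i\notin\mathfrak{p}$ or $x_j\notin\mathfrak{p}$.
   Context: A cell is a unit square $C\subset\mathbb{R}^2$ with vertex set $V(C)=\{(i,j),(i,j+1),(i+1,j),(i+1,j+1)\}$, where $i,j$ are positive integers; $E(C)$ denotes the set of its four edges. For a finite collection $\mathcal{C}$ of cells put $V(\mathcal{C})=\bigcup_{C\in\mathcal{C}}V(C)$ and $S=K[x_v : v\in V(\mathcal{C})]$, a polynomial ring in $|V(\mathcal{C})|$ variables over the field $K$. To a cell $C$ with vertex set $V(C)=\{(i,j),(i,j+1),(i+1,j),(i+1,j+1)\}$ one associates the binomial $f_C=x_{(i,j)}x_{(i+1,j+1)}-x_{(i+1,j)}x_{(i,j+1)}$, and $I_{\rm adj}(\mathcal{C})=(f_C : C\in\mathcal{C})\subset S$. A vertex of $\mathcal{C}$ is free if it belongs to exactly one cell of $\mathcal{C}$. Two cells $C,C'$ of $\mathcal{C}$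 are adjacent if $|E(C)\cap E(C')|=1$. An $X$-pentomino is a collection of five cells consisting of one cell together with the four cells adjacent to it (sharing an edge with it). A row of cells is the collection of all cells with vertices $(i,j),(i,j+1),(i+1,j),(i+1,j+1)$ for $p\le i<q$, with $j$ and $p<q$ fixed (so its vertex set is $\{(i,j),(i,j+1): p\le i\le q\}$); a column of cells is defined in the same way with the two coordinates interchanged (its vertex set is $\{(i,j),(i+1,j): p\le j\le q\}$ with $i$ fixed). A generalized $X$-pentomino is a collection of cells of the form $\mathcal{C}=\mathcal{C}'\cup\mathcal{C}''$, where $\mathcal{C}'$ is a row of cells and $\mathcal{C}''$ is a column of cells, such that $\mathcal{C}$ contains an $X$-pentomino. The unique cell $D$ with $\{D\}=\mathcal{C}'\cap\mathcal{C}''$ is called the central cell of $\mathcal{C}$. For a graded ideal $I$, $\operatorname{Ass}(S/I)$ is the set of associated primes of $S/I$, and depth is taken with respect to the graded maximal ideal of $S$ (generated by all variables). *)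

theory Defs
  imports
    "HOL-Algebra.QuotRing"
    "HOL-Algebra.Module"
    "HOL-Library.Poly_Mapping"
    "HOL-Library.Extended_Nat"
begin

section \<open>Associated primes and depth\<close>

definition ann :: "('a, 'm) ring_scheme \<Rightarrow> ('a, 'b, 'n) module_scheme \<Rightarrow> 'b \<Rightarrow> 'a set" where
  "ann R M x = {r \<in> carrier R. r \<odot>\<^bsub>M\<^esub> x = \<zero>\<^bsub>M\<^esub>}"

definition associated_primes ::
    "('a, 'm) ring_scheme \<Rightarrow> ('a, 'b, 'n) module_scheme \<Rightarrow> 'a set set" where
  "associated_primes R M = {P. primeideal P R \<and> (\<exists>x \<in> carrier M. P = ann R M x)}"

text \<open>The submodule \<open>(f\<^sub>1, \<dots>, f\<^sub>n) M = f\<^sub>1 M + \<dots> + f\<^sub>n M\<close> of \<open>M\<close>.\<close>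

primrec seq_submodule :: "('a, 'b, 'n) module_scheme \<Rightarrow> 'a list \<Rightarrow> 'b set" where
  "seq_submodule M [] = {\<zero>\<^bsub>M\<^esub>}"
| "seq_submodule M (f # fs) =
     {(f \<odot>\<^bsub>M\<^esub> x) \<oplus>\<^bsub>M\<^esub> y | x y. x \<in> carrier M \<and> y \<in> seq_submodule M fs}"

text \<open>The implication says that \<open>f\<^sub>i\<close> is a nonzerodivisor on \<open>M / (f\<^sub>1, \<dots>, f\<^bsub>i-1\<^esub>) M\<close>
  (list indices start at 0).\<close>

definition regular_sequence ::
    "('a, 'm) ring_scheme \<Rightarrow> ('a, 'b, 'n) module_scheme \<Rightarrow> 'a list \<Rightarrow> bool" where
  "regular_sequence R M fs \<longleftrightarrow>
     set fs \<subseteq> carrier R \<and>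
     (\<forall>i < length fs. \<forall>x \<in> carrier M.
        (fs ! i) \<odot>\<^bsub>M\<^esub> x \<in> seq_submodule M (take i fs) \<longrightarrow> x \<in> seq_submodule M (take i fs)) \<and>
     seq_submodule M fs \<noteq> carrier M"

text \<open>Depth of \<open>M\<close> with respect to the ideal \<open>J\<close>: the supremum of the lengths of the
  \<open>M\<close>-regular sequences contained in \<open>J\<close>. (For \<open>M = 0\<close> there are none and the value is \<open>0\<close>.)\<close>

definition depth ::
    "('a, 'm) ring_scheme \<Rightarrow> 'a set \<Rightarrow> ('a, 'b, 'n) module_scheme \<Rightarrow> enat" where
  "depth R J M = Sup {enat (length fs) | fs. set fs \<subseteq> J \<and> regular_sequence R M fs}"

text \<open>\<open>R / I\<close> as an \<open>R\<close>-module.\<close>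

definition quot_module :: "('a, 'm) ring_scheme \<Rightarrow> 'a set \<Rightarrow> ('a, 'a set) module" where
  "quot_module R I =
     \<lparr>carrier = carrier (R Quot I), mult = mult (R Quot I), one = \<one>\<^bsub>R Quot I\<^esub>,
      zero = \<zero>\<^bsub>R Quot I\<^esub>, add = add (R Quot I),
      smult = (\<lambda>r X. (I +>\<^bsub>R\<^esub> r) \<otimes>\<^bsub>R Quot I\<^esub> X)\<rparr>"

lemma (in cring) module_quot_module:
  assumes "ideal I R"
  shows "Module.module R (quot_module R I)"
proof -
  interpret I: ideal I R by fact
  interpret Q: cring "R Quot I" by (rule I.quotient_is_cring) (rule is_cring)
  have c: "I +> r \<in> carrier (R Quot I)" if "r \<in> carrier R" for r
    using that by (auto simp: FactRing_simps)
  have hom: "(+>) I \<in> ring_hom R (R Quot I)"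
    by (rule I.rcos_ring_hom)
  note simps = ring_hom_mult[OF hom] ring_hom_add[OF hom] ring_hom_one[OF hom]
  show ?thesis
  proof (rule moduleI)
    show "cring R" by (rule is_cring)
    show "abelian_group (quot_module R I)"
      by (rule abelian_groupI)
        (auto simp: quot_module_def Q.a_ac intro: Q.add.l_inv_ex)
  qed (auto simp: quot_module_def c simps Q.l_distr Q.r_distr Q.m_assoc)
qed


section \<open>Polynomial rings in a prescribed set of variables\<close>

text \<open>A polynomial is a finitely supported map from monomials to coefficients, a monomial a
  finitely supported map from variables to exponents. All polynomials with variables in the
  type \<open>'v\<close> form a ring by type class instances; \<open>poly_ring V\<close> is its subring \<open>K[x\<^sub>v : v \<in> V]\<close>.\<close>

type_synonym ('v, 'k) mpoly = "('v \<Rightarrow>\<^sub>0 nat) \<Rightarrow>\<^sub>0 'k"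

definition poly_ring :: "'v set \<Rightarrow> ('v, 'k::field) mpoly ring" where
  "poly_ring V =
     \<lparr>carrier = {p. \<forall>m \<in> Poly_Mapping.keys p. Poly_Mapping.keys m \<subseteq> V},
      mult = (*), one = 1, zero = 0, add = (+)\<rparr>"

definition X :: "'v \<Rightarrow> ('v, 'k::field) mpoly" where
  "X v = Poly_Mapping.single (Poly_Mapping.single v 1) 1"

lemma X_in_poly_ring: "v \<in> V \<Longrightarrow> X v \<in> carrier (poly_ring V)"
  by (simp add: X_def poly_ring_def)

lemma cring_poly_ring: "cring (poly_ring V)"
proof (rule cringI)
  show "abelian_group (poly_ring V :: ('a, 'b) mpoly ring)"
  proof (rule abelian_groupI, goal_cases)
    case (1 p q)
    then show ?case
      using keys_add[of p q] by (fastforce simp: poly_ring_def)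
  next
    case (6 p)
    then show ?case
      by (intro bexI[of _ "- p"]) (auto simp: poly_ring_def)
  qed (auto simp: poly_ring_def add_ac)
  show "comm_monoid (poly_ring V :: ('a, 'b) mpoly ring)"
  proof (rule comm_monoidI, goal_cases)
    case (1 p q)
    have "Poly_Mapping.keys m \<subseteq> V" if m: "m \<in> Poly_Mapping.keys (p * q)" for m
    proof -
      obtain a b where ab: "m = a + b" "a \<in> Poly_Mapping.keys p" "b \<in> Poly_Mapping.keys q"
        using subsetD[OF keys_mult m] by auto
      have "Poly_Mapping.keys (a + b) \<subseteq> Poly_Mapping.keys a \<union> Poly_Mapping.keys b"
        by (rule keys_add)
      moreover have "Poly_Mapping.keys a \<subseteq> V" "Poly_Mapping.keys b \<subseteq> V"
        using ab 1 by (auto simp: poly_ring_def)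
      ultimately show ?thesis using ab(1) by blast
    qed
    then show ?case by (simp add: poly_ring_def)
  qed (auto simp: poly_ring_def mult_ac)
qed (auto simp: poly_ring_def distrib_right)

text \<open>The graded maximal ideal of \<open>poly_ring V\<close>.\<close>

definition irrelevant_ideal :: "'v set \<Rightarrow> ('v, 'k::field) mpoly set" where
  "irrelevant_ideal V = genideal (poly_ring V) (X ` V)"


section \<open>Collections of cells\<close>

type_synonym vertex = "nat \<times> nat"

text \<open>A cell is represented by its lower left corner; \<open>is_cell\<close> expresses that the coordinates
  are positive.\<close>

type_synonym cell = "nat \<times> nat"

fun is_cell :: "cell \<Rightarrow> bool" where
  "is_cell (i, j) \<longleftrightarrow> 1 \<le> i \<and> 1 \<le> j"

fun cell_vertices :: "cell \<Rightarrow> vertex set" where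
  "cell_vertices (i, j) = {(i, j), (i, j + 1), (i + 1, j), (i + 1, j + 1)}"

fun cell_edges :: "cell \<Rightarrow> vertex set set" where
  "cell_edges (i, j) =
     {{(i, j), (i + 1, j)}, {(i, j + 1), (i + 1, j + 1)},
      {(i, j), (i, j + 1)}, {(i + 1, j), (i + 1, j + 1)}}"

definition vertices :: "cell set \<Rightarrow> vertex set" where
  "vertices \<C> = (\<Union>C \<in> \<C>. cell_vertices C)"

definition free_vertex :: "cell set \<Rightarrow> vertex \<Rightarrow> bool" where
  "free_vertex \<C> v \<longleftrightarrow> (\<exists>!C. C \<in> \<C> \<and> v \<in> cell_vertices C)"

definition adjacent :: "cell \<Rightarrow> cell \<Rightarrow> bool" where
  "adjacent C C' \<longleftrightarrow> card (cell_edges C \<inter> cell_edges C') = 1"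

text \<open>A cell touching the boundary of the positive quadrant has fewer than four adjacent cells;
  the cardinality condition excludes it as the centre of an \<open>X\<close>-pentomino.\<close>

definition X_pentomino :: "cell set \<Rightarrow> bool" where
  "X_pentomino \<P> \<longleftrightarrow>
     card \<P> = 5 \<and> (\<exists>C. is_cell C \<and> \<P> = insert C {C'. is_cell C' \<and> adjacent C C'})"

definition row_of_cells :: "cell set \<Rightarrow> bool" where
  "row_of_cells \<R> \<longleftrightarrow> (\<exists>j p q. 1 \<le> j \<and> 1 \<le> p \<and> p < q \<and> \<R> = {(i, j) | i. p \<le> i \<and> i < q})"

definition column_of_cells :: "cell set \<Rightarrow> bool" where
  "column_of_cells \<R> \<longleftrightarrow> (\<exists>i p q. 1 \<le> i \<and> 1 \<le> p \<and> p < q \<and> \<R> = {(i, j) | j. p \<le> j \<and> j < q})"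

text \<open>\<open>generalized_X_pentomino \<C> D\<close>: \<open>\<C>\<close> is a generalized \<open>X\<close>-pentomino with central cell \<open>D\<close>.\<close>

definition generalized_X_pentomino :: "cell set \<Rightarrow> cell \<Rightarrow> bool" where
  "generalized_X_pentomino \<C> D \<longleftrightarrow>
     (\<exists>\<R> \<Q>. row_of_cells \<R> \<and> column_of_cells \<Q> \<and> \<C> = \<R> \<union> \<Q> \<and> \<R> \<inter> \<Q> = {D}) \<and>
     (\<exists>\<P> \<subseteq> \<C>. X_pentomino \<P>)"

lemma finite_generalized_X_pentomino:
  assumes "generalized_X_pentomino \<C> D"
  shows "finite \<C>"
proof -
  have "finite {(i, j) | i. p \<le> i \<and> i < q}" for p q j :: nat
    by (rule finite_subset[of _ "{..<q} \<times> {j}"]) auto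
  moreover have "finite {(i, j) | j. p \<le> j \<and> j < q}" for p q i :: nat
    by (rule finite_subset[of _ "{i} \<times> {..<q}"]) auto
  ultimately show ?thesis
    using assms by (auto simp: generalized_X_pentomino_def row_of_cells_def column_of_cells_def)
qed

text \<open>Consequently the subtraction \<open>card (vertices \<C>) - card \<C>\<close> of natural numbers does not
  truncate.\<close>

lemma card_cells_le_card_vertices:
  assumes "finite \<C>"
  shows "card \<C> \<le> card (vertices \<C>)"
proof (rule card_mono)
  show "finite (vertices \<C>)"
    using assms by (auto simp: vertices_def)
  show "\<C> \<subseteq> vertices \<C>"
    by (force simp: vertices_def)
qed


section \<open>The ideal of adjacent 2-minors\<close>

fun cell_binomial :: "cell \<Rightarrow> (vertex, 'k::field) mpoly" where
  "cell_binomial (i, j) = X (i, j) * X (i + 1, j + 1) - X (i + 1, j) * X (i, j + 1)"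

definition I_adj :: "cell set \<Rightarrow> (vertex, 'k::field) mpoly set" where
  "I_adj \<C> = genideal (poly_ring (vertices \<C>)) (cell_binomial ` \<C>)"

end

theory Submission
  imports Defs "HOL-Library.Multiset"
begin

text \<open>Lower bound: in the \<open>X\<close>-pentomino with central cell \<open>a, b, c, d\<close> and central minor \<open>\<Delta>\<close>, the four
  outer minors form a complete intersection \<open>J\<close>. With \<open>\<delta>\<close> the difference of the two products of end
  vertices taken alternately around the cross, \<open>J : \<delta> = J + (a, b, c, d)\<close> and \<open>J : \<Delta> = J + (\<delta>)\<close>.
  Explicit weighted homogeneous parameters that are regular on \<open>J\<close> and make the outer minors split
  into factors reduce both to a linkage computation in five variables, and then stay regular
  modulo \<open>J + (\<Delta>)\<close>. For each arm with end vertices \<open>x, y\<close> they contain a form \<open>p = y - w x\<close>. An arm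
  is lengthened by a cell with new vertices \<open>u, v\<close> by trading \<open>p\<close> for \<open>u - p\<close> and \<open>v - w u\<close>, modulo
  which the new minor \<open>u y - v x\<close> is \<open>p\<^sup>2\<close>. Since \<open>p\<close> is a nonzerodivisor in the ideal \<open>(x, y)\<close>, no
  associated prime contains both \<open>x\<close> and \<open>y\<close>.

  Upper bound: there is an element \<open>u \<noteq> 0\<close> of \<open>S/I\<close> killed by a row of variables, and the minors of
  the column leave on \<open>S u\<close> only as many independent monomials as in \<open>|V| - |\<C>|\<close> variables. A regular
  sequence is quasi-regular, so its monomials applied to \<open>u\<close> are linearly independent over \<open>K\<close>;
  comparing growth bounds its length.\<close>

section \<open>Ideals and regular sequences\<close>

text \<open>The quotient \<open>S/I\<close> is not Cohen-Macaulay, and this shapes both bounds. In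
  the pentomino the ideal \<open>H = (a, b, c, d)\<close> of height 4 contains all five minors, so
  \<Delta> cannot prolong the regular sequence of outer minors, and the depth is one below the
  dimension. The lower bound therefore reaches \<open>S/(J + \<Delta>)\<close> as a cokernel, in two
  steps: \<delta> embeds \<open>S/H\<close> into \<open>S/J\<close> with cokernel
  \<open>S/(J + \<delta>)\<close>, and \<Delta> embeds this cokernel into \<open>S/J\<close> with
  cokernel \<open>S/(J + \<Delta>)\<close>. Parameters regular on both terms of such an embedding
  stay regular on its cokernel once the embedding survives cutting by all of them. Up to sign,
  \<delta> is the determinant of the outer minors read as four linear equations in
  \<open>a, b, c, d\<close>; by Cramer's rule \<delta> \<open>H\<close> lies in \<open>J\<close>,
  and \<Delta> \<delta> with it. In the upper bound the dimension of \<open>S/I\<close> is too large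
  by one, so a nonzero submodule \<open>S u\<close> of dimension at most \<open>|V| - |\<C>|\<close>
  takes its place. Sequences in the definition of depth may be inhomogeneous, so they cannot be
  permuted freely; quasi-regularity needs no grading.\<close>

global_interpretation idl: module "(*) :: 'a::comm_ring_1 \<Rightarrow> 'a \<Rightarrow> 'a"
  by unfold_locales (simp_all add: algebra_simps)

declare idl.scale_scale [simp del]

abbreviation is_ideal :: "'a::comm_ring_1 set \<Rightarrow> bool" where "is_ideal \<equiv> idl.subspace"

definition adjoin :: "'a::comm_ring_1 set \<Rightarrow> 'a \<Rightarrow> 'a set" where
  "adjoin A f = {x. \<exists>k. x - k * f \<in> A}"

lemma adjoin_eq_span: "is_ideal A \<Longrightarrow> adjoin A f = idl.span (insert f A)"
  by (simp add: adjoin_def idl.span_insert idl.span_eq_iff[THEN iffD2])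

lemma is_ideal_adjoin [intro, simp]: "is_ideal A \<Longrightarrow> is_ideal (adjoin A f)"
  by (simp add: adjoin_eq_span)

lemma adjoin_span: "adjoin (idl.span G) f = idl.span (insert f G)"
  by (simp add: adjoin_def idl.span_insert)

lemma mem_adjoin_left: "x \<in> A \<Longrightarrow> x \<in> adjoin A f"
  unfolding adjoin_def by (auto intro!: exI[of _ 0])

lemma mem_adjoin_right: "is_ideal A \<Longrightarrow> k * f \<in> adjoin A f"
  unfolding adjoin_def by (auto intro!: exI[of _ k] idl.subspace_0)

lemma adjoin_subset:
  assumes "is_ideal B" "A \<subseteq> B" "f \<in> B" shows "adjoin A f \<subseteq> B"
proof
  fix x assume "x \<in> adjoin A f"
  then obtain k where "x - k * f \<in> B" using assms(2) by (auto simp: adjoin_def)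
  then have "(x - k * f) + k * f \<in> B"
    using assms by (intro idl.subspace_add idl.subspace_scale)
  then show "x \<in> B" by simp
qed

lemma adjoin_commute: "is_ideal A \<Longrightarrow> adjoin (adjoin A f) g = adjoin (adjoin A g) f"
  by (simp add: adjoin_eq_span[of A] adjoin_span insert_commute)

lemma adjoin_cong:
  assumes "is_ideal A" "f - g \<in> A" shows "adjoin A f = adjoin A g"
proof -
  have *: "adjoin A f \<subseteq> adjoin A g" if "f - g \<in> A" for f g
  proof (rule adjoin_subset)
    have "(f - g) + 1 * g \<in> adjoin A g"
      using that assms(1) by (intro idl.subspace_add mem_adjoin_left mem_adjoin_right) auto
    then show "f \<in> adjoin A g" by simp
  qed (use assms in \<open>auto intro: mem_adjoin_left\<close>)
  have "g - f \<in> A" using idl.subspace_neg[OF assms] by simp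
  then show ?thesis using * assms by blast
qed

definition nzd :: "'a::comm_ring_1 set \<Rightarrow> 'a \<Rightarrow> bool" where
  "nzd A f \<longleftrightarrow> (\<forall>x. f * x \<in> A \<longrightarrow> x \<in> A)"

lemma nzdD: "nzd A f \<Longrightarrow> f * x \<in> A \<Longrightarrow> x \<in> A" by (simp add: nzd_def)

lemma nzd_mult: "nzd A f \<Longrightarrow> nzd A g \<Longrightarrow> nzd A (f * g)"
  unfolding nzd_def mult.assoc by blast

lemma nzd_power: "nzd A f \<Longrightarrow> nzd A (f ^ n)"
  by (induction n) (simp_all add: nzd_mult, simp add: nzd_def)

lemma nzd_factor: "is_ideal A \<Longrightarrow> nzd A (f * g) \<Longrightarrow> nzd A g"
  unfolding nzd_def using idl.subspace_scale[of A _ f] unfolding mult.assoc by blast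

lemma nzd_cong:
  assumes "is_ideal A" "f - g \<in> A" "nzd A g" shows "nzd A f"
  unfolding nzd_def
proof (intro allI impI)
  fix x assume "f * x \<in> A"
  then have "f * x - x * (f - g) \<in> A"
    using idl.subspace_diff[OF assms(1) _ idl.subspace_scale[OF assms(1,2)]] by blast
  then have "g * x \<in> A" by (simp add: algebra_simps)
  then show "x \<in> A" using assms(3) nzdD by blast
qed

lemma nzd_minus: "is_ideal A \<Longrightarrow> nzd A f \<Longrightarrow> nzd A (- f)"
  unfolding nzd_def using idl.subspace_neg[of A] by fastforce

fun adjoins :: "'a::comm_ring_1 set \<Rightarrow> 'a list \<Rightarrow> 'a set" where
  "adjoins A [] = A"
| "adjoins A (f # fs) = adjoins (adjoin A f) fs"

lemma adjoins_span: "adjoins (idl.span G) fs = idl.span (G \<union> set fs)"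
  by (induction fs arbitrary: G) (simp_all add: adjoin_span)

lemma adjoins_eq_span: "is_ideal A \<Longrightarrow> adjoins A fs = idl.span (A \<union> set fs)"
  using adjoins_span[of A fs] idl.span_eq_iff[THEN iffD2, of A] by simp

lemma is_ideal_adjoins [intro, simp]: "is_ideal A \<Longrightarrow> is_ideal (adjoins A fs)"
  by (simp add: adjoins_eq_span)

lemma adjoins_append: "adjoins A (fs @ gs) = adjoins (adjoins A fs) gs"
  by (induction fs arbitrary: A) simp_all

lemma adjoins_adjoin: "is_ideal A \<Longrightarrow> adjoins (adjoin A f) fs = adjoin (adjoins A fs) f"
  by (induction fs arbitrary: A) (simp_all add: adjoin_commute)

lemma mem_adjoins_left: "is_ideal A \<Longrightarrow> x \<in> A \<Longrightarrow> x \<in> adjoins A fs"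
  by (simp add: adjoins_eq_span idl.span_base)

lemma mem_adjoins_right: "is_ideal A \<Longrightarrow> x \<in> set fs \<Longrightarrow> x \<in> adjoins A fs"
  by (simp add: adjoins_eq_span idl.span_base)

lemma adjoins_mono: "is_ideal A \<Longrightarrow> set fs \<subseteq> set gs \<Longrightarrow> adjoins A fs \<subseteq> adjoins A gs"
  using idl.span_mono[of "A \<union> set fs" "A \<union> set gs"] by (auto simp: adjoins_eq_span)

text \<open>Properness of the final quotient is left out here. It is checked once, at the very end,
  by looking at constant terms.\<close>

fun regular_list :: "'a::comm_ring_1 set \<Rightarrow> 'a list \<Rightarrow> bool" where
  "regular_list A [] \<longleftrightarrow> True"
| "regular_list A (f # fs) \<longleftrightarrow> nzd A f \<and> regular_list (adjoin A f) fs"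

lemma regular_list_append:
  "regular_list A (fs @ gs) \<longleftrightarrow> regular_list A fs \<and> regular_list (adjoins A fs) gs"
  by (induction fs arbitrary: A) auto

lemma regular_list_snoc: "regular_list A (fs @ [f]) \<longleftrightarrow> regular_list A fs \<and> nzd (adjoins A fs) f"
  by (simp add: regular_list_append)

lemma regular_list_nth:
  "regular_list A fs \<longleftrightarrow> (\<forall>i<length fs. nzd (adjoins A (take i fs)) (fs ! i))"
proof (induction fs rule: rev_induct)
  case (snoc f fs)
  have "(\<forall>i<length (fs @ [f]). nzd (adjoins A (take i (fs @ [f]))) ((fs @ [f]) ! i)) \<longleftrightarrow>
    (\<forall>i<length fs. nzd (adjoins A (take i fs)) (fs ! i)) \<and> nzd (adjoins A fs) f"
    by (auto simp: less_Suc_eq nth_append)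
  then show ?case by (simp add: regular_list_snoc snoc)
qed simp

text \<open>Linkage: \<open>J : e = B\<close> and \<open>J : B = J + (e)\<close>.\<close>

definition linked :: "'a::comm_ring_1 set \<Rightarrow> 'a \<Rightarrow> 'a set \<Rightarrow> bool" where
  "linked J e B \<longleftrightarrow> J \<subseteq> B \<and> (\<forall>x. e * x \<in> J \<longleftrightarrow> x \<in> B) \<and>
     (\<forall>x. (\<forall>b\<in>B. x * b \<in> J) \<longrightarrow> x \<in> adjoin J e)"

lemma linked_refl: "is_ideal J \<Longrightarrow> linked J 1 J"
proof -
  assume "is_ideal J"
  then have "x \<in> adjoin J 1" for x using mem_adjoin_right[of J x 1] by simp
  then show ?thesis by (simp add: linked_def)
qed

text \<open>Since \<open>f\<close> is regular modulo \<open>A\<close>,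
  \<open>J : e f = (A + (f g)) : f = A + (g)\<close>. Conversely, if \<open>x\<close> multiplies
  \<open>A + (g)\<close> into \<open>J\<close>, then \<open>x\<close> is some \<open>v e\<close>
  modulo \<open>J\<close> with \<open>v g\<close> in \<open>A + (f g)\<close>; as \<open>g\<close>
  is regular modulo \<open>A\<close>, \<open>v\<close> lies in \<open>A + (f)\<close>, and
  \<open>e A\<close> lies in \<open>J\<close>. Iteration strips one factor after another from a
  complete intersection of products.\<close>

lemma linked_step:
  assumes J: "is_ideal J" and A: "is_ideal A" and l: "linked J e (adjoin A (f * g))"
    and f: "nzd A f" and g: "nzd A g"
  shows "linked J (e * f) (adjoin A g)"
  unfolding linked_def
proof (intro conjI allI impI)
  have fg: "f * g \<in> adjoin A g" using mem_adjoin_right[OF A] .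
  have sub: "adjoin A (f * g) \<subseteq> adjoin A g"
    using A by (intro adjoin_subset fg) (auto intro: mem_adjoin_left)
  then show "J \<subseteq> adjoin A g" using l by (auto simp: linked_def)
  have el: "e * x \<in> J \<longleftrightarrow> x \<in> adjoin A (f * g)" for x using l by (simp add: linked_def)
  show "e * f * x \<in> J \<longleftrightarrow> x \<in> adjoin A g" for x
  proof
    assume "e * f * x \<in> J"
    then have "f * x \<in> adjoin A (f * g)" using el[of "f * x"] by (simp add: mult.assoc)
    then obtain k where "f * x - k * (f * g) \<in> A" by (auto simp: adjoin_def)
    then have "f * (x - k * g) \<in> A" by (simp add: algebra_simps)
    then show "x \<in> adjoin A g" using f nzdD by (auto simp: adjoin_def)
  next
    assume "x \<in> adjoin A g"
    then obtain k where "x - k * g \<in> A" by (auto simp: adjoin_def)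
    then have "f * (x - k * g) \<in> A" using A idl.subspace_scale by blast
    then have "f * x \<in> adjoin A (f * g)" by (auto simp: adjoin_def algebra_simps)
    then show "e * f * x \<in> J" using el[of "f * x"] by (simp add: mult.assoc)
  qed
  fix x assume x: "\<forall>b\<in>adjoin A g. x * b \<in> J"
  then have "\<forall>b\<in>adjoin A (f * g). x * b \<in> J" using sub by blast
  then have "x \<in> adjoin J e" using l by (simp add: linked_def)
  then obtain v where v: "x - v * e \<in> J" by (auto simp: adjoin_def)
  have "x * g \<in> J" using x mem_adjoin_right[OF A, of 1 g] by simp
  then have "x * g - g * (x - v * e) \<in> J"
    using idl.subspace_diff[OF J _ idl.subspace_scale[OF J v]] by blast
  then have "e * (v * g) \<in> J" by (simp add: algebra_simps)
  then have "v * g \<in> adjoin A (f * g)" using el[of "v * g"] by simp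
  then obtain k where "v * g - k * (f * g) \<in> A" by (auto simp: adjoin_def)
  then have "g * (v - k * f) \<in> A" by (simp add: algebra_simps)
  then have "v - k * f \<in> A" using g nzdD by blast
  then have "e * (v - k * f) \<in> J" using el[of "v - k * f"] mem_adjoin_left by blast
  then have "(x - v * e) + e * (v - k * f) \<in> J" using v J by (intro idl.subspace_add)
  then have "x - k * (e * f) \<in> J" by (simp add: algebra_simps)
  then show "x \<in> adjoin J (e * f)" by (auto simp: adjoin_def)
qed

section \<open>Linear maps given by their values on monomials\<close>

abbreviation monom :: "('v \<Rightarrow>\<^sub>0 nat) \<Rightarrow> ('v, 'k::field) mpoly" where
  "monom m \<equiv> Poly_Mapping.single m 1"

abbreviation cst :: "'k::field \<Rightarrow> ('v, 'k) mpoly" where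
  "cst c \<equiv> Poly_Mapping.single 0 c"

lemma cst_mult_monom: "cst c * monom m = Poly_Mapping.single m c"
  by (simp add: mult_single)

definition lin :: "(('v \<Rightarrow>\<^sub>0 nat) \<Rightarrow> ('w, 'k::field) mpoly) \<Rightarrow> ('v, 'k) mpoly \<Rightarrow> ('w, 'k) mpoly" where
  "lin \<phi> p = (\<Sum>m \<in> Poly_Mapping.keys p. cst (Poly_Mapping.lookup p m) * \<phi> m)"

lemma lin_superset:
  "finite B \<Longrightarrow> Poly_Mapping.keys p \<subseteq> B \<Longrightarrow> lin \<phi> p = (\<Sum>m\<in>B. cst (Poly_Mapping.lookup p m) * \<phi> m)"
  unfolding lin_def by (rule sum.mono_neutral_left) (auto simp: in_keys_iff)

lemma lin_zero [simp]: "lin \<phi> 0 = 0"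
  by (simp add: lin_def)

lemma lin_add: "lin \<phi> (p + q) = lin \<phi> p + lin \<phi> q"
proof -
  let ?B = "Poly_Mapping.keys p \<union> Poly_Mapping.keys q"
  have "lin \<phi> (p + q) = (\<Sum>m\<in>?B. cst (Poly_Mapping.lookup (p + q) m) * \<phi> m)"
    by (rule lin_superset) (use keys_add[of p q] in auto)
  then show ?thesis
    by (simp add: lin_superset[of ?B p] lin_superset[of ?B q] lookup_add single_add
        distrib_right sum.distrib)
qed

lemma lin_sum: "lin \<phi> (sum p I) = (\<Sum>i\<in>I. lin \<phi> (p i))"
  by (induction I rule: infinite_finite_induct) (simp_all add: lin_add)

lemma lin_single: "lin \<phi> (Poly_Mapping.single m c) = cst c * \<phi> m"
  by (simp add: lin_def)

lemma mpoly_eq_sum: "p = (\<Sum>m\<in>Poly_Mapping.keys p. Poly_Mapping.single m (Poly_Mapping.lookup p m))"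
proof (rule poly_mapping_eqI)
  fix k
  show "Poly_Mapping.lookup p k =
    Poly_Mapping.lookup (\<Sum>m\<in>Poly_Mapping.keys p. Poly_Mapping.single m (Poly_Mapping.lookup p m)) k"
    by (simp add: lookup_sum lookup_single when_def in_keys_iff)
qed

lemma lin_monom [simp]: "lin monom p = p"
  using mpoly_eq_sum[of p] by (simp add: lin_def cst_mult_monom)

text \<open>The common source of the product rules for coefficients, homogeneous parts and 0-1
  evaluations below. Asking for the equation only on the supports lets a special shape of
  \<open>b\<close> enter.\<close>

lemma lin_mult:
  assumes "\<And>n k. n \<in> Poly_Mapping.keys b \<Longrightarrow> k \<in> Poly_Mapping.keys p \<Longrightarrow> \<phi> (n + k) = \<chi> n * \<psi> k"
  shows "lin \<phi> (b * p) = lin \<chi> b * lin \<psi> p"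
proof -
  let ?l = "Poly_Mapping.lookup"
  have "b * p = (\<Sum>n\<in>Poly_Mapping.keys b. \<Sum>k\<in>Poly_Mapping.keys p.
      Poly_Mapping.single (n + k) (?l b n * ?l p k))"
    by (subst mpoly_eq_sum[of b], subst mpoly_eq_sum[of p])
      (simp add: sum_product mult_single)
  then have "lin \<phi> (b * p) = (\<Sum>n\<in>Poly_Mapping.keys b. \<Sum>k\<in>Poly_Mapping.keys p.
      cst (?l b n * ?l p k) * \<phi> (n + k))"
    by (simp add: lin_sum lin_single)
  also have "\<dots> = (\<Sum>n\<in>Poly_Mapping.keys b. \<Sum>k\<in>Poly_Mapping.keys p.
      (cst (?l b n) * \<chi> n) * (cst (?l p k) * \<psi> k))"
  proof (intro sum.cong refl)
    fix n k assume "n \<in> Poly_Mapping.keys b" "k \<in> Poly_Mapping.keys p"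
    then show "cst (?l b n * ?l p k) * \<phi> (n + k) =
        (cst (?l b n) * \<chi> n) * (cst (?l p k) * \<psi> k)"
      using assms by (simp add: mult_ac flip: mult_single[of 0 _ 0, simplified])
  qed
  also have "\<dots> = lin \<chi> b * lin \<psi> p"
    by (simp add: lin_def sum_product)
  finally show ?thesis .
qed

lemma lin_fun_sum: "lin (\<lambda>m. \<Sum>i\<in>I. \<phi> i m) p = (\<Sum>i\<in>I. lin (\<phi> i) p)"
  by (simp add: lin_def sum_distrib_left sum.swap[of _ I])

lemma lin_fun_mult: "lin (\<lambda>m. c * \<phi> m) p = c * lin \<phi> p"
  by (simp add: lin_def sum_distrib_left mult_ac)

lemma lin_cong: "(\<And>m. m \<in> Poly_Mapping.keys p \<Longrightarrow> \<phi> m = \<psi> m) \<Longrightarrow> lin \<phi> p = lin \<psi> p"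
  by (simp add: lin_def)

lemma lin_minus: "lin \<phi> (- p) = - lin \<phi> p"
  using lin_add[of \<phi> p "- p"] by (simp add: eq_neg_iff_add_eq_0 add.commute)

lemma lin_diff: "lin \<phi> (p - q) = lin \<phi> p - lin \<phi> q"
  using lin_add[of \<phi> p "- q"] by (simp add: lin_minus)


section \<open>Subsets of the variables\<close>

text \<open>All computations take place in the ring of polynomials in every variable of the type;
  \<open>polys V\<close> is the ring of the theorem. Ideals are generated in the large ring and are
  contracted to \<open>polys V\<close> only when depth is evaluated.\<close>

definition polys :: "'v set \<Rightarrow> ('v, 'k::field) mpoly set" where
  "polys V = {p. \<forall>m \<in> Poly_Mapping.keys p. Poly_Mapping.keys m \<subseteq> V}"

lemma carrier_poly_ring: "carrier (poly_ring V) = polys V"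
  by (simp add: poly_ring_def polys_def)

lemma polys_ring_ops:
  fixes p q :: "('v, 'k::field) mpoly"
  shows "(0 :: ('v, 'k) mpoly) \<in> polys V" "(1 :: ('v, 'k) mpoly) \<in> polys V"
  "(cst c :: ('v, 'k) mpoly) \<in> polys V"
  "p \<in> polys V \<Longrightarrow> q \<in> polys V \<Longrightarrow> p + q \<in> polys V"
  "p \<in> polys V \<Longrightarrow> q \<in> polys V \<Longrightarrow> p * q \<in> polys V"
  "p \<in> polys V \<Longrightarrow> - p \<in> polys V"
  "p \<in> polys V \<Longrightarrow> q \<in> polys V \<Longrightarrow> p - q \<in> polys V"
proof -
  interpret R: cring "poly_ring V :: ('v, 'k) mpoly ring" by (rule cring_poly_ring)
  have [simp]: "x \<oplus>\<^bsub>poly_ring V\<^esub> y = x + y" "x \<otimes>\<^bsub>poly_ring V\<^esub> y = x * y" for x y :: "('v, 'k) mpoly"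
    by (simp_all add: poly_ring_def)
  show add: "p + q \<in> polys V" if "p \<in> polys V" "q \<in> polys V" for p q :: "('v, 'k) mpoly"
    using R.a_closed[of p q] that by (simp add: carrier_poly_ring)
  show "p * q \<in> polys V" if "p \<in> polys V" "q \<in> polys V"
    using R.m_closed[of p q] that by (simp add: carrier_poly_ring)
  show minus: "- p \<in> polys V" if "p \<in> polys V" for p :: "('v, 'k) mpoly"
    using that by (auto simp: polys_def)
  show "p - q \<in> polys V" if "p \<in> polys V" "q \<in> polys V"
    using add[OF that(1) minus[OF that(2)]] by simp
qed (auto simp: polys_def)

lemma polys_power: "p \<in> polys V \<Longrightarrow> p ^ n \<in> polys V"
  by (induction n) (auto intro: polys_ring_ops)

lemma polys_sum: "(\<And>i. i \<in> I \<Longrightarrow> p i \<in> polys V) \<Longrightarrow> sum p I \<in> polys V"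
  by (induction I rule: infinite_finite_induct) (auto intro: polys_ring_ops)

lemma X_in_polys: "v \<in> V \<Longrightarrow> X v \<in> polys V"
  using X_in_poly_ring[of v V] by (simp add: carrier_poly_ring)

lemmas polys_intros = polys_ring_ops polys_power X_in_polys

lemma polys_mono: "V \<subseteq> W \<Longrightarrow> polys V \<subseteq> polys W"
  by (auto simp: polys_def)

lemma polys_lin: "(\<And>m. m \<in> Poly_Mapping.keys p \<Longrightarrow> \<phi> m \<in> polys V) \<Longrightarrow> lin \<phi> p \<in> polys V"
  unfolding lin_def by (intro polys_sum polys_ring_ops) auto

definition restr :: "'v set \<Rightarrow> ('v \<Rightarrow>\<^sub>0 nat) \<Rightarrow> ('v \<Rightarrow>\<^sub>0 nat)" where
  "restr W m = Poly_Mapping.mapp (\<lambda>v x. if v \<in> W then x else 0) m"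

lemma lookup_restr: "Poly_Mapping.lookup (restr W m) v = (if v \<in> W then Poly_Mapping.lookup m v else 0)"
  by (simp add: restr_def lookup_mapp when_def in_keys_iff)

lemma restr_add: "restr W (m + n) = restr W m + restr W n"
  by (rule poly_mapping_eqI) (simp add: lookup_restr lookup_add)

lemma restr_compl: "restr W m + restr (- W) m = m"
  by (rule poly_mapping_eqI) (simp add: lookup_restr lookup_add)

lemma restr_empty_iff: "restr W m = 0 \<longleftrightarrow> Poly_Mapping.keys m \<subseteq> - W"
  by (auto simp: poly_mapping_eq_iff fun_eq_iff lookup_restr in_keys_iff)

lemma restr_id: "Poly_Mapping.keys m \<subseteq> W \<Longrightarrow> restr W m = m"
  by (rule poly_mapping_eqI) (auto simp: lookup_restr in_keys_iff)

lemma keys_restr: "Poly_Mapping.keys (restr W m) \<subseteq> W"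
  by (auto simp: in_keys_iff lookup_restr split: if_splits)

text \<open>The coefficient of the monomial \<open>m\<close> in the variables \<open>W\<close>,
  itself a polynomial in the other variables. For \<open>W = - V\<close> this is linear over
  \<open>polys V\<close>, and for \<open>m = 0\<close> a retraction onto \<open>polys V\<close>,
  which is how ideals pass between the two rings.\<close>

definition coef :: "'v set \<Rightarrow> ('v \<Rightarrow>\<^sub>0 nat) \<Rightarrow> ('v, 'k::field) mpoly \<Rightarrow> ('v, 'k) mpoly" where
  "coef W m = lin (\<lambda>k. if restr W k = m then monom (restr (- W) k) else 0)"

lemma coef_mult:
  assumes "b \<in> polys (- W)" shows "coef W m (b * p) = b * coef W m p"
proof -
  have "coef W m (b * p) = lin monom b * coef W m p"
    unfolding coef_def
  proof (rule lin_mult)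
    fix n k assume "n \<in> Poly_Mapping.keys b"
    then have "restr W n = 0" "restr (- W) n = n"
      using assms by (auto simp: polys_def restr_empty_iff intro: restr_id)
    then show "(if restr W (n + k) = m then monom (restr (- W) (n + k)) else 0) =
        monom n * (if restr W k = m then monom (restr (- W) k) else (0 :: ('a, 'b) mpoly))"
      by (simp add: restr_add mult_single)
  qed
  then show ?thesis by simp
qed

lemma coef_in_polys: "coef W m p \<in> polys (- W)"
  unfolding coef_def using keys_restr[of "- W"] by (intro polys_lin) (auto simp: polys_def)

lemma coef_0: "p \<in> polys (- W) \<Longrightarrow> coef W 0 p = p"
  unfolding coef_def
  by (rule trans[OF lin_cong lin_monom]) (auto simp: polys_def restr_empty_iff restr_id)

lemma mem_if_coefs:
  assumes A: "is_ideal A" and c: "\<And>m. coef W m p \<in> A" shows "p \<in> A"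
proof -
  let ?M = "restr W ` Poly_Mapping.keys p"
  have "(\<Sum>m\<in>?M. monom m * coef W m p) =
      lin (\<lambda>k. \<Sum>m\<in>?M. monom m * (if restr W k = m then monom (restr (- W) k) else 0)) p"
    by (simp add: coef_def lin_fun_sum lin_fun_mult)
  also have "\<dots> = lin monom p"
  proof (rule lin_cong)
    fix k assume k: "k \<in> Poly_Mapping.keys p"
    have "(\<Sum>m\<in>?M. monom m * (if restr W k = m then monom (restr (- W) k) else 0)) =
        (\<Sum>m\<in>?M. if restr W k = m then monom (restr W k) * monom (restr (- W) k) else (0 :: ('a, 'b) mpoly))"
      by (intro sum.cong) auto
    also have "\<dots> = monom k" using k by (simp add: mult_single restr_compl)
    finally show "(\<Sum>m\<in>?M. monom m * (if restr W k = m then monom (restr (- W) k) else 0)) =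
        (monom k :: ('a, 'b) mpoly)" .
  qed
  finally have "p = (\<Sum>m\<in>?M. monom m * coef W m p)" by simp
  moreover have "\<dots> \<in> A" using A c by (intro idl.subspace_sum idl.subspace_scale)
  ultimately show ?thesis by simp
qed

lemma coef_span:
  assumes "G \<subseteq> polys (- W)" "x \<in> idl.span G" shows "coef W m x \<in> idl.span G"
  using assms(2)
proof (induction rule: idl.span_induct_alt)
  case base
  then show ?case by (simp add: coef_def idl.span_zero)
next
  case (step c x y)
  have "coef W m (x * c + y) = coef W m (x * c) + coef W m y" by (simp add: coef_def lin_add)
  also have "coef W m (x * c) = x * coef W m c" using assms(1) step(1) by (intro coef_mult) auto
  finally have "coef W m (c * x + y) = coef W m c * x + coef W m y" by (simp add: mult.commute)
  then show ?case using step by (simp add: idl.span_add idl.span_scale idl.span_base)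
qed

text \<open>The generators are free of \<open>v\<close>, so membership can be tested on the
  coefficients of the powers of \<open>v\<close>. As \<open>X v - q\<close> is monic in
  \<open>v\<close>, the coefficients of \<open>x\<close> enter the ideal one by one from the
  top.\<close>

lemma nzd_monic:
  assumes G: "G \<subseteq> polys (- {v})" and q: "q \<in> polys (- {v})"
  shows "nzd (idl.span G) (X v - q :: ('v, 'k::field) mpoly)"
  unfolding nzd_def
proof (intro allI impI)
  fix x :: "('v, 'k) mpoly" assume x: "(X v - q) * x \<in> idl.span G"
  let ?c = "\<lambda>j. coef {v} (Poly_Mapping.single v j)"
  have restr_v: "restr {v} k = Poly_Mapping.single v (Poly_Mapping.lookup k v)" for k
    by (rule poly_mapping_eqI) (simp add: lookup_restr lookup_single when_def)
  have single_inj: "Poly_Mapping.single v i = Poly_Mapping.single v j \<longleftrightarrow> i = j" for i j :: nat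
    by (metis lookup_single_eq)
  have shift: "?c (Suc j) (X v * x) = ?c j x" for j
  proof -
    have "?c (Suc j) (X v * x) = lin (\<lambda>_. 1) (X v :: ('v, 'k) mpoly) * ?c j x"
      unfolding coef_def
    proof (rule lin_mult)
      fix n k assume "n \<in> Poly_Mapping.keys (X v :: ('v, 'k) mpoly)"
      then have n: "n = Poly_Mapping.single v 1" by (simp add: X_def split: if_splits)
      have r: "restr {v} (n + k) = Poly_Mapping.single v (Suc (Poly_Mapping.lookup k v))"
        by (simp add: restr_v lookup_add n)
      have "restr (- {v}) n = 0" by (simp add: n restr_empty_iff)
      then have r': "restr (- {v}) (n + k) = restr (- {v}) k" by (simp add: restr_add)
      show "(if restr {v} (n + k) = Poly_Mapping.single v (Suc j) then monom (restr (- {v}) (n + k)) else 0) =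
        1 * (if restr {v} k = Poly_Mapping.single v j then monom (restr (- {v}) k) else (0 :: ('v, 'k) mpoly))"
        unfolding r r' restr_v[of k] by (simp add: single_inj)
    qed
    then show ?thesis by (simp add: X_def lin_single)
  qed
  \<comment> \<open>\<open>J\<close> exceeds the degree of \<open>x\<close> in \<open>v\<close>, so
    the descent along \<open>J - i\<close> starts from a zero coefficient. For \<open>x = 0\<close>
    the maximum is unspecified, but then every coefficient is zero.\<close>
  define J where "J = Suc (Max ((\<lambda>k. Poly_Mapping.lookup k v) ` Poly_Mapping.keys x))"
  have big: "?c j x = 0" if "j \<ge> J" for j
  proof -
    have "lin (\<lambda>k. if restr {v} k = Poly_Mapping.single v j then monom (restr (- {v}) k) else 0) x
        = lin (\<lambda>_. 0 :: ('v, 'k) mpoly) x"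
    proof (rule lin_cong)
      fix k assume "k \<in> Poly_Mapping.keys x"
      then have "Poly_Mapping.lookup k v < J"
        unfolding J_def by (intro le_imp_less_Suc Max_ge) auto
      then show "(if restr {v} k = Poly_Mapping.single v j then monom (restr (- {v}) k) else 0) = (0 :: ('v, 'k) mpoly)"
        using that by (simp add: restr_v single_inj)
    qed
    then show ?thesis by (simp add: coef_def lin_def)
  qed
  have "?c (J - i) x \<in> idl.span G" for i
  proof (induction i)
    case 0
    then show ?case by (simp add: big idl.span_zero)
  next
    case (Suc i)
    show ?case
    proof (cases "J - i")
      case 0
      then show ?thesis using Suc by simp
    next
      case (Suc j)
      have "?c (Suc j) ((X v - q) * x) = ?c j x - q * ?c (Suc j) x"
        using coef_mult[OF q, of "Poly_Mapping.single v (Suc j)" x]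
        by (simp add: left_diff_distrib coef_def lin_diff)
          (simp add: shift[unfolded coef_def])
      moreover have "?c (Suc j) ((X v - q) * x) \<in> idl.span G"
        by (rule coef_span[OF G x])
      moreover have "q * ?c (Suc j) x \<in> idl.span G"
        using Suc.IH Suc by (simp add: idl.span_scale)
      ultimately have "?c j x \<in> idl.span G"
        using idl.span_add[of "?c j x - q * ?c (Suc j) x" G "q * ?c (Suc j) x"] by simp
      moreover have "J - Suc i = j" using Suc by simp
      ultimately show ?thesis by simp
    qed
  qed
  then have all: "?c j x \<in> idl.span G" for j
    by (cases "j \<le> J") (metis diff_diff_cancel, simp add: big idl.span_zero)
  show "x \<in> idl.span G"
  proof (rule mem_if_coefs)
    fix m
    show "coef {v} m x \<in> idl.span G"
    proof (cases "m = Poly_Mapping.single v (Poly_Mapping.lookup m v)")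
      case True
      then show ?thesis using all by metis
    next
      case False
      then have "restr {v} k \<noteq> m" for k
        unfolding restr_v by (metis lookup_single_eq)
      then show ?thesis by (simp add: coef_def lin_def idl.span_zero)
    qed
  qed simp
qed


section \<open>Weighted homogeneous ideals\<close>

definition wdeg :: "('v \<Rightarrow> nat) \<Rightarrow> ('v \<Rightarrow>\<^sub>0 nat) \<Rightarrow> nat" where
  "wdeg \<omega> m = (\<Sum>v\<in>Poly_Mapping.keys m. \<omega> v * Poly_Mapping.lookup m v)"

lemma wdeg_add: "wdeg \<omega> (m + n) = wdeg \<omega> m + wdeg \<omega> n"
  unfolding wdeg_def by (rule setsum_keys_plus_distrib) (simp_all add: distrib_left)

lemma wdeg_single [simp]: "wdeg \<omega> (Poly_Mapping.single v n) = \<omega> v * n"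
  by (simp add: wdeg_def)

lemma wdeg_zero [simp]: "wdeg \<omega> 0 = 0"
  by (simp add: wdeg_def)

definition homog :: "('v \<Rightarrow> nat) \<Rightarrow> nat \<Rightarrow> ('v, 'k::field) mpoly \<Rightarrow> bool" where
  "homog \<omega> d p \<longleftrightarrow> (\<forall>m \<in> Poly_Mapping.keys p. wdeg \<omega> m = d)"

lemma homog_zero: "homog \<omega> d 0" and homog_one: "homog \<omega> 0 1" and homog_cst: "homog \<omega> 0 (cst c)"
  by (auto simp: homog_def)

lemma homog_X: "\<omega> v = d \<Longrightarrow> homog \<omega> d (X v)"
  by (auto simp: homog_def X_def)

lemma homog_minus: "homog \<omega> d p \<Longrightarrow> homog \<omega> d (- p)"
  by (simp add: homog_def)

lemma homog_add: "homog \<omega> d p \<Longrightarrow> homog \<omega> d q \<Longrightarrow> homog \<omega> d (p + q)"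
  using keys_add[of p q] by (auto simp: homog_def)

lemma homog_diff: "homog \<omega> d p \<Longrightarrow> homog \<omega> d q \<Longrightarrow> homog \<omega> d (p - q)"
  using homog_add[of \<omega> d p "- q"] by (simp add: homog_minus)

lemma homog_mult: "homog \<omega> d p \<Longrightarrow> homog \<omega> e q \<Longrightarrow> d + e = n \<Longrightarrow> homog \<omega> n (p * q)"
  unfolding homog_def
proof
  fix m assume a: "\<forall>m\<in>Poly_Mapping.keys p. wdeg \<omega> m = d" "\<forall>m\<in>Poly_Mapping.keys q. wdeg \<omega> m = e"
    "d + e = n" "m \<in> Poly_Mapping.keys (p * q)"
  then obtain k l where "m = k + l" "k \<in> Poly_Mapping.keys p" "l \<in> Poly_Mapping.keys q"
    using keys_mult[of p q] by blast
  then show "wdeg \<omega> m = n" using a by (simp add: wdeg_add)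
qed

lemma homog_cong: "p \<in> polys V \<Longrightarrow> (\<And>v. v \<in> V \<Longrightarrow> \<omega> v = \<omega>' v) \<Longrightarrow> homog \<omega> d p \<Longrightarrow> homog \<omega>' d p"
  unfolding homog_def
proof
  fix m assume a: "p \<in> polys V" "\<And>v. v \<in> V \<Longrightarrow> \<omega> v = \<omega>' v"
    "\<forall>m\<in>Poly_Mapping.keys p. wdeg \<omega> m = d" "m \<in> Poly_Mapping.keys p"
  have "\<omega>' v = \<omega> v" if "v \<in> Poly_Mapping.keys m" for v
    using a(1,4) that by (intro a(2)[symmetric]) (auto simp: polys_def)
  then have "wdeg \<omega>' m = wdeg \<omega> m"
    unfolding wdeg_def by simp
  then show "wdeg \<omega>' m = d" using a by simp
qed

definition hpart :: "('v \<Rightarrow> nat) \<Rightarrow> nat \<Rightarrow> ('v, 'k::field) mpoly \<Rightarrow> ('v, 'k) mpoly" where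
  "hpart \<omega> n = lin (\<lambda>k. if wdeg \<omega> k = n then monom k else 0)"

lemma hpart_mult:
  assumes "homog \<omega> d f"
  shows "hpart \<omega> n (f * p) = (if d \<le> n then f * hpart \<omega> (n - d) p else 0)"
proof (cases "d \<le> n")
  case True
  have "hpart \<omega> n (f * p) = lin monom f * hpart \<omega> (n - d) p"
    unfolding hpart_def
    by (rule lin_mult) (use assms True in \<open>auto simp: homog_def wdeg_add mult_single\<close>)
  then show ?thesis using True by simp
next
  case False
  have "hpart \<omega> n (f * p) = lin monom f * lin (\<lambda>_. 0) p"
    unfolding hpart_def
    by (rule lin_mult) (use assms False in \<open>auto simp: homog_def wdeg_add\<close>)
  then show ?thesis using False by (simp add: lin_def)
qed

lemma hpart_homog: "homog \<omega> d f \<Longrightarrow> hpart \<omega> d f = f"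
  unfolding hpart_def by (rule trans[OF lin_cong lin_monom]) (simp add: homog_def)

lemma mem_if_hparts:
  assumes A: "is_ideal A" and c: "\<And>n. hpart \<omega> n p \<in> A" shows "p \<in> A"
proof -
  let ?M = "wdeg \<omega> ` Poly_Mapping.keys p"
  have "(\<Sum>n\<in>?M. hpart \<omega> n p) = lin (\<lambda>k. \<Sum>n\<in>?M. if wdeg \<omega> k = n then monom k else 0) p"
    by (simp only: hpart_def lin_fun_sum)
  also have "\<dots> = lin monom p" by (rule lin_cong) simp
  finally have "p = (\<Sum>n\<in>?M. hpart \<omega> n p)" by simp
  moreover have "\<dots> \<in> A" using A c by (intro idl.subspace_sum)
  ultimately show ?thesis by simp
qed

definition homog_ideal :: "('v \<Rightarrow> nat) \<Rightarrow> ('v, 'k::field) mpoly set \<Rightarrow> bool" where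
  "homog_ideal \<omega> A \<longleftrightarrow> is_ideal A \<and> (\<forall>x\<in>A. \<forall>n. hpart \<omega> n x \<in> A)"

lemma homog_ideal_span:
  assumes "\<And>g. g \<in> G \<Longrightarrow> \<exists>d. homog \<omega> d g" shows "homog_ideal \<omega> (idl.span G)"
  unfolding homog_ideal_def
proof (intro conjI ballI allI)
  fix x n assume "x \<in> idl.span G"
  then show "hpart \<omega> n x \<in> idl.span G"
  proof (induction rule: idl.span_induct_alt)
    case base
    then show ?case by (simp add: hpart_def idl.span_zero)
  next
    case (step c x y)
    obtain d where d: "homog \<omega> d x" using assms step by blast
    have "hpart \<omega> n (x * c + y) = hpart \<omega> n (x * c) + hpart \<omega> n y" by (simp add: hpart_def lin_add)
    then have "hpart \<omega> n (c * x + y) = hpart \<omega> n (x * c) + hpart \<omega> n y" by (simp add: mult.commute)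
    moreover have "hpart \<omega> n (x * c) \<in> idl.span G"
      unfolding hpart_mult[OF d] using idl.span_scale[OF idl.span_base[OF step(1)]]
      by (simp add: idl.span_zero mult.commute[of x])
    ultimately show ?case using step by (simp add: idl.span_add)
  qed
qed simp

lemma homog_ideal_adjoin:
  assumes "homog_ideal \<omega> A" "homog \<omega> d f" shows "homog_ideal \<omega> (adjoin A f)"
  unfolding homog_ideal_def
proof (intro conjI ballI allI)
  show A: "is_ideal (adjoin A f)" using assms by (simp add: homog_ideal_def)
  fix x n assume "x \<in> adjoin A f"
  then obtain k where k: "x - k * f \<in> A" by (auto simp: adjoin_def)
  then have "hpart \<omega> n (x - f * k) \<in> A" using assms by (simp add: homog_ideal_def mult.commute)
  then have "hpart \<omega> n x - hpart \<omega> n (f * k) \<in> A" by (simp add: hpart_def lin_diff)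
  then have "hpart \<omega> n x - (if d \<le> n then hpart \<omega> (n - d) k else 0) * f \<in> A"
    using hpart_mult[OF assms(2), of n k] by (auto simp: mult.commute)
  then show "hpart \<omega> n x \<in> adjoin A f" unfolding adjoin_def by blast
qed

text \<open>Graded Nakayama for an arbitrary set \<open>Z\<close>. The part of degree
  \<open>n\<close> of \<open>x\<close> is, modulo \<open>A\<close>, \<open>f\<close> times the part
  of degree \<open>n - d\<close> of another element of \<open>Z\<close>, so induction on the degree
  replaces finite generation.\<close>

lemma homog_nakayama:
  assumes A: "homog_ideal \<omega> A" and f: "homog \<omega> d f" "d > 0"
    and Z: "\<And>x. x \<in> Z \<Longrightarrow> \<exists>y\<in>Z. x - f * y \<in> A"
  shows "Z \<subseteq> A"
proof -
  have "hpart \<omega> n x \<in> A" if "x \<in> Z" for n x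
    using that
  proof (induction n arbitrary: x rule: less_induct)
    case (less n)
    obtain y where y: "y \<in> Z" "x - f * y \<in> A" using Z less.prems by blast
    have "hpart \<omega> n (x - f * y) \<in> A" using y A by (simp add: homog_ideal_def)
    then have "hpart \<omega> n x - hpart \<omega> n (f * y) \<in> A" by (simp add: hpart_def lin_diff)
    moreover have "hpart \<omega> n (f * y) \<in> A"
      using less.IH[of "n - d" y] y f A
      by (auto simp: hpart_mult[OF f(1)] homog_ideal_def idl.subspace_0 intro!: idl.subspace_scale)
    ultimately show ?case
      using A idl.subspace_add[of A "hpart \<omega> n x - hpart \<omega> n (f * y)" "hpart \<omega> n (f * y)"]
      by (simp add: homog_ideal_def)
  qed
  then show ?thesis using A unfolding homog_ideal_def by (blast intro: mem_if_hparts)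
qed

definition homog_list :: "('v \<Rightarrow> nat) \<Rightarrow> ('v, 'k::field) mpoly list \<Rightarrow> bool" where
  "homog_list \<omega> fs \<longleftrightarrow> (\<forall>f\<in>set fs. \<exists>d>0. homog \<omega> d f)"

lemma homog_list_simps [simp]:
  "homog_list \<omega> []"
  "homog_list \<omega> (f # fs) \<longleftrightarrow> (\<exists>d>0. homog \<omega> d f) \<and> homog_list \<omega> fs"
  "homog_list \<omega> (fs @ gs) \<longleftrightarrow> homog_list \<omega> fs \<and> homog_list \<omega> gs"
  by (auto simp: homog_list_def)

text \<open>The delicate point is that \<open>g\<close> is regular modulo \<open>A\<close> already
  before \<open>f\<close> is adjoined. If \<open>g x\<close> is in \<open>A\<close>, then
  \<open>x\<close> is in \<open>A + (f)\<close>, and the cofactor of \<open>f\<close> is again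
  killed by \<open>g\<close>; so the elements killed by \<open>g\<close> satisfy the hypothesis of
  \<open>homog_nakayama\<close>.\<close>

lemma regular_list_swap:
  assumes A: "homog_ideal \<omega> A" and h: "homog_list \<omega> (f # g # fs)"
    and r: "regular_list A (f # g # fs)"
  shows "regular_list A (g # f # fs)"
proof -
  have iA: "is_ideal A" using A by (simp add: homog_ideal_def)
  have f: "nzd A f" and g: "nzd (adjoin A f) g" and fs: "regular_list (adjoin (adjoin A f) g) fs"
    using r by auto
  obtain d where d: "homog \<omega> d f" "d > 0" using h by auto
  have "{x. g * x \<in> A} \<subseteq> A"
  proof (rule homog_nakayama[OF A d])
    fix x assume "x \<in> {x. g * x \<in> A}"
    then have gx: "g * x \<in> A" by simp
    then have "x \<in> adjoin A f" using g mem_adjoin_left by (auto simp: nzd_def)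
    then obtain y where y: "x - y * f \<in> A" by (auto simp: adjoin_def)
    have "g * x - g * (x - y * f) \<in> A"
      using gx idl.subspace_diff[OF iA _ idl.subspace_scale[OF iA y]] by blast
    then have "f * (g * y) \<in> A" by (simp add: algebra_simps)
    then have "g * y \<in> A" using f nzdD by blast
    then show "\<exists>y\<in>{x. g * x \<in> A}. x - f * y \<in> A" using y by (auto simp: mult.commute)
  qed
  then have 1: "nzd A g" by (auto simp: nzd_def)
  have 2: "nzd (adjoin A g) f"
    unfolding nzd_def
  proof (intro allI impI)
    fix x assume "f * x \<in> adjoin A g"
    then obtain y where y: "f * x - y * g \<in> A" by (auto simp: adjoin_def)
    have "x * f - (f * x - y * g) \<in> adjoin A f"
      using idl.subspace_diff[OF is_ideal_adjoin[OF iA] mem_adjoin_right[OF iA] mem_adjoin_left[OF y]] .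
    then have "g * y \<in> adjoin A f" by (simp add: algebra_simps)
    then have "y \<in> adjoin A f" using g nzdD by blast
    then obtain z where z: "y - z * f \<in> A" by (auto simp: adjoin_def)
    have "(f * x - y * g) + g * (y - z * f) \<in> A"
      using y z iA by (intro idl.subspace_add idl.subspace_scale)
    then have "f * (x - z * g) \<in> A" by (simp add: algebra_simps)
    then have "x - z * g \<in> A" using f nzdD by blast
    then show "x \<in> adjoin A g" by (auto simp: adjoin_def)
  qed
  show ?thesis using 1 2 fs iA by (simp add: adjoin_commute[of A g f])
qed

lemma regular_list_move:
  "homog_ideal \<omega> A \<Longrightarrow> homog_list \<omega> (f # us @ vs) \<Longrightarrow> regular_list A (us @ f # vs) \<longleftrightarrow> regular_list A (f # us @ vs)"
proof (induction us arbitrary: A)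
  case (Cons u us)
  have "regular_list A ((u # us) @ f # vs) \<longleftrightarrow> regular_list A (u # f # us @ vs)"
    using Cons.IH[of "adjoin A u"] Cons.prems by (auto intro: homog_ideal_adjoin)
  also have "\<dots> \<longleftrightarrow> regular_list A (f # u # us @ vs)"
    using regular_list_swap[OF Cons.prems(1), of f u "us @ vs"]
      regular_list_swap[OF Cons.prems(1), of u f "us @ vs"] Cons.prems(2)
    by (intro iffI) (simp_all del: regular_list.simps)
  finally show ?case by simp
qed simp

text \<open>This freedom is used throughout: regularity is verified with the parameters in front,
  where everything is triangular, and the minors are then moved before them.\<close>

lemma regular_list_permute:
  "homog_ideal \<omega> A \<Longrightarrow> homog_list \<omega> fs \<Longrightarrow> mset fs = mset gs \<Longrightarrow> regular_list A fs \<Longrightarrow> regular_list A gs"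
proof (induction fs arbitrary: A gs)
  case (Cons f fs)
  have "f \<in> set gs" using Cons.prems(3) by (metis list.set_intros(1) set_mset_mset)
  then obtain us vs where gs: "gs = us @ f # vs" by (meson split_list)
  have m: "mset fs = mset (us @ vs)" using Cons.prems(3) by (simp add: gs)
  have s: "set fs = set (us @ vs)" using m by (metis set_mset_mset)
  have "regular_list (adjoin A f) (us @ vs)"
    using Cons.IH[of "adjoin A f" "us @ vs"] Cons.prems m by (auto intro: homog_ideal_adjoin)
  then have "regular_list A (f # us @ vs)" using Cons.prems by simp
  moreover have "homog_list \<omega> (f # us @ vs)" using Cons.prems(2) s by (auto simp: homog_list_def)
  ultimately show ?case using regular_list_move[OF Cons.prems(1)] gs by simp
qed simp

text \<open>The snake lemma for \<open>0 \<rightarrow> R/A \<rightarrow> R/B \<rightarrow> R/(B + y) \<rightarrow> 0\<close>, where injectivity of \<open>y\<close> is detected after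
  cutting by \<open>fs\<close>.\<close>

lemma regular_list_cokernel:
  assumes "homog_ideal \<omega> A" "homog_ideal \<omega> B" "homog_list \<omega> fs" "\<And>a. a \<in> A \<Longrightarrow> y * a \<in> B"
    "regular_list A fs" "regular_list B fs" "\<And>x. y * x \<in> adjoins B fs \<Longrightarrow> x \<in> adjoins A fs"
  shows "regular_list (adjoin B y) fs \<and> (\<forall>x. y * x \<in> B \<longrightarrow> x \<in> A)"
  using assms
proof (induction fs arbitrary: A B)
  case Nil
  then show ?case by simp
next
  case (Cons f fs)
  obtain d where d: "homog \<omega> d f" "d > 0" using Cons.prems(3) by auto
  have iA: "is_ideal A" and iB: "is_ideal B" using Cons.prems by (auto simp: homog_ideal_def)
  have fA: "nzd A f" and fB: "nzd B f" using Cons.prems by auto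
  have IH: "regular_list (adjoin (adjoin B f) y) fs \<and> (\<forall>x. y * x \<in> adjoin B f \<longrightarrow> x \<in> adjoin A f)"
  proof (rule Cons.IH)
    fix a assume "a \<in> adjoin A f"
    then obtain k where "a - k * f \<in> A" by (auto simp: adjoin_def)
    then have "y * (a - k * f) \<in> B" using Cons.prems by blast
    then have "y * a - (y * k) * f \<in> B" by (simp add: algebra_simps)
    then show "y * a \<in> adjoin B f" unfolding adjoin_def by blast
  qed (use Cons.prems d in \<open>auto intro: homog_ideal_adjoin\<close>)
  \<comment> \<open>Injectivity of \<open>y\<close> is known after cutting by \<open>f\<close>;
    Nakayama lifts it.\<close>
  have "{x. y * x \<in> B} \<subseteq> A"
  proof (rule homog_nakayama[OF Cons.prems(1) d])
    fix x assume "x \<in> {x. y * x \<in> B}"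
    then have x: "y * x \<in> B" by simp
    then have "x \<in> adjoin A f" using IH mem_adjoin_left by blast
    then obtain z where z: "x - z * f \<in> A" by (auto simp: adjoin_def)
    then have "y * x - y * (x - z * f) \<in> B" using x Cons.prems(4) idl.subspace_diff[OF iB] by blast
    then have "f * (y * z) \<in> B" by (simp add: algebra_simps)
    then have "y * z \<in> B" using fB nzdD by blast
    then show "\<exists>z\<in>{x. y * x \<in> B}. x - f * z \<in> A" using z by (auto simp: mult.commute)
  qed
  moreover have "nzd (adjoin B y) f"
    unfolding nzd_def
  proof (intro allI impI)
    fix m assume "f * m \<in> adjoin B y"
    then obtain n where n: "f * m - n * y \<in> B" by (auto simp: adjoin_def)
    have "m * f - (f * m - n * y) \<in> adjoin B f"
      using idl.subspace_diff[OF is_ideal_adjoin[OF iB] mem_adjoin_right[OF iB] mem_adjoin_left[OF n]] .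
    then have "y * n \<in> adjoin B f" by (simp add: algebra_simps)
    then have "n \<in> adjoin A f" using IH by blast
    then obtain k where "n - k * f \<in> A" by (auto simp: adjoin_def)
    then have "y * (n - k * f) \<in> B" using Cons.prems by blast
    then have "(f * m - n * y) + y * (n - k * f) \<in> B" using n iB by (intro idl.subspace_add)
    then have "f * (m - k * y) \<in> B" by (simp add: algebra_simps)
    then have "m - k * y \<in> B" using fB nzdD by blast
    then show "m \<in> adjoin B y" by (auto simp: adjoin_def)
  qed
  ultimately show ?case using IH iB by (auto simp: adjoin_commute[of B y f])
qed

lemma ideal_mem_comb:
  assumes "is_ideal M" "x \<in> M" shows "k * x \<in> M" "x * k \<in> M"
  using idl.subspace_scale[OF assms] by (simp_all add: mult.commute)

text \<open>With smaller exponents the claim holds for \<open>z h\<close> and for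
  \<open>d h\<close>; subtracting them, \<open>(z - d) h\<close> lies in \<open>M\<close>, and
  \<open>z - d\<close> can be cancelled. Thus neither \<open>z\<close> nor \<open>d\<close> has to
  be a nonzerodivisor.\<close>

lemma nzd_sub_kills:
  assumes M: "is_ideal M" and N: "nzd M (z - d)"
  shows "z ^ i * h \<in> M \<Longrightarrow> d ^ j * h \<in> M \<Longrightarrow> h \<in> M"
proof (induction "i + j" arbitrary: i j h rule: less_induct)
  case less
  show ?case
  proof (cases "i = 0 \<or> j = 0")
    case True
    then show ?thesis using less.prems by auto
  next
    case False
    then obtain i' j' where ij: "i = Suc i'" "j = Suc j'" by (metis not0_implies_Suc)
    have 1: "z ^ i' * (z * h) \<in> M" using less.prems ij by (simp add: mult_ac)
    have 2: "d ^ j * (z * h) \<in> M" using ideal_mem_comb[OF M less.prems(2), of z] by (simp add: mult_ac)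
    have zh: "z * h \<in> M" using less.hyps[of i' j "z * h"] 1 2 ij by simp
    have 3: "d ^ j' * (d * h) \<in> M" using less.prems ij by (simp add: mult_ac)
    have 4: "z ^ i * (d * h) \<in> M" using ideal_mem_comb[OF M less.prems(1), of d] by (simp add: mult_ac)
    have dh: "d * h \<in> M" using less.hyps[of i j' "d * h"] 3 4 ij by simp
    have "(z - d) * h \<in> M" using idl.subspace_diff[OF M zh dh] by (simp add: algebra_simps)
    then show ?thesis using N nzdD by blast
  qed
qed

lemma power_diff_mem:
  assumes M: "is_ideal M" and "x - y \<in> M" shows "x ^ n - y ^ n \<in> M"
  using ideal_mem_comb(2)[OF assms] by (simp add: power_diff_sumr2)

section \<open>The \<open>X\<close>-pentomino\<close>

text \<open>The colon ideal computation behind the lower bound. Away from \<open>z = 0\<close> the relations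
  eliminate \<open>a\<close>, \<open>b\<close> and \<open>c\<close>, leaving two coprime binary forms in \<open>d\<close>, \<open>z\<close> times \<open>d\<close>; on \<open>z = 0\<close>
  they make \<open>d\<close> nilpotent.\<close>

lemma X_certificate:
  fixes a b c d z :: "'a::comm_ring_1"
  assumes M: "is_ideal M" and N: "nzd M (z - d)"
    and L: "z * (a - z * c) \<in> M"
    and T: "(c - d^2 - d * z + z^2) * (c - d^2) \<in> M"
    and R: "(z^2 - b - d^2) * (b - d^2 - z * d) \<in> M"
    and B: "(a - c * z + z^3) * (a - z * b) \<in> M"
    and D: "a * d - b * c \<in> M"
  shows "a \<in> M \<and> b \<in> M \<and> c \<in> M \<and> d \<in> M"
proof -
  note add = idl.subspace_add[OF M] and diff = idl.subspace_diff[OF M] and sc = ideal_mem_comb(1)[OF M]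
  \<comment> \<open>Up to powers of \<open>z\<close> one has \<open>a = z c\<close> and
    \<open>b = c\<close>, so \<open>T\<close>, \<open>R\<close> and \<open>D\<close> become three
    relations in \<open>c, d, z\<close>. With \<open>x\<close> in place of \<open>c\<close> they are
    solved in \<open>E3\<close> as \<open>x = - d q / z^2\<close>.\<close>
  define x where "x = c - d^2"
  define q where "q = d^3 + z * d^2 - z^3"
  have 1: "z^5 * (c - b) \<in> M"
  proof -
    have "z^5 * (c - b) = z * ((a - c * z + z^3) * (a - z * b))
        - ((a - z * b) * (z * (a - z * c)) + z^3 * (z * (a - z * c)))" by (simp add: field_simps eval_nat_numeral)
    then show ?thesis by (simp only: diff[OF sc[OF B] add[OF sc[OF L] sc[OF L]]])
  qed
  have 2: "z^6 * (c * (c - z * d)) \<in> M"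
  proof -
    have "z^6 * (c * (c - z * d)) = z * c * (z^5 * (c - b)) - (z^6 * (a * d - b * c) - z^5 * d * (z * (a - z * c)))"
      by (simp add: field_simps eval_nat_numeral)
    then show ?thesis by (simp only: diff[OF sc[OF 1] diff[OF sc[OF D] sc[OF L]]])
  qed
  have E1: "z^6 * ((2 * d^2 - z^2) * x + d^3 * (d - z)) \<in> M"
  proof -
    have "z^6 * ((2 * d^2 - z^2) * x + d^3 * (d - z)) =
        z^6 * (c * (c - z * d)) - z^6 * ((c - d^2 - d * z + z^2) * (c - d^2))"
      unfolding x_def by (simp add: field_simps eval_nat_numeral)
    then show ?thesis by (simp only: diff[OF 2 sc[OF T]])
  qed
  have E2: "z^5 * (2 * (z^2 - d^2) * x + z * d * (2 * d^2 - z^2)) \<in> M"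
  proof -
    have "z^5 * (2 * (z^2 - d^2) * x + z * d * (2 * d^2 - z^2)) =
        z^5 * ((z^2 - b - d^2) * (b - d^2 - z * d)) + (z^2 + z * d - b - c) * (z^5 * (c - b))
        + z^5 * ((c - d^2 - d * z + z^2) * (c - d^2))"
      unfolding x_def by (simp add: field_simps eval_nat_numeral)
    then show ?thesis by (simp only: add[OF add[OF sc[OF R] sc[OF 1]] sc[OF T]])
  qed
  have E3: "z^6 * (z^2 * x + d * q) \<in> M"
  proof -
    have "z^6 * (z^2 * x + d * q) =
        z * (z^5 * (2 * (z^2 - d^2) * x + z * d * (2 * d^2 - z^2))) + z^6 * ((2 * d^2 - z^2) * x + d^3 * (d - z))"
      unfolding q_def by (simp add: field_simps eval_nat_numeral)
    then show ?thesis by (simp only: add[OF sc[OF E2] E1])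
  qed
  \<comment> \<open>Substituting \<open>- d q / z^2\<close> for \<open>x\<close> in \<open>T\<close>
    leaves \<open>d\<close> times a binary form of degree 7; the same substitution in
    \<open>E1\<close> gives \<open>E5\<close>, with a form of degree 5.\<close>
  have E4: "z^6 * (d * (q * (d^4 + z * d^3 - z^4))) \<in> M"
  proof -
    have "z^6 * (d * (q * (d^4 + z * d^3 - z^4))) =
        z^10 * ((c - d^2 - d * z + z^2) * (c - d^2))
        - (z^2 * x - d * q + (z^2 - d * z) * z^2) * (z^6 * (z^2 * x + d * q))"
      unfolding q_def x_def by (simp add: field_simps eval_nat_numeral)
    then show ?thesis by (simp only: diff[OF sc[OF T] sc[OF E3]])
  qed
  have E5: "z^6 * (d * (- 2 * d^5 - 2 * z * d^4 + 2 * z^2 * d^3 + 2 * z^3 * d^2 - z^5)) \<in> M"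
  proof -
    have "z^6 * (d * (- 2 * d^5 - 2 * z * d^4 + 2 * z^2 * d^3 + 2 * z^3 * d^2 - z^5)) =
        z^2 * (z^6 * ((2 * d^2 - z^2) * x + d^3 * (d - z))) - (2 * d^2 - z^2) * (z^6 * (z^2 * x + d * q))"
      unfolding q_def by (simp add: field_simps eval_nat_numeral)
    then show ?thesis by (simp only: diff[OF sc[OF E1] sc[OF E3]])
  qed
  have zd: "z^17 * d \<in> M"
  proof -
    \<comment> \<open>The two binary forms are coprime, and these cofactors of degrees 4 and 6
      combine them to exactly \<open>z^11\<close>; with the factor \<open>z^6\<close> carried along
      this makes \<open>z^17\<close>. The coefficients are integers and the constant is 1, so the
      identity serves every characteristic.\<close>
    have "z^17 * d =
        (- 4 * z^4 - 8 * d * z^3 + 12 * d^3 * z + 8 * d^4) * (z^6 * (d * (q * (d^4 + z * d^3 - z^4))))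
        + (- 5 * z^6 - 8 * d * z^5 - 6 * d^2 * z^4 + 2 * d^3 * z^3 + 10 * d^4 * z^2 + 10 * d^5 * z + 4 * d^6)
          * (z^6 * (d * (- 2 * d^5 - 2 * z * d^4 + 2 * z^2 * d^3 + 2 * z^3 * d^2 - z^5)))"
      unfolding q_def by (simp add: field_simps eval_nat_numeral)
    then show ?thesis by (simp only: add[OF sc[OF E4] sc[OF E5]])
  qed
  have zc: "z^19 * c \<in> M"
  proof -
    have "z^19 * c = z^11 * (z^6 * (z^2 * x + d * q)) - q * (z^17 * d) + z^2 * d * (z^17 * d)"
      unfolding x_def by (simp add: field_simps eval_nat_numeral)
    then show ?thesis by (simp only: add[OF diff[OF sc[OF E3] sc[OF zd]] sc[OF zd]])
  qed
  have zb: "z^19 * b \<in> M"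
  proof -
    have "z^19 * b = z^19 * c - z^14 * (z^5 * (c - b))" by (simp add: field_simps eval_nat_numeral)
    then show ?thesis by (simp only: diff[OF zc sc[OF 1]])
  qed
  have za: "z^19 * a \<in> M"
  proof -
    have "z^19 * a = z^18 * (z * (a - z * c)) + z * (z^19 * c)" by (simp add: field_simps eval_nat_numeral)
    then show ?thesis by (simp only: add[OF sc[OF L] sc[OF zc]])
  qed
  have zd': "z^19 * d \<in> M"
    using sc[OF zd, of "z^2"] by (simp add: mult.assoc flip: power_add)
  have "d^10 \<in> adjoin M z"
  proof -
    define M' where "M' = adjoin M z"
    have M': "is_ideal M'" and MM': "M \<subseteq> M'" using M by (auto simp: M'_def intro: mem_adjoin_left)
    have z: "z \<in> M'" using mem_adjoin_right[OF M, of 1 z] by (simp add: M'_def)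
    note add' = idl.subspace_add[OF M'] and diff' = idl.subspace_diff[OF M'] and sc' = ideal_mem_comb(1)[OF M']
    have a: "a * a \<in> M'"
    proof -
      have "a * a = (a - c * z + z^3) * (a - z * b) + (a * b + (c - z^2) * (a - z * b)) * z" by (simp add: field_simps eval_nat_numeral)
      then show ?thesis by (simp only: add'[OF subsetD[OF MM' B] sc'[OF z]])
    qed
    have x: "x * x \<in> M'"
    proof -
      have "x * x = (c - d^2 - d * z + z^2) * (c - d^2) - (z - d) * x * z" unfolding x_def by (simp add: field_simps eval_nat_numeral)
      then show ?thesis by (simp only: diff'[OF subsetD[OF MM' T] sc'[OF z]])
    qed
    have b: "d^4 - b^2 \<in> M'"
    proof -
      have "d^4 - b^2 = (z^2 - b - d^2) * (b - d^2 - z * d) - (z * (b - d^2 - z * d) + (b + d^2) * d) * z"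
        by (simp add: field_simps eval_nat_numeral)
      then show ?thesis by (simp only: diff'[OF subsetD[OF MM' R] sc'[OF z]])
    qed
    \<comment> \<open>Modulo \<open>z\<close> the relations give
      \<open>c^2 d^4 = c^2 b^2 = a^2 d^2 = 0\<close>, where \<open>c = d^2 + x\<close> and
      \<open>x^2 = 0\<close>. The factor \<open>d^2 - 2 x\<close> cancels the term linear in
      \<open>x\<close> and leaves \<open>d^10\<close>.\<close>
    have "d^10 = (d^2 - 2 * x) * (d^2 * (a * a) - (a * d + b * c) * (a * d - b * c) + c^2 * (d^4 - b^2))
        + (3 * d^2 + 2 * x) * d^4 * (x * x)"
      unfolding x_def by (simp add: field_simps eval_nat_numeral)
    also have "\<dots> \<in> M'"
      by (rule add'[OF sc'[OF add'[OF diff'[OF sc'[OF a] sc'[OF subsetD[OF MM' D]]] sc'[OF b]]] sc'[OF x]])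
    finally show ?thesis by (simp add: M'_def)
  qed
  then obtain g where g: "d^10 - g * z \<in> M" by (auto simp: adjoin_def)
  \<comment> \<open>19 is the largest exponent of \<open>z\<close> obtained above. As
    \<open>d^10\<close> is a multiple of \<open>z\<close> modulo \<open>M\<close>, its 19th power
    kills whatever \<open>z^19\<close> kills, and \<open>nzd_sub_kills\<close> applies.\<close>
  have "h \<in> M" if h: "z^19 * h \<in> M" for h
  proof (rule nzd_sub_kills[OF M N h])
    have "(d^10)^19 - (g * z)^19 \<in> M" by (rule power_diff_mem[OF M g])
    then have "h * ((d^10)^19 - (g * z)^19) + g^19 * (z^19 * h) \<in> M"
      by (rule add[OF sc sc[OF h]])
    then have "(d^10)^19 * h \<in> M" by (simp add: algebra_simps)
    then show "d^(10 * 19) * h \<in> M" by (simp only: power_mult)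
  qed
  then show ?thesis using za zb zc zd' by blast
qed

lemma adjoin_minus: "adjoin A (- f) = adjoin A f"
proof -
  have "adjoin A (- f) \<subseteq> adjoin A f" for f
    unfolding adjoin_def by (smt (verit) Collect_mono minus_mult_commute)
  from this[of f] this[of "- f"] show ?thesis by simp
qed

lemma regular_list_cong:
  assumes A: "is_ideal A" and fg: "f - g \<in> A \<or> f + g \<in> A" and r: "regular_list A (g # fs)"
  shows "regular_list A (f # fs)"
  using fg
proof
  assume "f - g \<in> A"
  then show ?thesis using r nzd_cong[OF A] adjoin_cong[OF A] by auto
next
  assume "f + g \<in> A"
  then have 1: "f - (- g) \<in> A" by simp
  show ?thesis
    using r nzd_cong[OF A 1] nzd_minus[OF A] adjoin_cong[OF A 1] adjoin_minus[of A g] by auto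
qed

text \<open>Modulo \<open>z - d\<close> every choice of one factor from each relation becomes triangular.\<close>

lemma X_combinations:
  fixes a b c d z :: "'a::comm_ring_1"
  assumes I: "is_ideal I" and N: "z - d \<in> I"
    and H1: "\<And>\<beta>. \<beta> \<in> {0, 2 * d^2} \<Longrightarrow> regular_list I [c - d^2, b - \<beta>, d, a]"
    and H2: "\<And>\<beta>. \<beta> \<in> {0, 2 * d^2} \<Longrightarrow> regular_list I [c - d^2, b - \<beta>, a - d^3, d^3]"
    and T: "xT \<in> {c - d^2 - d * z + z^2, c - d^2}"
    and R: "xR \<in> {z^2 - b - d^2, b - d^2 - z * d}"
    and L: "xL \<in> {z, a - z * c}"
    and B: "xB \<in> {a - c * z + z^3, a - z * b}"
  shows "regular_list I [xT, xR, xL, xB]"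
proof -
  \<comment> \<open>Modulo \<open>z - d\<close> both factors of \<open>T\<close> become
    \<open>c - d^2\<close>, while those of \<open>R\<close> become \<open>- b\<close> and
    \<open>b - 2 d^2\<close>. The parameter \<beta> is the value that the chosen factor gives to
    \<open>b\<close>.\<close>
  define I1 where "I1 = adjoin I (c - d^2)"
  define I2 where "I2 \<beta> = adjoin I1 (b - \<beta>)" for \<beta>
  have I1: "is_ideal I1" and I2: "is_ideal (I2 \<beta>)" for \<beta> using I by (auto simp: I1_def I2_def)
  have N1: "z - d \<in> I1" and N2: "z - d \<in> I2 \<beta>" for \<beta>
    using N by (auto simp: I1_def I2_def intro: mem_adjoin_left)
  have c1: "c - d^2 \<in> I1" and c2: "c - d^2 \<in> I2 \<beta>" and b2: "b - \<beta> \<in> I2 \<beta>" for \<beta>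
    using mem_adjoin_right[OF I, of 1 "c - d^2"] mem_adjoin_right[OF I1, of 1 "b - \<beta>"]
    by (auto simp: I1_def I2_def intro: mem_adjoin_left)
  note add = idl.subspace_add and diff = idl.subspace_diff and sc = ideal_mem_comb(1)
  have last: "regular_list (I2 \<beta>) [xL, xB]" if \<beta>: "\<beta> \<in> {0, 2 * d^2}" for \<beta>
  proof -
    have r1: "regular_list (I2 \<beta>) [d, a]" and r2: "regular_list (I2 \<beta>) [a - d^3, d^3]"
      using H1[OF \<beta>] H2[OF \<beta>] by (auto simp: I1_def I2_def)
    consider "xL = z" | "xL = a - z * c" using L by blast
    then show ?thesis
    proof cases
      case 1
      let ?J = "adjoin (I2 \<beta>) d"
      have J: "is_ideal ?J" using I2 by auto
      have d: "d \<in> ?J" using mem_adjoin_right[OF I2, of 1 d] by simp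
      have z: "z \<in> ?J" using add[OF J mem_adjoin_left[OF N2] d] by simp
      have "xB - a = (z^2 - c) * z \<or> xB - a = - b * z"
        using B by (auto simp: power2_eq_square power3_eq_cube algebra_simps)
      then have "xB - a \<in> ?J" using sc[OF J z] by metis
      then have "regular_list ?J [xB]" using regular_list_cong[OF J _, of xB a "[]"] r1 by auto
      then have r: "regular_list (I2 \<beta>) [d, xB]" using r1 by auto
      show ?thesis using regular_list_cong[OF I2 disjI1[OF N2] r] 1 by (simp only:)
    next
      case 2
      let ?J = "adjoin (I2 \<beta>) (a - d^3)"
      have J: "is_ideal ?J" using I2 by auto
      have a: "a - d^3 \<in> ?J" using mem_adjoin_right[OF I2, of 1 "a - d^3"] by simp
      have z: "z - d \<in> ?J" and c: "c - d^2 \<in> ?J" and b: "b - \<beta> \<in> ?J"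
        using N2 c2 b2 by (auto intro: mem_adjoin_left)
      \<comment> \<open>Here \<open>z = d\<close>, \<open>c = d^2\<close> and
        \<open>a = d^3\<close>. The first factor of \<open>B\<close> becomes \<open>d^3\<close>; the
        second becomes \<open>d^3\<close> for \<beta> \<open>= 0\<close> and
        \<open>d^3 - 2 d^3\<close> for the other \<beta>. The coefficient is a sign each time, hence
        nonzero in every characteristic.\<close>
      have "xB - d^3 \<in> ?J \<or> xB + d^3 \<in> ?J"
      proof -
        consider "xB = a - c * z + z^3" | "xB = a - z * b" "\<beta> = 0" | "xB = a - z * b" "\<beta> = 2 * d^2"
          using B \<beta> by blast
        then show ?thesis
        proof cases
          case 1
          then have "xB - d^3 = (a - d^3) - z * (c - d^2) + z * (z + d) * (z - d)"
            by (simp add: algebra_simps eval_nat_numeral)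
          then show ?thesis by (simp only: add[OF J diff[OF J a sc[OF J c]] sc[OF J z]] simp_thms)
        next
          case 2
          then have "xB - d^3 = (a - d^3) - z * (b - \<beta>)" by (simp add: algebra_simps)
          then show ?thesis by (simp only: diff[OF J a sc[OF J b]] simp_thms)
        next
          case 3
          then have "xB + d^3 = (a - d^3) - z * (b - \<beta>) - 2 * d^2 * (z - d)"
            by (simp add: algebra_simps eval_nat_numeral)
          then show ?thesis by (simp only: diff[OF J diff[OF J a sc[OF J b]] sc[OF J z]] simp_thms)
        qed
      qed
      then have "regular_list ?J [xB]" using regular_list_cong[OF J, of xB "d^3" "[]"] r2 by auto
      then have r: "regular_list (I2 \<beta>) [a - d^3, xB]" using r2 by auto
      have "xL - (a - d^3) = - d * (c - d^2) - c * (z - d)"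
        using 2 by (simp add: algebra_simps eval_nat_numeral)
      then have "xL - (a - d^3) \<in> I2 \<beta>" by (simp only: diff[OF I2 sc[OF I2 c2] sc[OF I2 N2]])
      then show ?thesis using regular_list_cong[OF I2 disjI1 r] by blast
    qed
  qed
  have "regular_list I1 [xR, xL, xB]"
  proof -
    consider "xR = z^2 - b - d^2" | "xR = b - d^2 - z * d" using R by blast
    then show ?thesis
    proof cases
      case 1
      have "regular_list I1 [b - 0, xL, xB]"
        using last[of 0] H1[of 0] by (auto simp: I1_def I2_def)
      moreover have "xR + (b - 0) = (z + d) * (z - d)"
        using 1 by (simp add: algebra_simps eval_nat_numeral)
      then have "xR + (b - 0) \<in> I1" by (simp only: sc[OF I1 N1])
      ultimately show ?thesis using regular_list_cong[OF I1] by blast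
    next
      case 2
      have "regular_list I1 [b - 2 * d^2, xL, xB]"
        using last[of "2 * d^2"] H1[of "2 * d^2"] by (auto simp: I1_def I2_def)
      moreover have "xR - (b - 2 * d^2) = - d * (z - d)"
        using 2 by (simp add: algebra_simps eval_nat_numeral)
      then have "xR - (b - 2 * d^2) \<in> I1" by (simp only: sc[OF I1 N1])
      ultimately show ?thesis using regular_list_cong[OF I1] by blast
    qed
  qed
  then have r: "regular_list I [c - d^2, xR, xL, xB]" using H1[of 0] by (auto simp: I1_def)
  have "xT - (c - d^2) = z * (z - d) \<or> xT - (c - d^2) = 0 * (z - d)"
    using T by (auto simp: algebra_simps eval_nat_numeral)
  then have "xT - (c - d^2) \<in> I" using sc[OF I N] by metis
  then show ?thesis using regular_list_cong[OF I _ r] by blast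
qed

lemma regular_list_mult:
  assumes A: "homog_ideal \<omega> A" and h: "homog_list \<omega> (us @ f # g # vs)" "\<exists>d>0. homog \<omega> d (f * g)"
    and f: "regular_list A (us @ f # vs)" and g: "regular_list A (us @ g # vs)"
  shows "regular_list A (us @ (f * g) # vs)"
proof -
  have "regular_list A ((us @ vs) @ [x])" if "x \<in> {f, g}" for x
    by (rule regular_list_permute[OF A, of "us @ x # vs"]) (use h f g that in auto)
  then have "regular_list A (us @ vs)" "nzd (adjoins A (us @ vs)) f" "nzd (adjoins A (us @ vs)) g"
    by (auto simp only: regular_list_snoc)
  then have "regular_list A ((us @ vs) @ [f * g])" by (simp only: regular_list_snoc nzd_mult)
  then show ?thesis by (rule regular_list_permute[OF A, rotated 2]) (use h in auto)
qed

lemma regular_list_factor: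
  assumes A: "homog_ideal \<omega> A" and h: "homog_list \<omega> (us @ f # g # vs)" "\<exists>d>0. homog \<omega> d (f * g)"
    and r: "regular_list A (us @ (f * g) # vs)"
  shows "regular_list A (us @ g # vs)"
proof -
  have "regular_list A ((us @ vs) @ [f * g])"
    by (rule regular_list_permute[OF A, of "us @ (f * g) # vs"]) (use h r in auto)
  then have "regular_list A ((us @ vs) @ [g])"
    using nzd_factor[of "adjoins A (us @ vs)" f g] A by (simp add: regular_list_snoc homog_ideal_def del: append_assoc)
  then show ?thesis by (rule regular_list_permute[OF A, rotated 2]) (use h in auto)
qed

text \<open>The pattern of a substitution: each variable is new and is equated to a polynomial in
  the earlier ones, so \<open>nzd_monic\<close> applies to every difference in turn.\<close>

fun triangular :: "'v set \<Rightarrow> ('v \<times> ('v, 'k::field) mpoly) list \<Rightarrow> bool" where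
  "triangular V [] \<longleftrightarrow> True"
| "triangular V ((v, q) # r) \<longleftrightarrow> v \<notin> V \<and> q \<in> polys V \<and> triangular (insert v V) r"

lemma regular_list_triangular:
  "G \<subseteq> polys V \<Longrightarrow> triangular V r \<Longrightarrow> regular_list (idl.span G) (map (\<lambda>(v, q). X v - q) r)"
proof (induction r arbitrary: G V)
  case (Cons p r)
  obtain v q where p: "p = (v, q)" by force
  have v: "v \<notin> V" "q \<in> polys V" "triangular (insert v V) r" using Cons.prems(2) by (auto simp: p)
  have G: "G \<subseteq> polys (- {v})" "q \<in> polys (- {v})"
    using Cons.prems(1) v polys_mono[of V "- {v}"] by auto
  have "insert (X v - q) G \<subseteq> polys (insert v V)"
    using Cons.prems(1) v polys_mono[of V "insert v V"] by (auto intro!: polys_intros)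
  then have "regular_list (idl.span (insert (X v - q) G)) (map (\<lambda>(v, q). X v - q) r)"
    using v Cons.IH by blast
  then show ?case using nzd_monic[OF G] by (simp add: p adjoin_span)
qed simp

text \<open>The two new forms are triangular in \<open>u\<close> and \<open>v\<close>, hence regular
  behind \<open>F\<close> and \<open>P\<close>. Once \<open>P\<close> has been moved to the end, it
  may be replaced by its square, that is by the new minor, which then moves to the front. Two
  variables and one minor are gained, so the sequence grows by one.\<close>

lemma regular_list_extend:
  fixes w :: "('v, 'k::field) mpoly"
  assumes G: "G \<subseteq> polys V" "\<And>g. g \<in> G \<Longrightarrow> \<exists>d. homog \<omega> d g"
    and F: "set F \<subseteq> polys V" "homog_list \<omega> F"
    and xyw: "x \<in> V" "y \<in> V" "w \<in> polys V" and uv: "u \<notin> V" "v \<notin> V" "u \<noteq> v"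
    and deg: "homog \<omega> k w" "\<omega> y = k + \<omega> x" "\<omega> u = \<omega> y" "\<omega> v = k + \<omega> u" and pos: "\<And>v. \<omega> v > 0"
    and r: "regular_list (idl.span G) ((X y - w * X x) # F)"
    and e: "e \<in> {X u * X y - X v * X x, X v * X x - X u * X y}"
  shows "regular_list (idl.span (insert e G)) ((X v - w * X u) # (X u - (X y - w * X x)) # F)"
proof -
  define P where "P = X y - w * X x"
  define Q where "Q = X v - w * X u"
  define H where "H = X u - P"
  have A: "homog_ideal \<omega> (idl.span G)" using G by (intro homog_ideal_span)
  have hP: "\<exists>d>0. homog \<omega> d P"
    unfolding P_def using pos[of y] deg by (intro exI[of _ "\<omega> y"] conjI homog_diff homog_X homog_mult) auto
  have hQ: "\<exists>d>0. homog \<omega> d Q"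
    unfolding Q_def using pos[of v] deg by (intro exI[of _ "\<omega> v"] conjI homog_diff homog_X homog_mult) auto
  have hH: "\<exists>d>0. homog \<omega> d H"
    unfolding H_def P_def using pos[of y] deg
    by (intro exI[of _ "\<omega> y"] conjI homog_diff homog_X homog_mult) auto
  have he: "\<exists>d>0. homog \<omega> d e"
  proof -
    have "homog \<omega> (\<omega> u + \<omega> y) (X u * X y)" "homog \<omega> (\<omega> u + \<omega> y) (X v * X x)"
      using deg by (auto intro!: homog_mult homog_X)
    then have "homog \<omega> (\<omega> u + \<omega> y) e" using e by (auto intro: homog_diff)
    then show ?thesis using pos[of u] by (intro exI[of _ "\<omega> u + \<omega> y"]) auto
  qed
  have P: "P \<in> polys V" unfolding P_def using xyw by (intro polys_intros)
  have base: "regular_list (idl.span G) (F @ [P])"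
    by (rule regular_list_permute[OF A _ _ r]) (use F hP in \<open>auto simp: P_def\<close>)
  have "insert P (G \<union> set F) \<subseteq> polys V" using G F P by auto
  moreover have "triangular V [(u, P), (v, w * X u)]"
    using P xyw uv polys_mono[of V "insert u V"] by (auto intro!: polys_intros)
  ultimately have "regular_list (idl.span (insert P (G \<union> set F))) [H, Q]"
    using regular_list_triangular[of "insert P (G \<union> set F)" V "[(u, P), (v, w * X u)]"]
    by (simp add: H_def Q_def)
  then have "regular_list (idl.span G) ((F @ [P]) @ [H, Q])"
    using base unfolding regular_list_append by (simp add: adjoins_span adjoin_span)
  then have "regular_list (idl.span G) ((F @ [H, Q]) @ [P])"
    by (rule regular_list_permute[OF A, rotated 2]) (use F hP hQ hH in auto)
  then have 1: "regular_list (idl.span G) (F @ [H, Q])"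
    and 2: "nzd (adjoins (idl.span G) (F @ [H, Q])) P"
    unfolding regular_list_snoc by auto
  let ?J = "adjoins (idl.span G) (F @ [H, Q])"
  have J: "is_ideal ?J" by auto
  have "nzd ?J (P * P)" using 2 2 by (rule nzd_mult)
  moreover have "X u * X y - X v * X x - P * P \<in> ?J"
  proof -
    have "X u * X y - X v * X x - P * P = (X y - w * X x) * H - X x * Q"
      unfolding H_def Q_def P_def by (simp add: algebra_simps)
    moreover have "H \<in> ?J" "Q \<in> ?J" by (auto intro: mem_adjoins_right)
    ultimately show ?thesis using idl.subspace_diff[OF J] ideal_mem_comb(1)[OF J] by metis
  qed
  ultimately have "nzd ?J (X u * X y - X v * X x)" using nzd_cong[OF J] by blast
  then have "nzd ?J e" using nzd_minus[OF J, of "X u * X y - X v * X x"] e by auto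
  then have "regular_list (idl.span G) ((F @ [H, Q]) @ [e])" using 1 unfolding regular_list_snoc by blast
  then have "regular_list (idl.span G) (e # Q # H # F)"
    by (rule regular_list_permute[OF A, rotated 2]) (use F he hQ hH in auto)
  then show ?thesis by (simp add: adjoin_span P_def Q_def H_def)
qed

lemma homog_power: "homog \<omega> d p \<Longrightarrow> n * d = e \<Longrightarrow> homog \<omega> e (p ^ n)"
  by (induction n arbitrary: e) (auto intro: homog_mult simp: homog_one)

lemma homog_numeral: "homog \<omega> 0 (numeral n)"
  using homog_cst[of \<omega> "numeral n"] by simp

lemma numeral_in_polys: "numeral n \<in> polys V"
  using polys_ring_ops(3)[of "numeral n" V] by simp

lemma adjoin_cong_sign:
  "is_ideal A \<Longrightarrow> f - g \<in> A \<or> f + g \<in> A \<Longrightarrow> adjoin A f = adjoin A g"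
  using adjoin_cong[of A f g] adjoin_cong[of A f "- g"] by (auto simp: adjoin_minus)

text \<open>Homogeneity permits the product to be moved to the end of the list, where
  \<open>linked_step\<close> removes its first factor.\<close>

lemma linked_factor:
  assumes J: "is_ideal J" and A: "homog_ideal \<omega> A"
    and h: "homog_list \<omega> (us @ f # g # vs)" "\<exists>d>0. homog \<omega> d (f * g)"
    and l: "linked J e (adjoins A (us @ (f * g) # vs))" and r: "regular_list A (us @ (f * g) # vs)"
  shows "linked J (e * f) (adjoins A (us @ g # vs)) \<and> regular_list A (us @ g # vs)"
proof
  let ?A = "adjoins A (us @ vs)"
  have iA: "is_ideal A" "is_ideal ?A" using A by (auto simp: homog_ideal_def)
  have perm: "adjoins A (us @ x # vs) = adjoin ?A x" for x
    using iA by (simp add: adjoins_append adjoins_adjoin)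
  have "regular_list A ((us @ vs) @ [f * g])"
    by (rule regular_list_permute[OF A, of "us @ (f * g) # vs"]) (use h r in auto)
  then have fg: "nzd ?A (f * g)" unfolding regular_list_snoc by blast
  show "linked J (e * f) (adjoins A (us @ g # vs))"
    unfolding perm
  proof (rule linked_step[OF J iA(2)])
    show "linked J e (adjoin ?A (f * g))" using l by (simp only: perm)
    show "nzd ?A f" using nzd_factor[OF iA(2), of g f] fg by (simp add: mult.commute)
    show "nzd ?A g" by (rule nzd_factor[OF iA(2) fg])
  qed
  show "regular_list A (us @ g # vs)" by (rule regular_list_factor[OF A h r])
qed

text \<open>A triple \<open>(x, y, w)\<close> records an arm with end vertices \<open>x\<close>, \<open>y\<close> together with the form \<open>y - w x\<close>.\<close>

definition arm_system ::
    "('v \<Rightarrow> nat) \<Rightarrow> 'v set \<Rightarrow> ('v, 'k::field) mpoly set \<Rightarrow> ('v \<times> 'v \<times> ('v, 'k) mpoly) list \<Rightarrow>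
      ('v, 'k) mpoly list \<Rightarrow> bool" where
  "arm_system \<omega> V G Ps F \<longleftrightarrow>
     (\<forall>v. 0 < \<omega> v) \<and> G \<subseteq> polys V \<and> (\<forall>g\<in>G. \<exists>d. homog \<omega> d g) \<and> set F \<subseteq> polys V \<and> homog_list \<omega> F \<and>
     (\<forall>(x, y, w) \<in> set Ps. x \<in> V \<and> y \<in> V \<and> w \<in> polys V \<and> (\<exists>k. homog \<omega> k w \<and> \<omega> y = k + \<omega> x)) \<and>
     regular_list (idl.span G) (map (\<lambda>(x, y, w). X y - w * X x) Ps @ F)"

lemma X_system:
  fixes a b c d l1 l2 t1 t2 r1 r2 s1 s2 :: 'v
  defines "A \<equiv> X a :: ('v, 'k::field) mpoly" and "B \<equiv> X b" and "C \<equiv> X c" and "D \<equiv> X d"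
    and "L1 \<equiv> X l1" and "Z \<equiv> X l2" and "T1 \<equiv> X t1" and "T2 \<equiv> X t2"
    and "R1 \<equiv> X r1" and "R2 \<equiv> X r2" and "S1 \<equiv> X s1" and "S2 \<equiv> X s2"
  assumes dist: "distinct [a, b, c, d, l1, l2, t1, t2, r1, r2, s1, s2]"
  shows "\<exists>\<omega> F. arm_system \<omega> {a, b, c, d, l1, l2, t1, t2, r1, r2, s1, s2}
    {A * D - B * C, C * T2 - D * T1, B * R2 - R1 * D, L1 * C - A * Z, S1 * B - S2 * A}
    [(l2, l1, Z), (t2, t1, D), (r2, r1, D + Z), (s2, s1, Z)] F \<and> length F = 3"
proof -
  \<comment> \<open>Positive weights for which the five minors, the seven parameters and all factors
    of the split minors are homogeneous.\<close>
  define \<omega> :: "'v \<Rightarrow> nat" where "\<omega> = (\<lambda>v. if v \<in> {a, t1, r1, s2} then 3 else if v \<in> {b, c, l1, t2, r2} then 2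
    else if v = s1 then 4 else 1)"
  have pos: "0 < \<omega> v" for v by (simp add: \<omega>_def)
  have \<omega>: "\<omega> a = 3" "\<omega> b = 2" "\<omega> c = 2" "\<omega> d = 1" "\<omega> l1 = 2" "\<omega> l2 = 1" "\<omega> t1 = 3" "\<omega> t2 = 2"
    "\<omega> r1 = 3" "\<omega> r2 = 2" "\<omega> s1 = 4" "\<omega> s2 = 3"
    using dist by (auto simp: \<omega>_def)
  have hv: "homog \<omega> 3 A" "homog \<omega> 2 B" "homog \<omega> 2 C" "homog \<omega> 1 D" "homog \<omega> 2 L1" "homog \<omega> 1 Z"
    "homog \<omega> 3 T1" "homog \<omega> 2 T2" "homog \<omega> 3 R1" "homog \<omega> 2 R2" "homog \<omega> 4 S1" "homog \<omega> 3 S2"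
    unfolding A_def B_def C_def D_def L1_def Z_def T1_def T2_def R1_def R2_def S1_def S2_def
    by (rule homog_X, rule \<omega>)+
  \<comment> \<open>Modulo these forms the outer minors become the products \<open>jT, jR, jL, jB\<close>, up to sign; the forms were
    found by a search for products that meet \<open>X_certificate\<close> in every characteristic.\<close>
  define f1 where "f1 = T2 - (C - D^2 - D * Z + Z^2)"
  define f2 where "f2 = R2 - (Z^2 - B - D^2)"
  define f3 where "f3 = S2 - (A - C * Z + Z^3)"
  define pL where "pL = L1 - Z * Z"
  define pT where "pT = T1 - D * T2"
  define pR where "pR = R1 - (D + Z) * R2"
  define pB where "pB = S1 - Z * S2"
  \<comment> \<open>The seven forms above make up the sequence to be produced. \<open>N\<close> is
    auxiliary: cutting by it makes the check of regularity triangular, and afterwards it is the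
    nonzerodivisor that \<open>X_certificate\<close> asks for.\<close>
  define N where "N = Z - D"
  define \<theta> where "\<theta> = [f1, f2, f3, pL, pT, pR, pB]"
  define tt where "tt = C - D^2 - D * Z + Z^2"
  define rr where "rr = Z^2 - B - D^2"
  define ss where "ss = A - C * Z + Z^3"
  define g1 where "g1 = A - Z * C"
  define g2 where "g2 = A - Z * B"
  define g3 where "g3 = C - D^2"
  define g4 where "g4 = B - D^2 - Z * D"
  define jT where "jT = tt * g3"
  define jR where "jR = rr * g4"
  define jL where "jL = Z * g1"
  define jB where "jB = ss * g2"
  define cT where "cT = C * T2 - D * T1"
  define cR where "cR = B * R2 - R1 * D"
  define cL where "cL = L1 * C - A * Z"
  define cB where "cB = S1 * B - S2 * A"
  define \<Delta> where "\<Delta> = A * D - B * C"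
  define \<delta> where "\<delta> = Z * T2 * R1 * S1 - L1 * T1 * R2 * S2"
  note h = homog_diff homog_add homog_minus homog_mult homog_power homog_numeral homog_zero
  have hf: "homog \<omega> 2 f1" "homog \<omega> 2 f2" "homog \<omega> 3 f3" "homog \<omega> 2 pL" "homog \<omega> 3 pT"
    "homog \<omega> 3 pR" "homog \<omega> 4 pB" "homog \<omega> 1 N"
    unfolding f1_def f2_def f3_def pL_def pT_def pR_def pB_def N_def
    by (rule hv h refl | simp)+
  have hg: "homog \<omega> 2 tt" "homog \<omega> 2 rr" "homog \<omega> 3 ss" "homog \<omega> 3 g1" "homog \<omega> 3 g2"
    "homog \<omega> 2 g3" "homog \<omega> 2 g4"
    unfolding tt_def rr_def ss_def g1_def g2_def g3_def g4_def
    by (rule hv h refl | simp)+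
  have hj: "homog \<omega> 4 jT" "homog \<omega> 4 jR" "homog \<omega> 4 jL" "homog \<omega> 6 jB"
    unfolding jT_def jR_def jL_def jB_def
    by (rule hv hg h refl | simp)+
  have hc: "homog \<omega> 4 cT" "homog \<omega> 4 cR" "homog \<omega> 4 cL" "homog \<omega> 6 cB" "homog \<omega> 4 \<Delta>" "homog \<omega> 10 \<delta>"
    unfolding cT_def cR_def cL_def cB_def \<Delta>_def \<delta>_def
    by (rule hv h refl | simp)+
  have ex: "\<exists>d>0. homog \<omega> d p" if "homog \<omega> (numeral n) p \<or> homog \<omega> 1 p" for p n
    using that by (auto intro: exI[of _ "numeral n"] exI[of _ 1])
  have exs: "\<exists>d>0. homog \<omega> d A" "\<exists>d>0. homog \<omega> d D" "\<exists>d>0. homog \<omega> d Z"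
    "\<exists>d>0. homog \<omega> d f1" "\<exists>d>0. homog \<omega> d f2" "\<exists>d>0. homog \<omega> d f3" "\<exists>d>0. homog \<omega> d pL"
    "\<exists>d>0. homog \<omega> d pT" "\<exists>d>0. homog \<omega> d pR" "\<exists>d>0. homog \<omega> d pB" "\<exists>d>0. homog \<omega> d N"
    "\<exists>d>0. homog \<omega> d tt" "\<exists>d>0. homog \<omega> d rr" "\<exists>d>0. homog \<omega> d ss" "\<exists>d>0. homog \<omega> d g1"
    "\<exists>d>0. homog \<omega> d g2" "\<exists>d>0. homog \<omega> d g3" "\<exists>d>0. homog \<omega> d g4"
    "\<exists>d>0. homog \<omega> d jT" "\<exists>d>0. homog \<omega> d jR" "\<exists>d>0. homog \<omega> d jL" "\<exists>d>0. homog \<omega> d jB"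
    "\<exists>d>0. homog \<omega> d cT" "\<exists>d>0. homog \<omega> d cR" "\<exists>d>0. homog \<omega> d cL" "\<exists>d>0. homog \<omega> d cB"
    using hv hf hg hj hc ex by blast+
  have h\<theta>: "homog_list \<omega> \<theta>" using exs by (simp add: \<theta>_def)
  have zero: "homog_ideal \<omega> {0 :: ('v, 'k) mpoly}"
    using homog_ideal_span[of "{}" \<omega>] by simp
  note pl = polys_intros numeral_in_polys
  \<comment> \<open>The parameters express the seven outer variables other than \<open>l2\<close>
    through \<open>a, b, c, d, l2\<close>; this is the reduction to five variables.\<close>
  have last7: "triangular V [(t2, C - D^2 - D * Z + Z^2), (r2, Z^2 - B - D^2), (s2, A - C * Z + Z^3),
      (l1, Z * Z), (t1, D * T2), (r1, (D + Z) * R2), (s1, Z * S2)]" if "V = {a, b, c, d, l2}" for V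
    unfolding A_def B_def C_def D_def L1_def Z_def T1_def T2_def R1_def R2_def S1_def S2_def
    using dist that by (auto intro!: pl)
  have map7: "map (\<lambda>(v, q). X v - q) [(t2, C - D^2 - D * Z + Z^2), (r2, Z^2 - B - D^2), (s2, A - C * Z + Z^3),
      (l1, Z * Z), (t1, D * T2), (r1, (D + Z) * R2), (s1, Z * S2)] = \<theta>"
    by (simp add: \<theta>_def f1_def f2_def f3_def pL_def pT_def pR_def pB_def T2_def R2_def S2_def L1_def T1_def R1_def S1_def)

  have \<beta>: "\<beta> \<in> polys {a, d}" "homog \<omega> 2 \<beta>" "homog \<omega> 2 (B - \<beta>)" "homog \<omega> 3 (A - D^3)" "homog \<omega> 3 (D^3)"
    if "\<beta> \<in> {0, 2 * D^2}" for \<beta>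
  proof -
    show "\<beta> \<in> polys {a, d}" using that unfolding D_def by (auto intro!: pl)
    show \<beta>: "homog \<omega> 2 \<beta>"
      using that by (elim insertE emptyE; simp only:) (rule hv h refl | simp)+
    show "homog \<omega> 2 (B - \<beta>)" "homog \<omega> 3 (A - D^3)" "homog \<omega> 3 (D^3)"
      by (rule hv \<beta> h refl | simp)+
  qed
  have base1: "regular_list {0} ((N # \<theta>) @ [g3, B - \<beta>, D, A])" if b: "\<beta> \<in> {0, 2 * D^2}" for \<beta>
  proof (rule regular_list_permute[OF zero])
    let ?r = "[(a, 0), (d, 0), (b, \<beta>), (c, D^2), (l2, D), (t2, C - D^2 - D * Z + Z^2), (r2, Z^2 - B - D^2),
      (s2, A - C * Z + Z^3), (l1, Z * Z), (t1, D * T2), (r1, (D + Z) * R2), (s1, Z * S2)]"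
    have "\<beta> \<in> polys {d, a}" using \<beta>(1)[OF b] by (simp add: insert_commute)
    then have "triangular {} ?r"
      using last7[of "{l2, c, b, d, a}"] dist
      by (auto simp: D_def insert_commute intro!: pl)
    then show "regular_list {0} (map (\<lambda>(v, q). X v - q) ?r)"
      using regular_list_triangular[of "{}" "{}" ?r] by simp
    have m: "map (\<lambda>(v, q). X v - q) ?r = [A, D, B - \<beta>, g3, N] @ \<theta>"
      using map7 by (simp add: A_def B_def C_def D_def Z_def g3_def N_def)
    show "homog_list \<omega> (map (\<lambda>(v, q). X v - q) ?r)"
      unfolding m using exs h\<theta> ex[of _ "B - \<beta>"] \<beta>(3)[OF b] by auto
    show "mset (map (\<lambda>(v, q). X v - q) ?r) = mset ((N # \<theta>) @ [g3, B - \<beta>, D, A])"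
      unfolding m by simp
  qed
  have base2: "regular_list {0} ((N # \<theta>) @ [g3, B - \<beta>, A - D^3, D^3])" if b: "\<beta> \<in> {0, 2 * D^2}" for \<beta>
  proof (rule regular_list_permute[OF zero])
    let ?r = "[(a, D^3), (b, \<beta>), (c, D^2), (l2, D), (t2, C - D^2 - D * Z + Z^2), (r2, Z^2 - B - D^2),
      (s2, A - C * Z + Z^3), (l1, Z * Z), (t1, D * T2), (r1, (D + Z) * R2), (s1, Z * S2)]"
    \<comment> \<open>\<open>D^3\<close> is not of the form \<open>X v - q\<close>. It is placed in
      front, regular as a power of a variable, and the triangular list starts behind it.\<close>
    have D3: "{D^3} \<subseteq> polys {d}" unfolding D_def by (auto intro!: pl)
    have "triangular {d} ?r"
      using last7[of "{l2, c, b, a, d}"] dist \<beta>(1)[OF b]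
      by (auto simp: D_def insert_commute intro!: pl)
    then have "regular_list (idl.span {D^3}) (map (\<lambda>(v, q). X v - q) ?r)"
      by (rule regular_list_triangular[OF D3])
    moreover have "nzd {0} (D^3)"
      using nzd_power[OF nzd_monic[of "{}" d 0], of 3] by (simp add: D_def polys_ring_ops)
    moreover have "idl.span {D^3} = adjoin {0} (D^3)"
      using adjoin_span[of "{}" "D^3"] by simp
    ultimately show r: "regular_list {0} (D^3 # map (\<lambda>(v, q). X v - q) ?r)" by simp
    have m: "map (\<lambda>(v, q). X v - q) ?r = [A - D^3, B - \<beta>, g3, N] @ \<theta>"
      using map7 by (simp add: A_def B_def C_def D_def Z_def g3_def N_def)
    show "homog_list \<omega> (D^3 # map (\<lambda>(v, q). X v - q) ?r)"
      unfolding m using exs h\<theta> ex[of _ "B - \<beta>"] ex[of _ "A - D^3"] ex[of _ "D^3"] \<beta>(3-5)[OF b] by auto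
    show "mset (D^3 # map (\<lambda>(v, q). X v - q) ?r) = mset ((N # \<theta>) @ [g3, B - \<beta>, A - D^3, D^3])"
      unfolding m by simp
  qed
  \<comment> \<open>Every choice of one factor from each outer minor gives a regular sequence;
    \<open>r1\<close> to \<open>r4\<close> then assemble the products one minor at a time.\<close>
  have r0: "regular_list {0} ((N # \<theta>) @ [xT, xR, xL, xB])"
    if "xT \<in> {tt, g3}" "xR \<in> {rr, g4}" "xL \<in> {Z, g1}" "xB \<in> {ss, g2}" for xT xR xL xB
  proof -
    let ?I = "adjoins {0} (N # \<theta>)"
    have "regular_list ?I [xT, xR, xL, xB]"
    proof (rule X_combinations[of ?I Z D C B A])
      show "is_ideal ?I" by (intro is_ideal_adjoins) simp
      then show "Z - D \<in> ?I" by (intro mem_adjoins_right) (auto simp: N_def)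
    qed (use that base1 base2 in \<open>auto simp only: regular_list_append g1_def g2_def g3_def g4_def tt_def rr_def ss_def\<close>)
    moreover have "regular_list {0} (N # \<theta>)" using base1[of 0] by (simp only: regular_list_append insertI1)
    ultimately show ?thesis by (simp only: regular_list_append)
  qed
  have r1: "regular_list {0} ((N # \<theta>) @ [jT, xR, xL, xB])"
    if "xR \<in> {rr, g4}" "xL \<in> {Z, g1}" "xB \<in> {ss, g2}" for xR xL xB
    unfolding jT_def
    by (rule regular_list_mult[OF zero, of "N # \<theta>" tt g3 "[xR, xL, xB]"])
      (use that r0 exs h\<theta> in \<open>auto simp: jT_def\<close>)
  have r2: "regular_list {0} ((N # \<theta>) @ [jT, jR, xL, xB])"
    if "xL \<in> {Z, g1}" "xB \<in> {ss, g2}" for xL xB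
    using regular_list_mult[OF zero, of "(N # \<theta>) @ [jT]" rr g4 "[xL, xB]"]
      that r1[of _ xL xB] exs h\<theta> by (auto simp: jR_def)
  have r3: "regular_list {0} ((N # \<theta>) @ [jT, jR, jL, xB])"
    if "xB \<in> {ss, g2}" for xB
    using regular_list_mult[OF zero, of "(N # \<theta>) @ [jT, jR]" Z g1 "[xB]"]
      that r2[of _ xB] exs h\<theta> by (auto simp: jL_def)
  have r4: "regular_list {0} ((N # \<theta>) @ [jT, jR, jL, jB])"
    using regular_list_mult[OF zero, of "(N # \<theta>) @ [jT, jR, jL]" ss g2 "[]"]
      r3 exs h\<theta> by (auto simp: jB_def)
  have hj_list: "homog_list \<omega> ((N # \<theta>) @ [jT, jR, jL, jB])" using exs h\<theta> by auto
  have "regular_list {0} ((\<theta> @ [jT, jR, jL, jB]) @ [N])"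
    by (rule regular_list_permute[OF zero hj_list _ r4]) simp
  define J0 where "J0 = adjoins {0} (\<theta> @ [jT, jR, jL, jB])"
  have J0: "is_ideal J0" unfolding J0_def by (intro is_ideal_adjoins) simp
  from \<open>regular_list {0} ((\<theta> @ [jT, jR, jL, jB]) @ [N])\<close>
  have rj: "regular_list {0} (\<theta> @ [jT, jR, jL, jB])" and nN: "nzd J0 N"
    unfolding regular_list_snoc J0_def by auto

  \<comment> \<open>The factors \<open>tt\<close>, \<open>rr\<close>, \<open>Z\<close> and
    \<open>ss\<close> are stripped in turn and collected in the linking element; \<open>g3\<close>,
    \<open>g4\<close>, \<open>g1\<close> and \<open>g2\<close> stay behind.\<close>
  have "linked J0 1 (adjoins {0} (\<theta> @ [jT, jR, jL, jB]))"
    using linked_refl[OF J0] by (simp add: J0_def)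
  with rj have "linked J0 (1 * tt) (adjoins {0} (\<theta> @ [g3, jR, jL, jB])) \<and> regular_list {0} (\<theta> @ [g3, jR, jL, jB])"
    using linked_factor[OF J0 zero, of \<theta> tt g3 "[jR, jL, jB]" 1] exs h\<theta> by (simp add: jT_def)
  then have "linked J0 (1 * tt * rr) (adjoins {0} (\<theta> @ [g3, g4, jL, jB])) \<and> regular_list {0} (\<theta> @ [g3, g4, jL, jB])"
    using linked_factor[OF J0 zero, of "\<theta> @ [g3]" rr g4 "[jL, jB]" "1 * tt"] exs h\<theta> by (simp add: jR_def)
  then have "linked J0 (1 * tt * rr * Z) (adjoins {0} (\<theta> @ [g3, g4, g1, jB])) \<and> regular_list {0} (\<theta> @ [g3, g4, g1, jB])"
    using linked_factor[OF J0 zero, of "\<theta> @ [g3, g4]" Z g1 "[jB]" "1 * tt * rr"] exs h\<theta> by (simp add: jL_def)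
  then have l4: "linked J0 (1 * tt * rr * Z * ss) (adjoins {0} (\<theta> @ [g3, g4, g1, g2]))"
    and r4': "regular_list {0} ((\<theta> @ [g3, g4, g1]) @ [g2])"
    using linked_factor[OF J0 zero, of "\<theta> @ [g3, g4, g1]" ss g2 "[]" "1 * tt * rr * Z"] exs h\<theta>
    by (simp_all add: jB_def)
  define A5 where "A5 = adjoins {0} (\<theta> @ [g3, g4, g1])"
  have A5_span: "A5 = idl.span ({0} \<union> set \<theta> \<union> {g3, g4, g1})"
    unfolding A5_def by (subst adjoins_eq_span) (simp_all add: Un_commute insert_commute)
  have A5: "is_ideal A5" unfolding A5_def by (intro is_ideal_adjoins) simp
  \<comment> \<open>Modulo \<open>g1, g3, g4\<close> one has \<open>A = Z C\<close>,
    \<open>C = D^2\<close> and \<open>B = D^2 + Z D\<close>, so \<open>g2 = A - Z B\<close>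
    collapses to \<open>- Z^2 D\<close>. Stripping \<open>- Z^2\<close> as well ends the chain at
    \<open>A5 + (D)\<close>, which is generated by \<theta> and \<open>A, B, C, D\<close>.\<close>
  have "g2 - (- (Z^2)) * D \<in> A5"
  proof -
    have "g2 - (- (Z^2)) * D = (g1 + Z * g3) - Z * g4"
      unfolding g1_def g2_def g3_def g4_def by (simp add: algebra_simps eval_nat_numeral)
    moreover have "g1 \<in> A5" "g3 \<in> A5" "g4 \<in> A5"
      unfolding A5_def by (auto intro: mem_adjoins_right)
    ultimately show ?thesis
      using idl.subspace_diff[OF A5 idl.subspace_add[OF A5 _ ideal_mem_comb(1)[OF A5]] ideal_mem_comb(1)[OF A5]]
      by simp
  qed
  note \<kappa> = this
  have n2: "nzd A5 g2" using r4' unfolding regular_list_snoc A5_def by blast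
  have "(- (Z^2)) * D - g2 \<in> A5" using idl.subspace_neg[OF A5 \<kappa>] by (simp only: minus_diff_eq)
  then have nD: "nzd A5 ((- (Z^2)) * D)" using nzd_cong[OF A5] n2 by blast
  have "linked J0 (1 * tt * rr * Z * ss * (- (Z^2))) (adjoin A5 D)"
  proof (rule linked_step[OF J0 A5])
    have "adjoins {0} (\<theta> @ [g3, g4, g1, g2]) = adjoin A5 g2"
      by (simp add: A5_def adjoins_append)
    then show "linked J0 (1 * tt * rr * Z * ss) (adjoin A5 ((- (Z^2)) * D))"
      using l4 adjoin_cong[OF A5 \<kappa>] by simp
    show "nzd A5 D" by (rule nzd_factor[OF A5 nD])
    show "nzd A5 (- (Z^2))" by (rule nzd_factor[OF A5, of D]) (use nD in \<open>simp only: mult.commute\<close>)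
  qed
  then obtain E where E: "E = 1 * tt * rr * Z * ss * (- (Z^2))" and lE: "linked J0 E (adjoin A5 D)" by blast

  have \<theta>J0: "x \<in> J0" if "x \<in> set \<theta>" for x
    unfolding J0_def using that by (intro mem_adjoins_right) auto
  have span\<theta>: "x \<in> J0" if "x \<in> idl.span (set \<theta>)" for x
    using idl.span_minimal[of "set \<theta>" J0] \<theta>J0 J0 that by blast
  \<comment> \<open>Modulo \<theta> the two products in \<delta> are \<open>Z^2 T2 R2 S2\<close>
    times \<open>D + Z\<close> and times \<open>D\<close>. This explains the choice of the
    multipliers \<open>D + Z\<close> and \<open>D\<close> for the right and the top arm: the
    difference is \<open>Z^3 tt rr ss\<close>, a product of the stripped factors.\<close>
  have \<delta>E: "\<delta> + E \<in> J0"
  proof -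
    have "\<delta> + E = Z * T2 * S1 * pR + (Z * T2 * (D + Z) * R2 * pB + ((- (T1 * R2 * S2)) * pL
        + ((- (Z^2 * R2 * S2)) * pT + (Z^3 * R2 * S2 * f1 + (Z^3 * tt * S2 * f2 + Z^3 * tt * rr * f3)))))"
      unfolding \<delta>_def E pR_def pB_def pL_def pT_def f1_def f2_def f3_def tt_def[symmetric] rr_def[symmetric] ss_def[symmetric]
      by (simp add: algebra_simps eval_nat_numeral)
    also have "\<dots> \<in> J0"
      by (intro idl.subspace_add[OF J0] ideal_mem_comb(1)[OF J0] \<theta>J0) (auto simp: \<theta>_def)
    finally show ?thesis .
  qed
  define I0 where "I0 = adjoins {0} \<theta>"
  have I0: "is_ideal I0" unfolding I0_def by (intro is_ideal_adjoins) simp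
  have \<theta>I0: "x \<in> I0" if "x \<in> set \<theta>" for x
    unfolding I0_def using that by (intro mem_adjoins_right) auto
  have cj: "cT - jT \<in> I0" "cR - jR \<in> I0" "cL + jL \<in> I0" "cB + jB \<in> I0"
  proof -
    have eq: "cT - jT = g3 * f1 + (- D) * pT" "cR - jR = g4 * f2 + (- D) * pR"
      "cL + jL = C * pL + 0 * pL" "cB + jB = B * pB + (- g2) * f3"
      unfolding cT_def cR_def cL_def cB_def jT_def jR_def jL_def jB_def f1_def f2_def f3_def pT_def pR_def pL_def pB_def
        tt_def rr_def ss_def g1_def g2_def g3_def g4_def
      by (simp_all add: algebra_simps eval_nat_numeral)
    have comb: "k * x + k' * y \<in> I0" if "x \<in> set \<theta>" "y \<in> set \<theta>" for k k' x y
      using that \<theta>I0 by (intro idl.subspace_add[OF I0] ideal_mem_comb(1)[OF I0]) auto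
    show "cT - jT \<in> I0" "cR - jR \<in> I0" "cL + jL \<in> I0" "cB + jB \<in> I0"
      unfolding eq by (rule comb; simp add: \<theta>_def)+
  qed
  note left = mem_adjoin_left and idj = is_ideal_adjoin
  have rc: "regular_list {0} (\<theta> @ [cT, cR, cL, cB])" and J0c: "J0 = adjoins {0} (\<theta> @ [cT, cR, cL, cB])"
  proof -
    let ?I1 = "adjoin I0 cT" let ?I2 = "adjoin ?I1 cR" let ?I3 = "adjoin ?I2 cL"
    have e1: "adjoin I0 cT = adjoin I0 jT" by (rule adjoin_cong_sign[OF I0 disjI1[OF cj(1)]])
    have e2: "adjoin ?I1 cR = adjoin ?I1 jR" by (rule adjoin_cong_sign[OF idj[OF I0] disjI1[OF left[OF cj(2)]]])
    have e3: "adjoin ?I2 cL = adjoin ?I2 jL" by (rule adjoin_cong_sign[OF idj[OF idj[OF I0]] disjI2[OF left[OF left[OF cj(3)]]]])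
    have e4: "adjoin ?I3 cB = adjoin ?I3 jB"
      by (rule adjoin_cong_sign[OF idj[OF idj[OF idj[OF I0]]] disjI2[OF left[OF left[OF left[OF cj(4)]]]]])
    show "J0 = adjoins {0} (\<theta> @ [cT, cR, cL, cB])"
      by (simp add: J0_def adjoins_append I0_def[symmetric] flip: e1 e2 e3 e4)
    have "regular_list I0 [jT, jR, jL, jB]" and \<theta>: "regular_list {0} \<theta>"
      using rj by (simp_all only: regular_list_append I0_def)
    then have r: "nzd I0 jT" "nzd ?I1 jR" "nzd ?I2 jL" "nzd ?I3 jB"
      by (simp_all flip: e1 e2 e3)
    have "regular_list ?I3 [cB]"
      by (rule regular_list_cong[OF idj[OF idj[OF idj[OF I0]]] disjI2[OF left[OF left[OF left[OF cj(4)]]]]])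
        (simp add: r)
    then have 3: "regular_list ?I2 [jL, cB]" using r e3 by simp
    have "regular_list ?I2 [cL, cB]"
      by (rule regular_list_cong[OF idj[OF idj[OF I0]] disjI2[OF left[OF left[OF cj(3)]]] 3])
    then have 2: "regular_list ?I1 [jR, cL, cB]" using r e2 by simp
    have "regular_list ?I1 [cR, cL, cB]"
      by (rule regular_list_cong[OF idj[OF I0] disjI1[OF left[OF cj(2)]] 2])
    then have 1: "regular_list I0 [jT, cR, cL, cB]" using r e1 by simp
    have "regular_list I0 [cT, cR, cL, cB]"
      by (rule regular_list_cong[OF I0 disjI1[OF cj(1)] 1])
    then show "regular_list {0} (\<theta> @ [cT, cR, cL, cB])"
      using \<theta> by (simp only: regular_list_append I0_def)
  qed
  define J where "J = idl.span {cT, cR, cL, cB}"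
  have J: "is_ideal J" and hJ: "homog_ideal \<omega> J"
    unfolding J_def using exs by (auto intro!: homog_ideal_span)
  have Jc: "J = adjoins {0} [cT, cR, cL, cB]"
    using adjoins_span[of "{}" "[cT, cR, cL, cB]"] by (simp add: J_def)
  have "regular_list {0} ([cT, cR, cL, cB] @ \<theta>)"
    by (rule regular_list_permute[OF zero _ _ rc]) (use exs h\<theta> in auto)
  then have rJ: "regular_list J \<theta>" unfolding regular_list_append Jc by blast
  have J\<theta>: "adjoins J \<theta> = J0"
    unfolding J0c J_def adjoins_span using adjoins_span[of "{}" "\<theta> @ [cT, cR, cL, cB]"]
    by (simp add: Un_commute insert_commute)
  have cells: "cT \<in> J" "cR \<in> J" "cL \<in> J" "cB \<in> J" by (auto simp: J_def idl.span_base)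
  \<comment> \<open>Cramer's rule: the four minors are linear in \<open>A, B, C, D\<close>, and the
    cofactors below are entries of the adjugate matrix.\<close>
  have \<delta>H: "\<delta> * A \<in> J" "\<delta> * B \<in> J" "\<delta> * C \<in> J" "\<delta> * D \<in> J"
  proof -
    have "\<delta> * A = (- (T2 * R1 * S1)) * cL + ((L1 * R1 * S1) * cT + ((- (L1 * T1 * S1)) * cR + (L1 * T1 * R2) * cB))"
      "\<delta> * B = (Z * T2 * R1) * cB + ((- (T2 * R1 * S2)) * cL + ((L1 * R1 * S2) * cT + (- (L1 * T1 * S2)) * cR))"
      "\<delta> * C = (Z * R1 * S1) * cT + ((- (Z * T1 * S1)) * cR + ((Z * T1 * R2) * cB + (- (T1 * R2 * S2)) * cL))"
      "\<delta> * D = (- (Z * T2 * S1)) * cR + ((Z * T2 * R2) * cB + ((- (T2 * R2 * S2)) * cL + (L1 * R2 * S2) * cT))"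
      unfolding \<delta>_def cT_def cR_def cL_def cB_def by (simp_all add: algebra_simps)
    then show "\<delta> * A \<in> J" "\<delta> * B \<in> J" "\<delta> * C \<in> J" "\<delta> * D \<in> J"
      by (simp_all only: idl.subspace_add[OF J] ideal_mem_comb(1)[OF J] cells)
  qed
  have colon: "is_ideal {m. m * x \<in> M}" if "is_ideal M" for M and x :: "('v, 'k) mpoly"
    using that by (auto simp: idl.subspace_def distrib_right mult.assoc)
  define H where "H = idl.span {A, B, C, D}"
  have H: "is_ideal H" and hH: "homog_ideal \<omega> H"
    unfolding H_def using hv by (auto intro!: homog_ideal_span)
  have rH: "regular_list H \<theta>"
  proof -
    have "{A, B, C, D} \<subseteq> polys {a, b, c, d, l2}"
      unfolding A_def B_def C_def D_def by (auto intro!: pl)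
    from regular_list_triangular[OF this last7[OF refl]] show ?thesis
      unfolding map7 H_def .
  qed
  have "regular_list (adjoin J \<delta>) \<theta> \<and> (\<forall>x. \<delta> * x \<in> J \<longrightarrow> x \<in> H)"
  proof (rule regular_list_cokernel[OF hH hJ h\<theta> _ rH rJ])
    fix x assume "x \<in> H"
    moreover have "H \<subseteq> {m. m * \<delta> \<in> J}"
      unfolding H_def using \<delta>H by (intro idl.span_minimal colon[OF J]) (auto simp: mult.commute)
    ultimately show "\<delta> * x \<in> J" by (auto simp: mult.commute)
  next
    fix x assume "\<delta> * x \<in> adjoins J \<theta>"
    then have "\<delta> * x \<in> J0" by (simp only: J\<theta>)
    then have "x * (\<delta> + E) - \<delta> * x \<in> J0"
      using idl.subspace_diff[OF J0 ideal_mem_comb(1)[OF J0 \<delta>E]] by blast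
    then have "E * x \<in> J0" by (simp add: algebra_simps)
    then have "x \<in> adjoin A5 D" using lE by (simp add: linked_def)
    moreover have "adjoin A5 D \<subseteq> adjoins H \<theta>"
    proof (rule adjoin_subset)
      let ?K = "adjoins H \<theta>"
      show K: "is_ideal ?K" using H by simp
      have v: "A \<in> ?K" "B \<in> ?K" "C \<in> ?K" "D \<in> ?K"
        using H by (auto intro!: mem_adjoins_left simp: H_def idl.span_base)
      then show "D \<in> ?K" by blast
      have "g3 = C - D * D" "g4 = (B - D * D) - Z * D" "g1 = A - Z * C"
        by (simp_all add: g1_def g3_def g4_def power2_eq_square)
      then have "g3 \<in> ?K" "g4 \<in> ?K" "g1 \<in> ?K"
        by (simp_all only: idl.subspace_diff[OF K] ideal_mem_comb(1)[OF K] v)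
      moreover have "set \<theta> \<subseteq> ?K" using H by (auto intro: mem_adjoins_right)
      ultimately show "A5 \<subseteq> ?K"
        unfolding A5_span using idl.subspace_0[OF K] by (intro idl.span_minimal K) auto
    qed
    ultimately show "x \<in> adjoins H \<theta>" by blast
  qed
  then have r\<delta>: "regular_list (adjoin J \<delta>) \<theta>" by blast

  have "regular_list (adjoin J \<Delta>) \<theta> \<and> (\<forall>x. \<Delta> * x \<in> J \<longrightarrow> x \<in> adjoin J \<delta>)"
  proof (rule regular_list_cokernel[OF homog_ideal_adjoin[OF hJ hc(6)] hJ h\<theta> _ r\<delta> rJ])
    fix x assume "x \<in> adjoin J \<delta>"
    then obtain k where k: "x - k * \<delta> \<in> J" by (auto simp: adjoin_def)
    have "\<Delta> * x = \<Delta> * (x - k * \<delta>) + ((k * D) * (\<delta> * A) - (k * C) * (\<delta> * B))"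
      by (simp add: \<Delta>_def algebra_simps)
    then show "\<Delta> * x \<in> J"
      by (simp only: idl.subspace_add[OF J] idl.subspace_diff[OF J] ideal_mem_comb(1)[OF J] k \<delta>H)
  next
    fix x assume "\<Delta> * x \<in> adjoins J \<theta>"
    then have \<Delta>x: "\<Delta> * x \<in> J0" by (simp only: J\<theta>)
    \<comment> \<open>\<open>?M\<close> is the colon ideal \<open>J0 : x\<close>. Once it contains
      \<open>A, B, C, D\<close> it contains \<open>A5 + (D)\<close>, and the second half of the
      linkage puts \<open>x\<close> into \<open>J0 + (E)\<close>, which equals
      \<open>J0 + (\<delta>)\<close>.\<close>
    let ?M = "{m. m * x \<in> J0}"
    have M: "is_ideal ?M" by (rule colon[OF J0])
    have J0M: "m \<in> ?M" if "m \<in> J0" for m using ideal_mem_comb(2)[OF J0 that] by simp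
    have jJ0: "jT \<in> J0" "jR \<in> J0" "jL \<in> J0" "jB \<in> J0"
      unfolding J0_def by (auto intro: mem_adjoins_right)
    have nM: "nzd ?M (Z - D)"
      using nN unfolding N_def nzd_def by (auto simp: mult.assoc)
    have "A \<in> ?M \<and> B \<in> ?M \<and> C \<in> ?M \<and> D \<in> ?M"
    proof (rule X_certificate[OF M nM])
      show "A * D - B * C \<in> ?M" using \<Delta>x by (simp add: \<Delta>_def)
    qed (use J0M jJ0 in \<open>simp_all only: jT_def jR_def jL_def jB_def tt_def rr_def ss_def g1_def g2_def g3_def g4_def\<close>)
    moreover have "set \<theta> \<subseteq> ?M" using \<theta>J0 J0M by blast
    moreover have "0 \<in> ?M" using idl.subspace_0[OF M] .
    ultimately have "adjoin A5 D \<subseteq> ?M"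
    proof (intro adjoin_subset[OF M])
      assume v: "A \<in> ?M \<and> B \<in> ?M \<and> C \<in> ?M \<and> D \<in> ?M" and t: "set \<theta> \<subseteq> ?M" "0 \<in> ?M"
      have "g3 = C - D * D" "g4 = (B - D * D) - Z * D" "g1 = A - Z * C"
        by (simp_all add: g1_def g3_def g4_def power2_eq_square)
      then have "g3 \<in> ?M" "g4 \<in> ?M" "g1 \<in> ?M"
        by (simp_all only: idl.subspace_diff[OF M] ideal_mem_comb(1)[OF M] v)
      then show "A5 \<subseteq> ?M"
        unfolding A5_span using t by (intro idl.span_minimal M) (simp_all only: Un_subset_iff insert_subset empty_subsetI simp_thms)
      show "D \<in> ?M" using v by blast
    qed
    then have "\<forall>b\<in>adjoin A5 D. x * b \<in> J0" by (auto simp: mult.commute)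
    then have "x \<in> adjoin J0 E" using lE by (simp add: linked_def)
    moreover have "adjoin J0 E = adjoin J0 \<delta>"
      using adjoin_cong_sign[OF J0, of \<delta> E] \<delta>E by simp
    ultimately show "x \<in> adjoins (adjoin J \<delta>) \<theta>"
      using J by (simp add: adjoins_adjoin J\<theta>)
  qed
  then have fin: "regular_list (idl.span {\<Delta>, cT, cR, cL, cB}) \<theta>"
    by (simp add: J_def adjoin_span)
  have hG: "homog_ideal \<omega> (idl.span {\<Delta>, cT, cR, cL, cB})"
    using hc by (intro homog_ideal_span) auto
  have "regular_list (idl.span {\<Delta>, cT, cR, cL, cB}) ([pL, pT, pR, pB] @ [f1, f2, f3])"
    by (rule regular_list_permute[OF hG h\<theta> _ fin]) (simp add: \<theta>_def)
  then have "arm_system \<omega> {a, b, c, d, l1, l2, t1, t2, r1, r2, s1, s2} {\<Delta>, cT, cR, cL, cB}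
    [(l2, l1, Z), (t2, t1, D), (r2, r1, D + Z), (s2, s1, Z)] [f1, f2, f3]"
    unfolding arm_system_def
  proof (intro conjI)
    show "\<forall>(x, y, w)\<in>set [(l2, l1, Z), (t2, t1, D), (r2, r1, D + Z), (s2, s1, Z)].
      x \<in> {a, b, c, d, l1, l2, t1, t2, r1, r2, s1, s2} \<and> y \<in> {a, b, c, d, l1, l2, t1, t2, r1, r2, s1, s2} \<and>
      w \<in> polys {a, b, c, d, l1, l2, t1, t2, r1, r2, s1, s2} \<and> (\<exists>k. homog \<omega> k w \<and> \<omega> y = k + \<omega> x)"
      using hv(4,6) homog_add[OF hv(4,6)] by (auto simp: \<omega> D_def Z_def intro!: pl exI[of _ 1])
    show "{\<Delta>, cT, cR, cL, cB} \<subseteq> polys {a, b, c, d, l1, l2, t1, t2, r1, r2, s1, s2}"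
      unfolding \<Delta>_def cT_def cR_def cL_def cB_def A_def B_def C_def D_def L1_def Z_def T1_def T2_def R1_def R2_def S1_def S2_def
      by (auto intro!: pl)
    show "set [f1, f2, f3] \<subseteq> polys {a, b, c, d, l1, l2, t1, t2, r1, r2, s1, s2}"
      unfolding f1_def f2_def f3_def A_def B_def C_def D_def L1_def Z_def T1_def T2_def R1_def R2_def S1_def S2_def
      by (auto intro!: pl)
  qed (use pos hc exs in \<open>auto simp: pL_def pT_def pR_def pB_def L1_def T1_def R1_def S1_def Z_def T2_def R2_def S2_def\<close>)
  then show ?thesis
    unfolding \<Delta>_def cT_def cR_def cL_def cB_def by (intro exI[of _ \<omega>] exI[of _ "[f1, f2, f3]"]) simp
qed

section \<open>Lengthening the arms\<close>

lemma arm_systemD: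
  assumes "arm_system \<omega> V G Ps F"
  shows "0 < \<omega> v" "G \<subseteq> polys V" "g \<in> G \<Longrightarrow> \<exists>d. homog \<omega> d g" "set F \<subseteq> polys V" "homog_list \<omega> F"
    "(x, y, w) \<in> set Ps \<Longrightarrow> x \<in> V" "(x, y, w) \<in> set Ps \<Longrightarrow> y \<in> V" "(x, y, w) \<in> set Ps \<Longrightarrow> w \<in> polys V"
    "(x, y, w) \<in> set Ps \<Longrightarrow> \<exists>k. homog \<omega> k w \<and> \<omega> y = k + \<omega> x"
    "regular_list (idl.span G) (map (\<lambda>(x, y, w). X y - w * X x) Ps @ F)"
  using assms unfolding arm_system_def by auto

lemma arm_system_rotate:
  assumes "arm_system \<omega> V G (P # Ps) F" shows "arm_system \<omega> V G (Ps @ [P]) F"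
proof -
  let ?f = "\<lambda>(x, y, w). X y - w * X x :: ('a, 'b) mpoly"
  note s = arm_systemD[OF assms]
  have G: "homog_ideal \<omega> (idl.span G)" using s(3) by (intro homog_ideal_span)
  have "\<exists>d>0. homog \<omega> d (?f p)" if p_in: "p \<in> set (P # Ps)" for p
  proof -
    obtain x y w where p: "p = (x, y, w)" by (cases p)
    then obtain k where "homog \<omega> k w" "\<omega> y = k + \<omega> x" using s(9)[of x y w] p_in by blast
    then have "homog \<omega> (\<omega> y) (X y - w * X x)" by (intro homog_diff homog_X homog_mult) auto
    then show ?thesis using s(1) by (auto simp: p)
  qed
  then have h: "homog_list \<omega> (map ?f (P # Ps) @ F)" using s(5) by (auto simp: homog_list_def)
  have "regular_list (idl.span G) (map ?f (Ps @ [P]) @ F)"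
    by (rule regular_list_permute[OF G h _ s(10)]) simp
  then show ?thesis using assms by (auto simp: arm_system_def)
qed

lemma arm_system_step:
  fixes w :: "('v, 'k::field) mpoly"
  assumes s: "arm_system \<omega> V G ((x, y, w) # Ps) F" and uv: "u \<notin> V" "v \<notin> V" "u \<noteq> v"
    and e: "e \<in> {X u * X y - X v * X x, X v * X x - X u * X y}"
  shows "\<exists>\<omega>' F'. arm_system \<omega>' (V \<union> {u, v}) (insert e G) ((u, v, w) # Ps) F' \<and> length F' = Suc (length F)"
proof -
  let ?f = "\<lambda>(x, y, w). X y - w * X x :: ('v, 'k) mpoly"
  note s = arm_systemD[OF s]
  obtain k where k: "homog \<omega> k w" "\<omega> y = k + \<omega> x" using s(9)[of x y w] by auto
  \<comment> \<open>The form \<open>u - p\<close> forces the weight of \<open>y\<close> on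
    \<open>u\<close>, and \<open>v - w u\<close> then determines that of \<open>v\<close>. The new
    minor is balanced by this choice.\<close>
  define \<omega>' where "\<omega>' = \<omega>(u := \<omega> y, v := k + \<omega> y)"
  have eq: "\<omega> v' = \<omega>' v'" if "v' \<in> V" for v' using that uv by (auto simp: \<omega>'_def)
  have tr: "homog \<omega>' d p" if "homog \<omega> d p" "p \<in> polys V" for d p
    using homog_cong[OF that(2) eq that(1)] .
  have pos: "0 < \<omega>' v'" for v' using s(1) by (simp add: \<omega>'_def)
  have xy: "x \<in> V" "y \<in> V" "w \<in> polys V" using s(6-8)[of x y w] by auto
  have G: "G \<subseteq> polys V" "\<And>g. g \<in> G \<Longrightarrow> \<exists>d. homog \<omega>' d g" using s(2,3) tr by blast+
  have Ps: "\<exists>k. homog \<omega>' k w' \<and> \<omega>' y' = k + \<omega>' x'" "x' \<in> V" "y' \<in> V" "w' \<in> polys V"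
    if p_in: "(x', y', w') \<in> set Ps" for x' y' w'
  proof -
    show m: "x' \<in> V" "y' \<in> V" "w' \<in> polys V" using s(6-8)[of x' y' w'] p_in by auto
    obtain k where "homog \<omega> k w'" "\<omega> y' = k + \<omega> x'" using s(9)[of x' y' w'] p_in by auto
    then show "\<exists>k. homog \<omega>' k w' \<and> \<omega>' y' = k + \<omega>' x'" using tr[of k w'] m eq by auto
  qed
  have F: "set F \<subseteq> polys V" "homog_list \<omega>' F"
    using s(4,5) tr unfolding homog_list_def by blast+
  have P1: "?f ` set Ps \<subseteq> polys V"
    using Ps by (auto intro!: polys_intros)
  have P2: "\<exists>d>0. homog \<omega>' d (?f p)" if p_in: "p \<in> set Ps" for p
  proof -
    obtain x' y' w' where p: "p = (x', y', w')" by (cases p)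
    then obtain k where "homog \<omega>' k w'" "\<omega>' y' = k + \<omega>' x'" using Ps(1) p_in by blast
    then have "homog \<omega>' (\<omega>' y') (X y' - w' * X x')" by (intro homog_diff homog_X homog_mult) auto
    then show ?thesis using pos by (auto simp: p)
  qed
  have hl: "homog_list \<omega>' (map ?f Ps @ F)" using F P2 by (auto simp: homog_list_def)
  define f where "f = X u - (X y - w * X x)"
  have r: "regular_list (idl.span (insert e G)) ((X v - w * X u) # f # (map ?f Ps @ F))"
    unfolding f_def
  proof (rule regular_list_extend[OF G _ _ xy uv])
    show "set (map ?f Ps @ F) \<subseteq> polys V" using F(1) P1 by simp
    show "homog \<omega>' k w" by (rule tr[OF k(1) xy(3)])
    show "\<omega>' y = k + \<omega>' x" using k(2) uv xy by (auto simp: \<omega>'_def)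
    show "\<omega>' u = \<omega>' y" "\<omega>' v = k + \<omega>' u" using uv xy by (auto simp: \<omega>'_def)
    show "regular_list (idl.span G) ((X y - w * X x) # map ?f Ps @ F)" using s(10) by simp
  qed (assumption | rule hl pos e)+
  have hw: "homog \<omega>' k w" using tr k xy by blast
  have \<omega>': "\<omega>' u = \<omega> y" "\<omega>' v = k + \<omega> y" "\<omega>' x = \<omega> x" "\<omega>' y = \<omega> y"
    using uv xy by (auto simp: \<omega>'_def)
  have hf: "homog \<omega>' (\<omega>' y) f"
    unfolding f_def using k(2) hw by (intro homog_diff homog_X homog_mult) (auto simp: \<omega>')
  have hv: "homog \<omega>' (\<omega>' v) (X v - w * X u)"
    using hw by (intro homog_diff homog_X homog_mult) (auto simp: \<omega>')
  have he: "homog \<omega>' (\<omega>' u + \<omega>' y) e"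
  proof -
    have "\<omega>' v + \<omega>' x = \<omega>' u + \<omega>' y" using k by (simp add: \<omega>')
    then have "homog \<omega>' (\<omega>' u + \<omega>' y) (X u * X y)" "homog \<omega>' (\<omega>' u + \<omega>' y) (X v * X x)"
      by (auto intro!: homog_mult homog_X)
    then show ?thesis using e by (auto intro: homog_diff)
  qed
  have G': "homog_ideal \<omega>' (idl.span (insert e G))" using G he by (intro homog_ideal_span) auto
  have r': "regular_list (idl.span (insert e G)) (map ?f ((u, v, w) # Ps) @ f # F)"
    by (rule regular_list_permute[OF G' _ _ r]) (use hl hf hv pos in auto)
  have sub: "polys V \<subseteq> polys (V \<union> {u, v})" by (rule polys_mono) auto
  have "arm_system \<omega>' (V \<union> {u, v}) (insert e G) ((u, v, w) # Ps) (f # F)"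
    unfolding arm_system_def
  proof (intro conjI)
    show "insert e G \<subseteq> polys (V \<union> {u, v})"
      using G(1) sub e xy by (auto intro!: polys_intros)
    show "set (f # F) \<subseteq> polys (V \<union> {u, v})"
      using F sub xy unfolding f_def by (auto intro!: polys_intros)
    show "\<forall>(x, y, w)\<in>set ((u, v, w) # Ps).
       x \<in> V \<union> {u, v} \<and> y \<in> V \<union> {u, v} \<and> w \<in> polys (V \<union> {u, v}) \<and> (\<exists>k. homog \<omega>' k w \<and> \<omega>' y = k + \<omega>' x)"
      using Ps sub xy hw by (auto simp: \<omega>' intro: exI[of _ k])
  qed (use pos G he F hf r' in auto)
  then show ?thesis by (intro exI[of _ \<omega>'] exI[of _ "f # F"]) simp
qed

text \<open>The vertices are indexed outwards along the arm. The two signs allowed for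
  \<open>e\<close> serve arms running towards larger and towards smaller coordinates.\<close>

lemma arm_system_arm:
  fixes w :: "('v, 'k::field) mpoly" and x y :: "nat \<Rightarrow> 'v"
  assumes "arm_system \<omega> V G ((x 0, y 0, w) # Ps) F"
    and "\<And>k. k < n \<Longrightarrow> e k \<in> {X (x (Suc k)) * X (y k) - X (y (Suc k)) * X (x k),
      X (y (Suc k)) * X (x k) - X (x (Suc k)) * X (y k)}"
    and "\<And>k. k < n \<Longrightarrow> x (Suc k) \<notin> V" "\<And>k. k < n \<Longrightarrow> y (Suc k) \<notin> V"
    and "inj_on x {..n}" "inj_on y {..n}" "\<And>i j. x i \<noteq> y j"
  shows "\<exists>\<omega>' F'. arm_system \<omega>' (V \<union> (\<Union>k<n. {x (Suc k), y (Suc k)})) (G \<union> e ` {..<n}) ((x n, y n, w) # Ps) F'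
    \<and> length F' = length F + n"
  using assms
proof (induction n)
  case (Suc n)
  have "\<exists>\<omega>' F'. arm_system \<omega>' (V \<union> (\<Union>k<n. {x (Suc k), y (Suc k)})) (G \<union> e ` {..<n}) ((x n, y n, w) # Ps) F'
    \<and> length F' = length F + n"
  proof (rule Suc.IH)
    show "inj_on x {..n}" "inj_on y {..n}"
      using inj_on_subset[OF Suc.prems(5)] inj_on_subset[OF Suc.prems(6)] by simp_all
    show "x i \<noteq> y j" for i j by (rule Suc.prems(7))
    fix k assume "k < n"
    then have k: "k < Suc n" by simp
    show "x (Suc k) \<notin> V" "y (Suc k) \<notin> V" using Suc.prems(3,4)[OF k] .
    show "e k \<in> {X (x (Suc k)) * X (y k) - X (y (Suc k)) * X (x k), X (y (Suc k)) * X (x k) - X (x (Suc k)) * X (y k)}"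
      using Suc.prems(2)[OF k] .
  qed (rule Suc.prems(1))
  then obtain \<omega>' F' where s: "arm_system \<omega>' (V \<union> (\<Union>k<n. {x (Suc k), y (Suc k)})) (G \<union> e ` {..<n}) ((x n, y n, w) # Ps) F'"
    and l: "length F' = length F + n" by blast
  have "x (Suc n) \<noteq> x (Suc k)" "y (Suc n) \<noteq> y (Suc k)" if "k < n" for k
    using inj_onD[OF Suc.prems(5), of "Suc n" "Suc k"] inj_onD[OF Suc.prems(6), of "Suc n" "Suc k"] that by auto
  then have "x (Suc n) \<notin> V \<union> (\<Union>k<n. {x (Suc k), y (Suc k)})" "y (Suc n) \<notin> V \<union> (\<Union>k<n. {x (Suc k), y (Suc k)})"
    using Suc.prems(3,4)[of n] Suc.prems(7)[of "Suc n"] Suc.prems(7)[of _ "Suc n"] by fastforce+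
  from arm_system_step[OF s this Suc.prems(7) Suc.prems(2)[of n]] obtain \<omega>'' F'' where
    s': "arm_system \<omega>'' (V \<union> (\<Union>k<n. {x (Suc k), y (Suc k)}) \<union> {x (Suc n), y (Suc n)}) (insert (e n) (G \<union> e ` {..<n}))
      ((x (Suc n), y (Suc n), w) # Ps) F''" and l': "length F'' = Suc (length F')" by auto
  have V: "V \<union> (\<Union>k<n. {x (Suc k), y (Suc k)}) \<union> {x (Suc n), y (Suc n)} = V \<union> (\<Union>k<Suc n. {x (Suc k), y (Suc k)})"
    unfolding lessThan_Suc by blast
  have G: "insert (e n) (G \<union> e ` {..<n}) = G \<union> e ` {..<Suc n}" unfolding lessThan_Suc by blast
  show ?case using s' l' l unfolding V G by (intro exI[of _ \<omega>''] exI[of _ F'']) simp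
qed auto

definition cross :: "nat \<Rightarrow> nat \<Rightarrow> nat \<Rightarrow> nat \<Rightarrow> nat \<Rightarrow> nat \<Rightarrow> cell set" where
  "cross i0 j0 p q p' q' = {p..<q} \<times> {j0} \<union> {i0} \<times> {p'..<q'}"

text \<open>Each arm of the pentomino is lengthened while it heads the list and is then rotated to
  the end. The pentomino has five cells and three forms in \<open>F\<close>, and every further cell
  adds one form; hence the difference of 2 between the number of cells and the length of
  \<open>F\<close>.\<close>

lemma cross_system:
  assumes p: "p < i0" "Suc i0 < q" "p' < j0" "Suc j0 < q'"
  shows "\<exists>\<omega> w1 w2 w3 w4 F. arm_system \<omega> ({p..q} \<times> {j0, Suc j0} \<union> {i0, Suc i0} \<times> {p'..q'})
    (cell_binomial ` cross i0 j0 p q p' q' :: (vertex, 'k::field) mpoly set)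
    [((p, Suc j0), (p, j0), w1), ((Suc i0, q'), (i0, q'), w2), ((q, Suc j0), (q, j0), w3), ((Suc i0, p'), (i0, p'), w4)] F
    \<and> length F + 2 = (q - p) + (q' - p') - 1"
proof -
  let ?b = "cell_binomial :: cell \<Rightarrow> (vertex, 'k) mpoly"
  have ij: "i0 = Suc (i0 - 1)" "j0 = Suc (j0 - 1)" using p by auto
  define V0 where "V0 = {(i0, j0), (Suc i0, j0), (i0, Suc j0), (Suc i0, Suc j0), (i0 - 1, j0), (i0 - 1, Suc j0),
    (i0, Suc (Suc j0)), (Suc i0, Suc (Suc j0)), (Suc (Suc i0), j0), (Suc (Suc i0), Suc j0), (i0, j0 - 1), (Suc i0, j0 - 1)}"
  define G0 where "G0 = ?b ` {(i0, j0), (i0, Suc j0), (Suc i0, j0), (i0 - 1, j0), (i0, j0 - 1)}"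
  obtain \<omega>0 F0 where 0: "arm_system \<omega>0 V0 G0
    [((i0 - 1, Suc j0), (i0 - 1, j0), X (i0 - 1, Suc j0)), ((Suc i0, Suc (Suc j0)), (i0, Suc (Suc j0)), X (Suc i0, Suc j0)),
     ((Suc (Suc i0), Suc j0), (Suc (Suc i0), j0), X (Suc i0, Suc j0) + X (i0 - 1, Suc j0)),
     ((Suc i0, j0 - 1), (i0, j0 - 1), X (i0 - 1, Suc j0))] F0" and l0: "length F0 = 3"
  proof -
    have "distinct [(i0, j0), (Suc i0, j0), (i0, Suc j0), (Suc i0, Suc j0), (i0 - 1, j0), (i0 - 1, Suc j0),
      (i0, Suc (Suc j0)), (Suc i0, Suc (Suc j0)), (Suc (Suc i0), j0), (Suc (Suc i0), Suc j0), (i0, j0 - 1), (Suc i0, j0 - 1)]"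
      using p by auto
    from X_system[OF this, where 'k = 'k] show ?thesis
      using that ij by (simp add: V0_def G0_def) blast
  qed
  define nL where "nL = i0 - 1 - p"
  define nT where "nT = q' - Suc (Suc j0)"
  define nR where "nR = q - Suc (Suc i0)"
  define nB where "nB = j0 - 1 - p'"
  define VL where "VL = {p..<i0 - 1} \<times> {j0, Suc j0}"
  define VT where "VT = {i0, Suc i0} \<times> {Suc (Suc (Suc j0))..q'}"
  define VR where "VR = {Suc (Suc (Suc i0))..q} \<times> {j0, Suc j0}"
  define VB where "VB = {i0, Suc i0} \<times> {p'..<j0 - 1}"
  define CL where "CL = {p..<i0 - 1} \<times> {j0}"
  define CT where "CT = {i0} \<times> {Suc (Suc j0)..<q'}"
  define CR where "CR = {Suc (Suc i0)..<q} \<times> {j0}"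
  define CB where "CB = {i0} \<times> {p'..<j0 - 1}"
  obtain \<omega>1 F1 where 1: "arm_system \<omega>1 (V0 \<union> VL) (G0 \<union> ?b ` CL)
    [((Suc i0, Suc (Suc j0)), (i0, Suc (Suc j0)), X (Suc i0, Suc j0)),
     ((Suc (Suc i0), Suc j0), (Suc (Suc i0), j0), X (Suc i0, Suc j0) + X (i0 - 1, Suc j0)),
     ((Suc i0, j0 - 1), (i0, j0 - 1), X (i0 - 1, Suc j0)),
     ((p, Suc j0), (p, j0), X (i0 - 1, Suc j0))] F1" and l1: "length F1 = 3 + nL"
  proof -
    let ?x = "\<lambda>k. (i0 - 1 - k, Suc j0)" and ?y = "\<lambda>k. (i0 - 1 - k, j0)"
    let ?e = "\<lambda>k. ?b (i0 - 1 - Suc k, j0)"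
    \<comment> \<open>Within the arm the truncated subtraction is exact. The new cell lies on the
      side of smaller coordinates, so its minor carries the opposite sign.\<close>
    have s: "i0 - 1 - k = Suc (i0 - 1 - Suc k)" if "k < nL" for k using that by (simp add: nL_def)
    have e: "?e k = X (?y (Suc k)) * X (?x k) - X (?x (Suc k)) * X (?y k)" if "k < nL" for k
      unfolding s[OF that] by (simp add: mult.commute)
    have "\<exists>\<omega>' F'. arm_system \<omega>' (V0 \<union> (\<Union>k<nL. {?x (Suc k), ?y (Suc k)})) (G0 \<union> ?e ` {..<nL})
      ((?x nL, ?y nL, X (i0 - 1, Suc j0)) # [((Suc i0, Suc (Suc j0)), (i0, Suc (Suc j0)), X (Suc i0, Suc j0)),
     ((Suc (Suc i0), Suc j0), (Suc (Suc i0), j0), X (Suc i0, Suc j0) + X (i0 - 1, Suc j0)),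
     ((Suc i0, j0 - 1), (i0, j0 - 1), X (i0 - 1, Suc j0))]) F' \<and> length F' = length F0 + nL"
    proof (rule arm_system_arm)
      show "?e k \<in> {X (?x (Suc k)) * X (?y k) - X (?y (Suc k)) * X (?x k), X (?y (Suc k)) * X (?x k) - X (?x (Suc k)) * X (?y k)}"
        if "k < nL" for k using e[OF that] by blast
    qed (use 0 p in \<open>auto simp: V0_def nL_def inj_on_def\<close>)
    moreover have "(\<Union>k<nL. {?x (Suc k), ?y (Suc k)}) = VL"
    proof -
      have "\<exists>k<nL. i = i0 - 1 - Suc k" if "p \<le> i" "i < i0 - 1" for i
        using that by (intro exI[of _ "i0 - 2 - i"]) (auto simp: nL_def)
      then show ?thesis by (auto simp: VL_def nL_def) blast+
    qed
    moreover have "?e ` {..<nL} = ?b ` CL"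
    proof -
      have "\<exists>k<nL. i = i0 - 1 - Suc k" if "p \<le> i" "i < i0 - 1" for i
        using that by (intro exI[of _ "i0 - 2 - i"]) (auto simp: nL_def)
      then have "(\<lambda>k. (i0 - 1 - Suc k, j0)) ` {..<nL} = CL"
        by (auto simp: CL_def nL_def image_iff) blast
      then show ?thesis by (metis (no_types, lifting) image_cong image_image)
    qed
    moreover have "i0 - 1 - nL = p" using p by (simp add: nL_def)
    ultimately show ?thesis using that l0 arm_system_rotate by fastforce
  qed
  obtain \<omega>2 F2 where 2: "arm_system \<omega>2 (V0 \<union> VL \<union> VT) (G0 \<union> ?b ` CL \<union> ?b ` CT)
    [((Suc (Suc i0), Suc j0), (Suc (Suc i0), j0), X (Suc i0, Suc j0) + X (i0 - 1, Suc j0)),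
     ((Suc i0, j0 - 1), (i0, j0 - 1), X (i0 - 1, Suc j0)),
     ((p, Suc j0), (p, j0), X (i0 - 1, Suc j0)),
     ((Suc i0, q'), (i0, q'), X (Suc i0, Suc j0))] F2" and l2: "length F2 = 3 + nL + nT"
  proof -
    let ?x = "\<lambda>k. (Suc i0, Suc (Suc j0) + k)" and ?y = "\<lambda>k. (i0, Suc (Suc j0) + k)"
    let ?e = "\<lambda>k. ?b (i0, Suc (Suc j0) + k)"
    have "\<exists>\<omega>' F'. arm_system \<omega>' (V0 \<union> VL \<union> (\<Union>k<nT. {?x (Suc k), ?y (Suc k)})) (G0 \<union> ?b ` CL \<union> ?e ` {..<nT})
      ((?x nT, ?y nT, X (Suc i0, Suc j0)) # [((Suc (Suc i0), Suc j0), (Suc (Suc i0), j0), X (Suc i0, Suc j0) + X (i0 - 1, Suc j0)),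
     ((Suc i0, j0 - 1), (i0, j0 - 1), X (i0 - 1, Suc j0)),
     ((p, Suc j0), (p, j0), X (i0 - 1, Suc j0))]) F' \<and> length F' = length F1 + nT"
      by (rule arm_system_arm)
        (use 1 p in \<open>auto simp: V0_def VL_def inj_on_def mult.commute\<close>)
    moreover have "(\<Union>k<nT. {?x (Suc k), ?y (Suc k)}) = VT"
    proof -
      have "\<exists>k<nT. j = Suc (Suc (Suc (j0 + k)))" if "Suc (Suc (Suc j0)) \<le> j" "j \<le> q'" for j
        using that by (intro exI[of _ "j - Suc (Suc (Suc j0))"]) (auto simp: nT_def)
      then show ?thesis by (auto simp: VT_def nT_def) blast+
    qed
    moreover have "?e ` {..<nT} = ?b ` CT"
    proof -
      have "\<exists>k<nT. j = Suc (Suc (j0 + k))" if "Suc (Suc j0) \<le> j" "j < q'" for j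
        using that by (intro exI[of _ "j - Suc (Suc j0)"]) (auto simp: nT_def)
      then have "(\<lambda>k. (i0, Suc (Suc j0) + k)) ` {..<nT} = CT"
        by (auto simp: CT_def nT_def image_iff) blast
      then show ?thesis by (metis (no_types, lifting) image_cong image_image)
    qed
    moreover have "Suc (Suc j0) + nT = q'" using p by (simp add: nT_def)
    ultimately show ?thesis using that l1 arm_system_rotate by fastforce
  qed
  obtain \<omega>3 F3 where 3: "arm_system \<omega>3 (V0 \<union> VL \<union> VT \<union> VR) (G0 \<union> ?b ` CL \<union> ?b ` CT \<union> ?b ` CR)
    [((Suc i0, j0 - 1), (i0, j0 - 1), X (i0 - 1, Suc j0)),
     ((p, Suc j0), (p, j0), X (i0 - 1, Suc j0)),
     ((Suc i0, q'), (i0, q'), X (Suc i0, Suc j0)),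
     ((q, Suc j0), (q, j0), X (Suc i0, Suc j0) + X (i0 - 1, Suc j0))] F3" and l3: "length F3 = 3 + nL + nT + nR"
  proof -
    let ?x = "\<lambda>k. (Suc (Suc i0) + k, Suc j0)" and ?y = "\<lambda>k. (Suc (Suc i0) + k, j0)"
    let ?e = "\<lambda>k. ?b (Suc (Suc i0) + k, j0)"
    have "\<exists>\<omega>' F'. arm_system \<omega>' (V0 \<union> VL \<union> VT \<union> (\<Union>k<nR. {?x (Suc k), ?y (Suc k)})) (G0 \<union> ?b ` CL \<union> ?b ` CT \<union> ?e ` {..<nR})
      ((?x nR, ?y nR, X (Suc i0, Suc j0) + X (i0 - 1, Suc j0)) # [((Suc i0, j0 - 1), (i0, j0 - 1), X (i0 - 1, Suc j0)),
     ((p, Suc j0), (p, j0), X (i0 - 1, Suc j0)),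
     ((Suc i0, q'), (i0, q'), X (Suc i0, Suc j0))]) F' \<and> length F' = length F2 + nR"
      by (rule arm_system_arm)
        (use 2 p in \<open>auto simp: V0_def VL_def VT_def inj_on_def mult.commute\<close>)
    moreover have "(\<Union>k<nR. {?x (Suc k), ?y (Suc k)}) = VR"
    proof -
      have "\<exists>k<nR. j = Suc (Suc (Suc (i0 + k)))" if "Suc (Suc (Suc i0)) \<le> j" "j \<le> q" for j
        using that by (intro exI[of _ "j - Suc (Suc (Suc i0))"]) (auto simp: nR_def)
      then show ?thesis by (auto simp: VR_def nR_def) blast+
    qed
    moreover have "?e ` {..<nR} = ?b ` CR"
    proof -
      have "\<exists>k<nR. j = Suc (Suc (i0 + k))" if "Suc (Suc i0) \<le> j" "j < q" for j
        using that by (intro exI[of _ "j - Suc (Suc i0)"]) (auto simp: nR_def)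
      then have "(\<lambda>k. (Suc (Suc i0) + k, j0)) ` {..<nR} = CR"
        by (auto simp: CR_def nR_def image_iff) blast
      then show ?thesis by (metis (no_types, lifting) image_cong image_image)
    qed
    moreover have "Suc (Suc i0) + nR = q" using p by (simp add: nR_def)
    ultimately show ?thesis using that l2 arm_system_rotate by fastforce
  qed
  obtain \<omega>4 F4 where 4: "arm_system \<omega>4 (V0 \<union> VL \<union> VT \<union> VR \<union> VB) (G0 \<union> ?b ` CL \<union> ?b ` CT \<union> ?b ` CR \<union> ?b ` CB)
    [((p, Suc j0), (p, j0), X (i0 - 1, Suc j0)),
     ((Suc i0, q'), (i0, q'), X (Suc i0, Suc j0)),
     ((q, Suc j0), (q, j0), X (Suc i0, Suc j0) + X (i0 - 1, Suc j0)),
     ((Suc i0, p'), (i0, p'), X (i0 - 1, Suc j0))] F4" and l4: "length F4 = 3 + nL + nT + nR + nB"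
  proof -
    let ?x = "\<lambda>k. (Suc i0, j0 - 1 - k)" and ?y = "\<lambda>k. (i0, j0 - 1 - k)"
    let ?e = "\<lambda>k. ?b (i0, j0 - 1 - Suc k)"
    have s: "j0 - 1 - k = Suc (j0 - 1 - Suc k)" if "k < nB" for k using that by (simp add: nB_def)
    have e: "?e k = X (?y (Suc k)) * X (?x k) - X (?x (Suc k)) * X (?y k)" if "k < nB" for k
      unfolding s[OF that] by (simp add: mult.commute)
    have "\<exists>\<omega>' F'. arm_system \<omega>' (V0 \<union> VL \<union> VT \<union> VR \<union> (\<Union>k<nB. {?x (Suc k), ?y (Suc k)}))
      (G0 \<union> ?b ` CL \<union> ?b ` CT \<union> ?b ` CR \<union> ?e ` {..<nB})
      ((?x nB, ?y nB, X (i0 - 1, Suc j0)) # [((p, Suc j0), (p, j0), X (i0 - 1, Suc j0)),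
     ((Suc i0, q'), (i0, q'), X (Suc i0, Suc j0)),
     ((q, Suc j0), (q, j0), X (Suc i0, Suc j0) + X (i0 - 1, Suc j0))]) F' \<and> length F' = length F3 + nB"
    proof (rule arm_system_arm)
      show "?e k \<in> {X (?x (Suc k)) * X (?y k) - X (?y (Suc k)) * X (?x k), X (?y (Suc k)) * X (?x k) - X (?x (Suc k)) * X (?y k)}"
        if "k < nB" for k using e[OF that] by blast
    qed (use 3 p in \<open>auto simp: V0_def VL_def VT_def VR_def nB_def inj_on_def\<close>)
    moreover have "(\<Union>k<nB. {?x (Suc k), ?y (Suc k)}) = VB"
    proof -
      have "\<exists>k<nB. i = j0 - 1 - Suc k" if "p' \<le> i" "i < j0 - 1" for i
        using that by (intro exI[of _ "j0 - 2 - i"]) (auto simp: nB_def)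
      then show ?thesis by (auto simp: VB_def nB_def) blast+
    qed
    moreover have "?e ` {..<nB} = ?b ` CB"
    proof -
      have "\<exists>k<nB. i = j0 - 1 - Suc k" if "p' \<le> i" "i < j0 - 1" for i
        using that by (intro exI[of _ "j0 - 2 - i"]) (auto simp: nB_def)
      then have "(\<lambda>k. (i0, j0 - 1 - Suc k)) ` {..<nB} = CB"
        by (auto simp: CB_def nB_def image_iff) blast
      then show ?thesis by (metis (no_types, lifting) image_cong image_image)
    qed
    moreover have "j0 - 1 - nB = p'" using p by (simp add: nB_def)
    ultimately show ?thesis using that l3 arm_system_rotate by fastforce
  qed
  have "V0 \<union> VL \<union> VT \<union> VR \<union> VB = {p..q} \<times> {j0, Suc j0} \<union> {i0, Suc i0} \<times> {p'..q'}"
  proof -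
    have "{p..q} = {p..<i0 - 1} \<union> {i0 - 1, i0, Suc i0, Suc (Suc i0)} \<union> {Suc (Suc (Suc i0))..q}"
      "{p'..q'} = {p'..<j0 - 1} \<union> {j0 - 1, j0, Suc j0, Suc (Suc j0)} \<union> {Suc (Suc (Suc j0))..q'}"
      using p by auto
    then have "{p..q} \<times> {j0, Suc j0} = VL \<union> {i0 - 1, i0, Suc i0, Suc (Suc i0)} \<times> {j0, Suc j0} \<union> VR"
      "{i0, Suc i0} \<times> {p'..q'} = VB \<union> {i0, Suc i0} \<times> {j0 - 1, j0, Suc j0, Suc (Suc j0)} \<union> VT"
      by (simp_all only: VL_def VT_def VR_def VB_def Sigma_Un_distrib1 Sigma_Un_distrib2)
    moreover have "V0 = {i0 - 1, i0, Suc i0, Suc (Suc i0)} \<times> {j0, Suc j0} \<union>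
        {i0, Suc i0} \<times> {j0 - 1, j0, Suc j0, Suc (Suc j0)}"
      unfolding V0_def by (simp add: insert_Times_insert) (simp add: insert_commute)
    ultimately show ?thesis by (simp only: Un_ac)
  qed
  moreover have "G0 \<union> ?b ` CL \<union> ?b ` CT \<union> ?b ` CR \<union> ?b ` CB = ?b ` cross i0 j0 p q p' q'"
  proof -
    have "{p..<q} = {p..<i0 - 1} \<union> {i0 - 1, i0, Suc i0} \<union> {Suc (Suc i0)..<q}"
      "{p'..<q'} = {p'..<j0 - 1} \<union> {j0 - 1, j0, Suc j0} \<union> {Suc (Suc j0)..<q'}"
      using p by auto
    then have "cross i0 j0 p q p' q' = {(i0, j0), (i0, Suc j0), (Suc i0, j0), (i0 - 1, j0), (i0, j0 - 1)} \<union> CL \<union> CT \<union> CR \<union> CB"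
      unfolding cross_def CL_def CT_def CR_def CB_def by auto
    then show ?thesis by (simp only: G0_def image_Un)
  qed
  moreover have "length F4 + 2 = (q - p) + (q' - p') - 1"
    using l4 p by (simp add: nL_def nT_def nR_def nB_def)
  ultimately show ?thesis using 4 by metis
qed

section \<open>Quasi-regular sequences\<close>

fun pmon :: "'a::comm_ring_1 list \<Rightarrow> nat list \<Rightarrow> 'a" where
  "pmon (f # fs) (i # \<alpha>) = f ^ i * pmon fs \<alpha>"
| "pmon _ _ = 1"

definition exps :: "nat \<Rightarrow> nat \<Rightarrow> nat list set" where
  "exps n k = {\<alpha>. length \<alpha> = n \<and> sum_list \<alpha> = k}"

lemma finite_exps [simp]: "finite (exps n k)"
proof (rule finite_subset)
  show "exps n k \<subseteq> {\<alpha>. set \<alpha> \<subseteq> {..k} \<and> length \<alpha> = n}"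
    using member_le_sum_list by (fastforce simp: exps_def)
qed (simp add: finite_lists_length_eq)

lemma exps_0: "exps n 0 = {replicate n 0}"
  by (auto simp: exps_def sum_list_replicate intro: replicate_eqI)

lemma pmon_replicate_0: "pmon fs (replicate n 0) = 1"
proof (induction fs arbitrary: n)
  case (Cons f fs)
  then show ?case by (cases n) simp_all
qed simp

lemma pmon_add:
  "length \<alpha> = length fs \<Longrightarrow> length \<beta> = length fs \<Longrightarrow> pmon fs (map2 (+) \<alpha> \<beta>) = pmon fs \<alpha> * pmon fs \<beta>"
proof (induction fs arbitrary: \<alpha> \<beta>)
  case (Cons f fs)
  obtain i \<alpha>' j \<beta>' where "\<alpha> = i # \<alpha>'" "\<beta> = j # \<beta>'" using Cons.prems by (auto simp: length_Suc_conv)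
  then show ?case using Cons by (simp add: power_add mult_ac)
qed simp

lemma sum_list_map2_add:
  "length \<alpha> = length \<beta> \<Longrightarrow> sum_list (map2 (+) \<alpha> \<beta>) = sum_list \<alpha> + (sum_list \<beta> :: nat)"
  by (induction rule: list_induct2) simp_all

lemma exps_add: "\<alpha> \<in> exps n k \<Longrightarrow> \<beta> \<in> exps n l \<Longrightarrow> map2 (+) \<alpha> \<beta> \<in> exps n (k + l)"
  by (auto simp: exps_def sum_list_map2_add)

lemma pmon_lower:
  "length \<beta> = length fs \<Longrightarrow> sum_list \<beta> = Suc k \<Longrightarrow>
    \<exists>h\<in>set fs. \<exists>\<alpha>\<in>exps (length fs) k. pmon fs \<beta> = h * pmon fs \<alpha>"
proof (induction fs arbitrary: \<beta> k)
  case (Cons f fs)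
  obtain i \<beta>' where \<beta>: "\<beta> = i # \<beta>'" "length \<beta>' = length fs" using Cons.prems by (auto simp: length_Suc_conv)
  show ?case
  proof (cases i)
    case 0
    then obtain h \<alpha> where "h \<in> set fs" "\<alpha> \<in> exps (length fs) k" "pmon fs \<beta>' = h * pmon fs \<alpha>"
      using Cons.IH[of \<beta>' k] Cons.prems \<beta> by auto
    then show ?thesis using 0 \<beta> by (intro bexI[of _ h] bexI[of _ "0 # \<alpha>"]) (auto simp: exps_def)
  next
    case (Suc j)
    then show ?thesis using Cons.prems \<beta>
      by (intro bexI[of _ f] bexI[of _ "j # \<beta>'"]) (auto simp: exps_def mult_ac)
  qed
qed simp

lemma pmon_raise:
  "h \<in> set fs \<Longrightarrow> \<alpha> \<in> exps (length fs) k \<Longrightarrow> \<exists>\<beta>\<in>exps (length fs) (Suc k). pmon fs \<beta> = h * pmon fs \<alpha>"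
proof (induction fs arbitrary: \<alpha> k)
  case (Cons f fs)
  obtain i \<alpha>' where \<alpha>: "\<alpha> = i # \<alpha>'" "\<alpha>' \<in> exps (length fs) (k - i)" "i \<le> k"
    using Cons.prems by (auto simp: exps_def length_Suc_conv)
  show ?case
  proof (cases "h = f")
    case True
    then show ?thesis using \<alpha> by (intro bexI[of _ "Suc i # \<alpha>'"]) (auto simp: exps_def mult_ac)
  next
    case False
    then obtain \<beta> where "\<beta> \<in> exps (length fs) (Suc (k - i))" "pmon fs \<beta> = h * pmon fs \<alpha>'"
      using Cons.IH[of \<alpha>' "k - i"] Cons.prems \<alpha> by auto
    then show ?thesis using \<alpha> by (intro bexI[of _ "i # \<beta>"]) (auto simp: exps_def mult_ac)
  qed
qed simp

fun inc_hd :: "nat list \<Rightarrow> nat list" where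
  "inc_hd (i # \<alpha>) = Suc i # \<alpha>"
| "inc_hd [] = []"

text \<open>With this split a form of degree \<open>k + 1\<close> in \<open>f # fs\<close> is
  written \<open>G + f H\<close>, where \<open>G\<close> is a form in \<open>fs\<close>
  alone.\<close>

lemma sum_exps_Suc:
  "(\<Sum>\<alpha>\<in>exps (Suc n) (Suc k). g \<alpha>) = (\<Sum>\<alpha>\<in>exps n (Suc k). g (0 # \<alpha>)) + (\<Sum>\<beta>\<in>exps (Suc n) k. g (inc_hd \<beta>))"
proof -
  have eq: "exps (Suc n) (Suc k) = Cons 0 ` exps n (Suc k) \<union> inc_hd ` exps (Suc n) k" (is "?l = ?r")
  proof
    show "?l \<subseteq> ?r"
    proof
      fix \<alpha> assume a: "\<alpha> \<in> ?l"
      then obtain i \<alpha>' where \<alpha>: "\<alpha> = i # \<alpha>'" "length \<alpha>' = n" by (auto simp: exps_def length_Suc_conv)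
      show "\<alpha> \<in> ?r"
      proof (cases i)
        case 0
        then show ?thesis using a \<alpha> by (auto simp: exps_def)
      next
        case (Suc j)
        then have "\<alpha> = inc_hd (j # \<alpha>')" "j # \<alpha>' \<in> exps (Suc n) k" using a \<alpha> by (auto simp: exps_def)
        then show ?thesis by blast
      qed
    qed
    show "?r \<subseteq> ?l" by (auto simp: exps_def length_Suc_conv)
  qed
  have inj: "inj_on inc_hd (exps (Suc n) k)"
  proof (rule inj_onI)
    fix \<alpha> \<beta> assume "\<alpha> \<in> exps (Suc n) k" "\<beta> \<in> exps (Suc n) k" "inc_hd \<alpha> = inc_hd \<beta>"
    then show "\<alpha> = \<beta>" by (cases \<alpha>; cases \<beta>) (simp_all add: exps_def)
  qed
  have "Cons 0 ` exps n (Suc k) \<inter> inc_hd ` exps (Suc n) k = {}"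
    by (auto simp: exps_def length_Suc_conv)
  then show ?thesis
    unfolding eq by (subst sum.union_disjoint) (auto simp: sum.reindex[OF inj] sum.reindex)
qed

text \<open>The ideal \<open>A + (fs)\<^sup>k\<close>.\<close>

definition powers :: "'a::comm_ring_1 set \<Rightarrow> 'a list \<Rightarrow> nat \<Rightarrow> 'a set" where
  "powers A fs k = {x. \<exists>c. x - (\<Sum>\<alpha>\<in>exps (length fs) k. c \<alpha> * pmon fs \<alpha>) \<in> A}"

lemma is_ideal_powers: assumes A: "is_ideal A" shows "is_ideal (powers A fs k)"
  unfolding idl.subspace_def
proof (intro conjI ballI allI)
  show "0 \<in> powers A fs k"
    unfolding powers_def mem_Collect_eq using idl.subspace_0[OF A] by (intro exI[of _ "\<lambda>_. 0"]) simp
next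
  fix x y assume "x \<in> powers A fs k" "y \<in> powers A fs k"
  then obtain c d where "x - (\<Sum>\<alpha>\<in>exps (length fs) k. c \<alpha> * pmon fs \<alpha>) \<in> A"
    "y - (\<Sum>\<alpha>\<in>exps (length fs) k. d \<alpha> * pmon fs \<alpha>) \<in> A" by (auto simp: powers_def)
  from idl.subspace_add[OF A this]
  have "x + y - (\<Sum>\<alpha>\<in>exps (length fs) k. (c \<alpha> + d \<alpha>) * pmon fs \<alpha>) \<in> A"
    by (simp add: algebra_simps sum.distrib)
  then show "x + y \<in> powers A fs k"
    unfolding powers_def mem_Collect_eq by (rule exI[of _ "\<lambda>\<alpha>. c \<alpha> + d \<alpha>"])
next
  fix a x assume "x \<in> powers A fs k"
  then obtain c where "x - (\<Sum>\<alpha>\<in>exps (length fs) k. c \<alpha> * pmon fs \<alpha>) \<in> A" by (auto simp: powers_def)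
  from ideal_mem_comb(1)[OF A this, of a]
  have "a * x - (\<Sum>\<alpha>\<in>exps (length fs) k. (a * c \<alpha>) * pmon fs \<alpha>) \<in> A"
    by (simp add: right_diff_distrib sum_distrib_left mult.assoc)
  then show "a * x \<in> powers A fs k"
    unfolding powers_def mem_Collect_eq by (rule exI[of _ "\<lambda>\<alpha>. a * c \<alpha>"])
qed

lemma subset_powers: "A \<subseteq> powers A fs k"
proof
  fix x assume "x \<in> A"
  then show "x \<in> powers A fs k"
    unfolding powers_def mem_Collect_eq by (intro exI[of _ "\<lambda>_. 0"]) simp
qed

lemma pmon_in_powers: assumes "is_ideal A" "\<alpha> \<in> exps (length fs) k" shows "pmon fs \<alpha> \<in> powers A fs k"
proof -
  have "(\<Sum>\<beta>\<in>exps (length fs) k. (if \<beta> = \<alpha> then 1 else 0) * pmon fs \<beta>) = pmon fs \<alpha>"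
    using assms(2) by (simp add: if_distrib[of "\<lambda>x. x * _"] cong: if_cong)
  then show ?thesis
    using idl.subspace_0[OF assms(1)] by (auto simp: powers_def intro!: exI[of _ "\<lambda>\<beta>. if \<beta> = \<alpha> then 1 else 0"])
qed

text \<open>One factor of each monomial of degree \<open>k + 1\<close> is absorbed into its
  coefficient, and the terms with the same remaining monomial are collected.\<close>

lemma powers_form:
  assumes "x \<in> powers A fs (Suc k)"
  shows "\<exists>e. (\<forall>\<alpha>. e \<alpha> \<in> idl.span (set fs)) \<and> x - (\<Sum>\<alpha>\<in>exps (length fs) k. e \<alpha> * pmon fs \<alpha>) \<in> A"
proof -
  let ?n = "length fs"
  obtain c where c: "x - (\<Sum>\<beta>\<in>exps ?n (Suc k). c \<beta> * pmon fs \<beta>) \<in> A" using assms by (auto simp: powers_def)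
  have "\<forall>\<beta>\<in>exps ?n (Suc k). \<exists>h \<alpha>. h \<in> set fs \<and> \<alpha> \<in> exps ?n k \<and> pmon fs \<beta> = h * pmon fs \<alpha>"
  proof
    fix \<beta> assume "\<beta> \<in> exps ?n (Suc k)"
    then have "length \<beta> = ?n" "sum_list \<beta> = Suc k" by (auto simp: exps_def)
    from pmon_lower[OF this] show "\<exists>h \<alpha>. h \<in> set fs \<and> \<alpha> \<in> exps ?n k \<and> pmon fs \<beta> = h * pmon fs \<alpha>" by blast
  qed
  then obtain h d where hd: "\<And>\<beta>. \<beta> \<in> exps ?n (Suc k) \<Longrightarrow> h \<beta> \<in> set fs \<and> d \<beta> \<in> exps ?n k \<and> pmon fs \<beta> = h \<beta> * pmon fs (d \<beta>)"
    by metis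
  define e where "e \<alpha> = (\<Sum>\<beta>\<in>{\<beta>\<in>exps ?n (Suc k). d \<beta> = \<alpha>}. c \<beta> * h \<beta>)" for \<alpha>
  have "(\<Sum>\<alpha>\<in>exps ?n k. e \<alpha> * pmon fs \<alpha>) =
      (\<Sum>\<alpha>\<in>exps ?n k. \<Sum>\<beta>\<in>{\<beta>\<in>exps ?n (Suc k). d \<beta> = \<alpha>}. c \<beta> * pmon fs \<beta>)"
    unfolding e_def sum_distrib_right by (intro sum.cong refl) (use hd in \<open>auto simp: mult.assoc\<close>)
  also have "\<dots> = (\<Sum>\<beta>\<in>exps ?n (Suc k). c \<beta> * pmon fs \<beta>)"
    by (rule sum.group) (use hd in auto)
  finally have "x - (\<Sum>\<alpha>\<in>exps ?n k. e \<alpha> * pmon fs \<alpha>) \<in> A" using c by simp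
  moreover have "e \<alpha> \<in> idl.span (set fs)" for \<alpha>
    unfolding e_def using hd by (intro idl.span_sum idl.span_scale idl.span_base) auto
  ultimately show ?thesis by blast
qed

lemma powers_Suc_subset: "powers A fs (Suc k) \<subseteq> powers A fs k"
proof
  fix x assume "x \<in> powers A fs (Suc k)"
  from powers_form[OF this] show "x \<in> powers A fs k" by (auto simp: powers_def)
qed

lemma powers_antimono: "k \<le> l \<Longrightarrow> powers A fs l \<subseteq> powers A fs k"
  by (induction rule: inc_induct) (use powers_Suc_subset in blast)+

lemma mult_pmon_in_powers:
  assumes A: "is_ideal A" and e: "e \<in> adjoins A fs" and \<alpha>: "\<alpha> \<in> exps (length fs) k"
  shows "e * pmon fs \<alpha> \<in> powers A fs (Suc k)"
proof -
  let ?P = "powers A fs (Suc k)"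
  have P: "is_ideal ?P" using A by (rule is_ideal_powers)
  have "idl.span (A \<union> set fs) \<subseteq> {e. e * pmon fs \<alpha> \<in> ?P}"
  proof (rule idl.span_minimal)
    show "is_ideal {e. e * pmon fs \<alpha> \<in> ?P}"
      using P by (auto simp: idl.subspace_def distrib_right mult.assoc)
    have "h * pmon fs \<alpha> \<in> ?P" if "h \<in> set fs" for h
      using pmon_raise[OF that \<alpha>] pmon_in_powers[OF A] by metis
    moreover have "a * pmon fs \<alpha> \<in> ?P" if "a \<in> A" for a
      using subset_powers ideal_mem_comb(2)[OF A that] by blast
    ultimately show "A \<union> set fs \<subseteq> {e. e * pmon fs \<alpha> \<in> ?P}" by auto
  qed
  then show ?thesis using e by (auto simp: adjoins_eq_span[OF A])
qed

text \<open>In other words, the graded ring of the filtration by the ideals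
  \<open>A + (fs)^k\<close> is a polynomial ring over the quotient by \<open>A + (fs)\<close>, with
  the classes of \<open>fs\<close> as variables.\<close>

definition quasi_regular :: "'a::comm_ring_1 set \<Rightarrow> 'a list \<Rightarrow> bool" where
  "quasi_regular A fs \<longleftrightarrow> (\<forall>k c. (\<Sum>\<alpha>\<in>exps (length fs) k. c \<alpha> * pmon fs \<alpha>) \<in> A \<longrightarrow>
     (\<forall>\<alpha>\<in>exps (length fs) k. c \<alpha> \<in> adjoins A fs))"

lemma quasi_regularD:
  "quasi_regular A fs \<Longrightarrow> (\<Sum>\<alpha>\<in>exps (length fs) k. c \<alpha> * pmon fs \<alpha>) \<in> A \<Longrightarrow> \<alpha> \<in> exps (length fs) k \<Longrightarrow>
    c \<alpha> \<in> adjoins A fs"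
  unfolding quasi_regular_def by blast

text \<open>If \<open>f y\<close> lies in the next power, induction writes \<open>y\<close> as a
  form of degree \<open>j\<close> in \<open>fs\<close>. Quasi-regularity compares coefficients:
  \<open>f\<close> times each coefficient of \<open>y\<close> lies in \<open>A + (fs)\<close>, hence
  so does the coefficient, and \<open>y\<close> gains a degree.\<close>

lemma nzd_powers:
  assumes A: "is_ideal A" and q: "quasi_regular A fs" and f: "nzd (adjoins A fs) f"
  shows "nzd (powers A fs j) f"
  unfolding nzd_def
proof (intro allI)
  fix y show "f * y \<in> powers A fs j \<longrightarrow> y \<in> powers A fs j"
  proof (induction j)
    case 0
    then show ?case using idl.subspace_0[OF A]
      by (auto simp: powers_def exps_0 pmon_replicate_0 intro!: exI[of _ "\<lambda>_. y"])
  next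
    case (Suc j)
    show ?case
    proof
      let ?s = "\<lambda>c. \<Sum>\<alpha>\<in>exps (length fs) j. c \<alpha> * pmon fs \<alpha>"
      assume fy: "f * y \<in> powers A fs (Suc j)"
      then have "y \<in> powers A fs j" using Suc powers_Suc_subset by blast
      then obtain c where c: "y - ?s c \<in> A" by (auto simp: powers_def)
      obtain e where e: "\<And>\<alpha>. e \<alpha> \<in> idl.span (set fs)" "f * y - ?s e \<in> A" using powers_form[OF fy] by blast
      have "(f * y - ?s e) - f * (y - ?s c) \<in> A"
        by (rule idl.subspace_diff[OF A e(2) ideal_mem_comb(1)[OF A c]])
      also have "(f * y - ?s e) - f * (y - ?s c) = ?s (\<lambda>\<alpha>. f * c \<alpha> - e \<alpha>)"
        by (simp add: algebra_simps sum_distrib_left sum_subtractf)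
      finally have *: "f * c \<alpha> - e \<alpha> \<in> adjoins A fs" if "\<alpha> \<in> exps (length fs) j" for \<alpha>
        using quasi_regularD[OF q, of "\<lambda>\<alpha>. f * c \<alpha> - e \<alpha>" j \<alpha>] that by simp
      have P: "is_ideal (adjoins A fs)" using A by simp
      have ea: "e \<alpha> \<in> adjoins A fs" for \<alpha>
        using e(1) idl.span_mono[of "set fs" "A \<union> set fs"] by (auto simp: adjoins_eq_span[OF A])
      have "c \<alpha> \<in> adjoins A fs" if "\<alpha> \<in> exps (length fs) j" for \<alpha>
        using idl.subspace_add[OF P *[OF that] ea[of \<alpha>]] f nzdD by auto
      then have "?s c \<in> powers A fs (Suc j)"
        using mult_pmon_in_powers[OF A] by (intro idl.subspace_sum[OF is_ideal_powers[OF A]]) auto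
      moreover have "y - ?s c \<in> powers A fs (Suc j)" using c subset_powers by blast
      ultimately show "y \<in> powers A fs (Suc j)"
        using idl.subspace_add[OF is_ideal_powers[OF A], of "y - ?s c" fs "Suc j" "?s c"] by simp
    qed
  qed
qed

text \<open>The head \<open>f\<close> is the last element of the sequence here.\<close>

lemma quasi_regular_Cons:
  assumes A: "is_ideal A" and q: "quasi_regular A fs" and f: "nzd (adjoins A fs) f"
  shows "quasi_regular A (f # fs)"
proof -
  let ?n = "length fs"
  have B: "is_ideal (adjoins A (f # fs))" "adjoins A fs \<subseteq> adjoins A (f # fs)"
    using A adjoins_mono[OF A, of fs "f # fs"] by auto
  have "\<forall>\<alpha>\<in>exps (Suc ?n) k. c \<alpha> \<in> adjoins A (f # fs)"
    if "(\<Sum>\<alpha>\<in>exps (Suc ?n) k. c \<alpha> * pmon (f # fs) \<alpha>) \<in> A" for k c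
    using that
  proof (induction k arbitrary: c)
    case 0
    then have "c (replicate (Suc ?n) 0) \<in> A" unfolding exps_0 by (simp add: pmon_replicate_0)
    then have "c (replicate (Suc ?n) 0) \<in> adjoins A (f # fs)" by (rule mem_adjoins_left[OF A])
    then show ?case by (simp only: exps_0 ball_simps simp_thms)
  next
    case (Suc k)
    let ?G = "\<Sum>\<alpha>\<in>exps ?n (Suc k). c (0 # \<alpha>) * pmon fs \<alpha>"
    let ?H = "\<Sum>\<beta>\<in>exps (Suc ?n) k. c (inc_hd \<beta>) * pmon (f # fs) \<beta>"
    have inc: "pmon (f # fs) (inc_hd \<beta>) = f * pmon (f # fs) \<beta>" if "\<beta> \<in> exps (Suc ?n) k" for \<beta>
      using that by (auto simp: exps_def length_Suc_conv mult_ac)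
    have "?G + f * ?H \<in> A"
      using Suc.prems by (simp add: sum_exps_Suc sum_distrib_left inc mult_ac)
    note GH = this
    have P: "is_ideal (powers A fs (Suc k))" by (rule is_ideal_powers[OF A])
    have "?G \<in> powers A fs (Suc k)"
      by (intro idl.subspace_sum[OF P] ideal_mem_comb(1)[OF P] pmon_in_powers[OF A])
    then have "f * ?H \<in> powers A fs (Suc k)"
      using idl.subspace_diff[OF P subsetD[OF subset_powers GH]] by fastforce
    then have H: "?H \<in> powers A fs (Suc k)" using nzd_powers[OF A q f] nzdD by blast
    then obtain h where h: "?H - (\<Sum>\<alpha>\<in>exps ?n (Suc k). h \<alpha> * pmon fs \<alpha>) \<in> A" by (auto simp: powers_def)
    have "(?G + f * ?H) - f * (?H - (\<Sum>\<alpha>\<in>exps ?n (Suc k). h \<alpha> * pmon fs \<alpha>)) \<in> A"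
      by (rule idl.subspace_diff[OF A GH ideal_mem_comb(1)[OF A h]])
    also have "(?G + f * ?H) - f * (?H - (\<Sum>\<alpha>\<in>exps ?n (Suc k). h \<alpha> * pmon fs \<alpha>)) =
        (\<Sum>\<alpha>\<in>exps ?n (Suc k). (c (0 # \<alpha>) + f * h \<alpha>) * pmon fs \<alpha>)"
      by (simp add: right_diff_distrib sum_distrib_left distrib_right sum.distrib mult.assoc)
    finally have *: "c (0 # \<alpha>) + f * h \<alpha> \<in> adjoins A fs" if "\<alpha> \<in> exps ?n (Suc k)" for \<alpha>
      using quasi_regularD[OF q, of "\<lambda>\<alpha>. c (0 # \<alpha>) + f * h \<alpha>" "Suc k" \<alpha>] that by simp
    have fB: "f \<in> adjoins A (f # fs)" by (rule mem_adjoins_right[OF A]) simp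
    have c0: "c (0 # \<alpha>) \<in> adjoins A (f # fs)" if "\<alpha> \<in> exps ?n (Suc k)" for \<alpha>
      using idl.subspace_diff[OF B(1) subsetD[OF B(2) *[OF that]] ideal_mem_comb(2)[OF B(1) fB, of "h \<alpha>"]] by simp
    obtain e where e: "\<And>\<alpha>. e \<alpha> \<in> idl.span (set fs)" "?H - (\<Sum>\<alpha>\<in>exps ?n k. e \<alpha> * pmon fs \<alpha>) \<in> A"
      using powers_form[OF H] by blast
    \<comment> \<open>\<open>?H\<close> is a form of degree \<open>k\<close> in
      \<open>f # fs\<close>, yet it lies in the power \<open>k + 1\<close> of \<open>fs\<close>.
      Written with coefficients \<open>e\<close> in the ideal of \<open>fs\<close> and subtracted,
      it leaves a relation of degree \<open>k\<close> for the induction hypothesis.\<close>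
    define e' where "e' \<beta> = (if hd \<beta> = 0 then e (tl \<beta>) else 0)" for \<beta>
    have "(\<Sum>\<beta>\<in>exps (Suc ?n) k. e' \<beta> * pmon (f # fs) \<beta>) = (\<Sum>\<beta>\<in>Cons 0 ` exps ?n k. e' \<beta> * pmon (f # fs) \<beta>)"
    proof (rule sum.mono_neutral_right)
      show "Cons 0 ` exps ?n k \<subseteq> exps (Suc ?n) k" by (auto simp: exps_def)
      show "\<forall>\<beta>\<in>exps (Suc ?n) k - Cons 0 ` exps ?n k. e' \<beta> * pmon (f # fs) \<beta> = 0"
      proof
        fix \<beta> assume \<beta>: "\<beta> \<in> exps (Suc ?n) k - Cons 0 ` exps ?n k"
        then have "hd \<beta> \<noteq> 0" by (cases \<beta>) (auto simp: exps_def)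
        then show "e' \<beta> * pmon (f # fs) \<beta> = 0" by (simp add: e'_def)
      qed
    qed simp
    also have "\<dots> = (\<Sum>\<alpha>\<in>exps ?n k. e \<alpha> * pmon fs \<alpha>)" by (simp add: sum.reindex e'_def)
    finally have "(\<Sum>\<beta>\<in>exps (Suc ?n) k. (c (inc_hd \<beta>) - e' \<beta>) * pmon (f # fs) \<beta>) \<in> A"
      using e(2) by (simp add: left_diff_distrib sum_subtractf)
    then have 1: "c (inc_hd \<beta>) - e' \<beta> \<in> adjoins A (f # fs)" if "\<beta> \<in> exps (Suc ?n) k" for \<beta>
      using Suc.IH[of "\<lambda>\<beta>. c (inc_hd \<beta>) - e' \<beta>"] that by blast
    have e'B: "e' \<beta> \<in> adjoins A (f # fs)" for \<beta>
      using e(1)[of "tl \<beta>"] idl.span_mono[of "set fs" "A \<union> set (f # fs)"] idl.subspace_0[OF B(1)]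
      unfolding e'_def adjoins_eq_span[OF A] by auto
    have c1: "c (inc_hd \<beta>) \<in> adjoins A (f # fs)" if "\<beta> \<in> exps (Suc ?n) k" for \<beta>
      using idl.subspace_add[OF B(1) 1[OF that] e'B[of \<beta>]] by simp
    show ?case
    proof
      fix \<alpha> assume a: "\<alpha> \<in> exps (Suc ?n) (Suc k)"
      then obtain i \<alpha>' where \<alpha>: "\<alpha> = i # \<alpha>'" "length \<alpha>' = ?n" by (auto simp: exps_def length_Suc_conv)
      show "c \<alpha> \<in> adjoins A (f # fs)"
      proof (cases i)
        case 0
        then show ?thesis using c0[of \<alpha>'] a \<alpha> by (auto simp: exps_def)
      next
        case (Suc j)
        then show ?thesis using c1[of "j # \<alpha>'"] a \<alpha> by (auto simp: exps_def)
      qed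
    qed
  qed
  then show ?thesis unfolding quasi_regular_def by simp
qed

text \<open>The list is reversed because \<open>quasi_regular_Cons\<close> puts the element regular
  modulo all others at the head.\<close>

lemma quasi_regular_rev: "is_ideal A \<Longrightarrow> regular_list A fs \<Longrightarrow> quasi_regular A (rev fs)"
proof (induction fs rule: rev_induct)
  case Nil
  have "exps 0 k = (if k = 0 then {[]} else {})" for k by (auto simp: exps_def)
  then show ?case by (auto simp: quasi_regular_def)
next
  case (snoc f fs)
  have "adjoins A (rev fs) = adjoins A fs" using snoc.prems by (simp add: adjoins_eq_span)
  then show ?case
    using snoc quasi_regular_Cons[of A "rev fs" f] by (simp add: regular_list_snoc)
qed

text \<open>Reads an exponent vector as digits in base \<open>b\<close>. It is additive without
  restriction and injective on entries below \<open>b\<close>, so it ranks exponent vectors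
  compatibly with multiplication of monomials.\<close>

fun encode :: "nat \<Rightarrow> nat list \<Rightarrow> nat" where
  "encode b [] = 0"
| "encode b (i # \<alpha>) = i + b * encode b \<alpha>"

lemma encode_add: "length \<alpha> = length \<beta> \<Longrightarrow> encode b (map2 (+) \<alpha> \<beta>) = encode b \<alpha> + encode b \<beta>"
  by (induction rule: list_induct2) (simp_all add: algebra_simps)

lemma encode_inj:
  "length \<alpha> = length \<beta> \<Longrightarrow> \<forall>i\<in>set \<alpha>. i < b \<Longrightarrow> \<forall>i\<in>set \<beta>. i < b \<Longrightarrow> encode b \<alpha> = encode b \<beta> \<Longrightarrow> \<alpha> = \<beta>"
proof (induction rule: list_induct2)
  case (Cons x xs y ys)
  have "x = y"
    using arg_cong[OF Cons.prems(3), of "\<lambda>m. m mod b"] Cons.prems(1,2) by simp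
  then show ?case using Cons by auto
qed simp

lemma map2_add_cancel:
  fixes \<alpha> \<beta> \<beta>' :: "nat list"
  assumes l: "length \<beta> = length \<alpha>" "length \<beta>' = length \<alpha>" and eq: "map2 (+) \<beta> \<alpha> = map2 (+) \<beta>' \<alpha>"
  shows "\<beta> = \<beta>'"
proof (rule nth_equalityI)
  fix i assume "i < length \<beta>"
  then show "\<beta> ! i = \<beta>' ! i" using l arg_cong[OF eq, of "\<lambda>xs. xs ! i"] by simp
qed (use l in simp)

lemma ex_max_nat:
  fixes f :: "'b \<Rightarrow> nat"
  assumes "finite S" "S \<noteq> {}" shows "\<exists>a\<in>S. \<forall>b\<in>S. f b \<le> f a"
proof -
  have "Max (f ` S) \<in> f ` S" using assms by (intro Max_in) auto
  then obtain a where "a \<in> S" "Max (f ` S) = f a" by auto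
  then show ?thesis using assms by (intro bexI[of _ a]) (auto dest!: sym[of "Max _"])
qed

text \<open>In the associated graded ring the product of the initial forms of \<open>u\<close> and of the polynomial in
  \<open>fs\<close> does not vanish.\<close>

lemma quasi_regular_independent:
  assumes A: "is_ideal A" and q: "quasi_regular A fs" and u: "u \<notin> powers A fs K"
    and B: "finite B" "B \<noteq> {}" "\<And>\<beta>. \<beta> \<in> B \<Longrightarrow> length \<beta> = length fs"
    and c: "\<And>\<beta>. \<beta> \<in> B \<Longrightarrow> \<exists>d. d * c \<beta> = 1"
  shows "(\<Sum>\<beta>\<in>B. c \<beta> * pmon fs \<beta>) * u \<notin> A"
proof
  assume "(\<Sum>\<beta>\<in>B. c \<beta> * pmon fs \<beta>) * u \<in> A"
  note Fu = this
  let ?n = "length fs" and ?P = "adjoins A fs"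
  have P: "is_ideal ?P" using A by simp
  have "u \<in> powers A fs 0"
    using idl.subspace_0[OF A] by (auto simp: powers_def exps_0 pmon_replicate_0 intro!: exI[of _ "\<lambda>_. u"])
  then obtain k where k: "u \<in> powers A fs k" "u \<notin> powers A fs (Suc k)"
    using u ex_least_nat_less[of "\<lambda>k. u \<notin> powers A fs k" K] by blast
  then obtain w where w: "u - (\<Sum>\<alpha>\<in>exps ?n k. w \<alpha> * pmon fs \<alpha>) \<in> A" by (auto simp: powers_def)
  let ?U = "\<Sum>\<alpha>\<in>exps ?n k. w \<alpha> * pmon fs \<alpha>"
  define S where "S = {\<alpha> \<in> exps ?n k. w \<alpha> \<notin> ?P}"
  have "S \<noteq> {}"
  proof
    assume "S = {}"
    then have "w \<alpha> * pmon fs \<alpha> \<in> powers A fs (Suc k)" if "\<alpha> \<in> exps ?n k" for \<alpha>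
      using mult_pmon_in_powers[OF A _ that] that by (auto simp: S_def)
    then have "?U \<in> powers A fs (Suc k)" by (intro idl.subspace_sum[OF is_ideal_powers[OF A]])
    then show False
      using idl.subspace_add[OF is_ideal_powers[OF A] subsetD[OF subset_powers w]] k by fastforce
  qed
  have "finite S" by (simp add: S_def)
  define r where "r = Min (sum_list ` B)"
  define Br where "Br = {\<beta>\<in>B. sum_list \<beta> = r}"
  have "r \<in> sum_list ` B" unfolding r_def using B by (intro Min_in) auto
  then have Br: "finite Br" "Br \<noteq> {}" "Br \<subseteq> exps ?n r"
    using B by (auto simp: Br_def exps_def)
  have rmin: "r \<le> sum_list \<beta>" if "\<beta> \<in> B" for \<beta> using B that by (simp add: r_def)
  \<comment> \<open>Entries of vectors in \<open>S\<close> are at most \<open>k\<close>, so base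
    \<open>k + 1\<close> separates them. \<open>encode\<close> may have ties on \<open>Br\<close>;
    they do no harm, since a pair reaching the maximal sum must have \<alpha> \<open>=\<close>
    \<alpha>\<open>'\<close>, and cancellation then gives \<beta> \<open>=\<close>
    \<beta>\<open>'\<close>.\<close>
  define b where "b = Suc k"
  obtain \<alpha>' where \<alpha>': "\<alpha>' \<in> S" "\<And>\<alpha>. \<alpha> \<in> S \<Longrightarrow> encode b \<alpha> \<le> encode b \<alpha>'"
    using ex_max_nat[OF \<open>finite S\<close> \<open>S \<noteq> {}\<close>, of "encode b"] by blast
  obtain \<beta>' where \<beta>': "\<beta>' \<in> Br" "\<And>\<beta>. \<beta> \<in> Br \<Longrightarrow> encode b \<beta> \<le> encode b \<beta>'"
    using ex_max_nat[OF Br(1,2), of "encode b"] by blast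
  let ?Q = "powers A fs (Suc (k + r))"
  have Q: "is_ideal ?Q" using A by (rule is_ideal_powers)
  have big: "c \<beta> * pmon fs \<beta> * (w \<alpha> * pmon fs \<alpha>) \<in> ?Q" if \<beta>: "\<beta> \<in> B - Br" and \<alpha>: "\<alpha> \<in> exps ?n k" for \<alpha> \<beta>
  proof -
    have "\<beta> \<in> exps ?n (sum_list \<beta>)" "sum_list \<beta> \<ge> Suc r"
      using \<beta> B(3) rmin[of \<beta>] by (auto simp: exps_def Br_def)
    then have "pmon fs (map2 (+) \<beta> \<alpha>) \<in> ?Q"
      using pmon_in_powers[OF A exps_add[OF _ \<alpha>, of \<beta> "sum_list \<beta>"]]
        powers_antimono[of "Suc (k + r)" "sum_list \<beta> + k" A fs] by auto
    then have "pmon fs \<beta> * pmon fs \<alpha> \<in> ?Q" using \<alpha> \<beta> B(3) by (simp add: pmon_add exps_def)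
    from ideal_mem_comb(1)[OF Q this, of "c \<beta> * w \<alpha>"] show ?thesis by (simp add: mult_ac)
  qed
  let ?F = "\<lambda>C. \<Sum>\<beta>\<in>C. \<Sum>\<alpha>\<in>exps ?n k. c \<beta> * pmon fs \<beta> * (w \<alpha> * pmon fs \<alpha>)"
  have "(\<Sum>\<beta>\<in>B. c \<beta> * pmon fs \<beta>) * u - (\<Sum>\<beta>\<in>B. c \<beta> * pmon fs \<beta>) * (u - ?U) \<in> A"
    by (rule idl.subspace_diff[OF A Fu ideal_mem_comb(1)[OF A w]])
  then have "?F B \<in> A" by (simp add: right_diff_distrib sum_product)
  moreover have "?F B = ?F (B - Br) + ?F Br"
    using B by (intro sum.subset_diff) (auto simp: Br_def)
  moreover have "?F (B - Br) \<in> ?Q" by (intro idl.subspace_sum[OF Q] big)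
  ultimately have "?F Br \<in> ?Q"
    using idl.subspace_diff[OF Q subsetD[OF subset_powers[of A fs "Suc (k + r)"], of "?F B"], of "?F (B - Br)"] by simp
  then obtain e where e: "\<And>\<gamma>. e \<gamma> \<in> idl.span (set fs)" "?F Br - (\<Sum>\<gamma>\<in>exps ?n (k + r). e \<gamma> * pmon fs \<gamma>) \<in> A"
    using powers_form by blast
  define D where "D = Br \<times> exps ?n k"
  define pl where "pl = (\<lambda>(\<beta>, \<alpha>). map2 (+) \<beta> \<alpha> :: nat list)"
  define z where "z \<gamma> = (\<Sum>(\<beta>, \<alpha>)\<in>{x\<in>D. pl x = \<gamma>}. c \<beta> * w \<alpha>)" for \<gamma>
  have "?F Br = (\<Sum>(\<beta>, \<alpha>)\<in>D. c \<beta> * w \<alpha> * pmon fs (pl (\<beta>, \<alpha>)))"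
    unfolding D_def sum.cartesian_product[symmetric]
    by (intro sum.cong refl) (use Br in \<open>auto simp: pl_def pmon_add exps_def mult_ac\<close>)
  also have "\<dots> = (\<Sum>\<gamma>\<in>exps ?n (k + r). \<Sum>(\<beta>, \<alpha>)\<in>{x\<in>D. pl x = \<gamma>}. c \<beta> * w \<alpha> * pmon fs (pl (\<beta>, \<alpha>)))"
  proof (rule sum.group[symmetric])
    show "finite D" using Br by (simp add: D_def)
    show "pl ` D \<subseteq> exps ?n (k + r)"
      using Br exps_add[of _ ?n r _ k] by (auto simp: D_def pl_def add.commute)
  qed simp
  also have "\<dots> = (\<Sum>\<gamma>\<in>exps ?n (k + r). z \<gamma> * pmon fs \<gamma>)"
    unfolding z_def sum_distrib_right by (intro sum.cong refl) auto
  finally have "(\<Sum>\<gamma>\<in>exps ?n (k + r). (z \<gamma> - e \<gamma>) * pmon fs \<gamma>) \<in> A"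
    using e(2) by (simp add: left_diff_distrib sum_subtractf)
  moreover define \<gamma> where "\<gamma> = pl (\<beta>', \<alpha>')"
  moreover have \<gamma>: "\<gamma> \<in> exps ?n (k + r)"
    using Br \<beta>' \<alpha>' exps_add[of \<beta>' ?n r \<alpha>' k] by (auto simp: \<gamma>_def pl_def S_def add.commute)
  ultimately have "z \<gamma> - e \<gamma> \<in> ?P"
    using quasi_regularD[OF q, of "\<lambda>\<gamma>. z \<gamma> - e \<gamma>"] by simp
  moreover have "e \<gamma> \<in> ?P"
    using e(1) idl.span_mono[of "set fs" "A \<union> set fs"] by (auto simp: adjoins_eq_span[OF A])
  ultimately have z: "z \<gamma> \<in> ?P" using idl.subspace_add[OF P] by fastforce
  let ?T = "{x\<in>D. pl x = \<gamma>}"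
  have T: "finite ?T" "(\<beta>', \<alpha>') \<in> ?T" using Br \<beta>' \<alpha>' by (auto simp: D_def \<gamma>_def S_def)
  have other: "c \<beta> * w \<alpha> \<in> ?P" if x: "(\<beta>, \<alpha>) \<in> ?T - {(\<beta>', \<alpha>')}" for \<alpha> \<beta>
  proof (cases "w \<alpha> \<in> ?P")
    case False
    then have \<alpha>: "\<alpha> \<in> S" and \<beta>: "\<beta> \<in> Br" using x by (auto simp: S_def D_def)
    have len: "length \<alpha> = ?n" "length \<alpha>' = ?n" "length \<beta> = ?n" "length \<beta>' = ?n"
      using \<alpha> \<beta> \<alpha>' \<beta>' Br by (auto simp: S_def exps_def)
    have "encode b \<beta> + encode b \<alpha> = encode b \<beta>' + encode b \<alpha>'"
      using x len encode_add[of \<beta> \<alpha> b] encode_add[of \<beta>' \<alpha>' b] by (auto simp: pl_def \<gamma>_def)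
    then have "encode b \<alpha> = encode b \<alpha>'" using \<alpha>'(2)[OF \<alpha>] \<beta>'(2)[OF \<beta>] by linarith
    moreover have "i < b" if "i \<in> set \<alpha> \<union> set \<alpha>'" for i
      using that \<alpha> \<alpha>'(1) member_le_sum_list[of i \<alpha>] member_le_sum_list[of i \<alpha>'] by (auto simp: S_def exps_def b_def)
    ultimately have a: "\<alpha> = \<alpha>'" using encode_inj[of \<alpha> \<alpha>' b] len by auto
    have "map2 (+) \<beta> \<alpha>' = map2 (+) \<beta>' \<alpha>'" using x a by (auto simp: pl_def \<gamma>_def)
    then have "\<beta> = \<beta>'" using map2_add_cancel[of \<beta> \<alpha>' \<beta>'] len by simp
    then show ?thesis using x a by simp
  qed (use ideal_mem_comb(1)[OF P] in auto)
  have "z \<gamma> = c \<beta>' * w \<alpha>' + (\<Sum>(\<beta>, \<alpha>)\<in>?T - {(\<beta>', \<alpha>')}. c \<beta> * w \<alpha>)"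
    unfolding z_def by (subst sum.remove[OF T]) simp
  moreover have "(\<Sum>(\<beta>, \<alpha>)\<in>?T - {(\<beta>', \<alpha>')}. c \<beta> * w \<alpha>) \<in> ?P"
    using other by (intro idl.subspace_sum[OF P]) auto
  ultimately have cw: "c \<beta>' * w \<alpha>' \<in> ?P" using idl.subspace_diff[OF P z] by fastforce
  obtain d where d: "d * c \<beta>' = 1" using c \<beta>' by (auto simp: Br_def)
  have "d * (c \<beta>' * w \<alpha>') \<in> ?P" by (rule ideal_mem_comb(1)[OF P cw])
  then have "w \<alpha>' \<in> ?P" by (simp add: d flip: mult.assoc)
  then show False using \<alpha>'(1) by (simp add: S_def)
qed

section \<open>An upper bound for the length of regular sequences\<close>

global_interpretation mpoly_vs: vector_space "\<lambda>(c :: 'k::field) (p :: ('v, 'k) mpoly). cst c * p"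
  by unfold_locales (simp_all add: algebra_simps single_add mult_single flip: mult.assoc)

declare mpoly_vs.scale_scale [simp del] mpoly_vs.scale_one [simp del]

text \<open>The statement is about a family, whereas \<open>dependent\<close> is about a set; a
  repeated value therefore gets its own relation.\<close>

lemma ex_linear_dependence:
  fixes \<rho> :: "'i \<Rightarrow> ('v, 'k::field) mpoly"
  assumes I: "finite I" and W: "finite W" "card W < card I" and \<rho>: "\<And>i. i \<in> I \<Longrightarrow> \<rho> i \<in> mpoly_vs.span W"
  shows "\<exists>c. (\<exists>i\<in>I. c i \<noteq> 0) \<and> (\<Sum>i\<in>I. cst (c i) * \<rho> i) = 0"
proof (cases "inj_on \<rho> I")
  case True
  have "mpoly_vs.dependent (\<rho> ` I)"
    using mpoly_vs.independent_span_bound[OF W(1), of "\<rho> ` I"] \<rho> W(2) card_image[OF True] by fastforce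
  then obtain c where "\<exists>v\<in>\<rho> ` I. c v \<noteq> 0" "(\<Sum>v\<in>\<rho> ` I. cst (c v) * v) = 0"
    using mpoly_vs.dependent_finite[of "\<rho> ` I"] I by auto
  then show ?thesis
    by (intro exI[of _ "\<lambda>i. c (\<rho> i)"]) (simp add: sum.reindex[OF True])
next
  case False
  then obtain i j where ij: "i \<in> I" "j \<in> I" "i \<noteq> j" "\<rho> i = \<rho> j" by (auto simp: inj_on_def)
  define c :: "'i \<Rightarrow> 'k" where "c = (\<lambda>k. if k = i then 1 else if k = j then - 1 else 0)"
  have "(\<Sum>k\<in>I. cst (c k) * \<rho> k) = (\<Sum>k\<in>{i, j}. cst (c k) * \<rho> k)"
    using I ij by (intro sum.mono_neutral_right) (auto simp: c_def)
  also have "\<dots> = 0" using ij by (simp add: c_def single_uminus)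
  finally show ?thesis using ij by (intro exI[of _ c]) (auto simp: c_def)
qed

lemma card_monomials:
  assumes U: "finite U"
  shows "finite {m :: 'v \<Rightarrow>\<^sub>0 nat. Poly_Mapping.keys m \<subseteq> U \<and> (\<forall>v. Poly_Mapping.lookup m v \<le> N)} \<and>
    card {m :: 'v \<Rightarrow>\<^sub>0 nat. Poly_Mapping.keys m \<subseteq> U \<and> (\<forall>v. Poly_Mapping.lookup m v \<le> N)} \<le> Suc N ^ card U"
proof -
  let ?M = "{m :: 'v \<Rightarrow>\<^sub>0 nat. Poly_Mapping.keys m \<subseteq> U \<and> (\<forall>v. Poly_Mapping.lookup m v \<le> N)}"
  let ?h = "\<lambda>m. restrict (Poly_Mapping.lookup m) U"
  have inj: "inj_on ?h ?M"
  proof (rule inj_onI, rule poly_mapping_eqI)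
    fix m n v assume mn: "m \<in> ?M" "n \<in> ?M" "?h m = ?h n"
    show "Poly_Mapping.lookup m v = Poly_Mapping.lookup n v"
    proof (cases "v \<in> U")
      case True
      then show ?thesis using fun_cong[OF mn(3), of v] by simp
    next
      case False
      then show ?thesis using mn(1,2) by (metis (no_types, lifting) in_keys_iff mem_Collect_eq subsetD)
    qed
  qed
  have sub: "?h ` ?M \<subseteq> (\<Pi>\<^sub>E v\<in>U. {..N})" by auto
  have fin: "finite (\<Pi>\<^sub>E v\<in>U. {..N})" using U by (intro finite_PiE) auto
  have "card ?M \<le> card (\<Pi>\<^sub>E v\<in>U. {..N})" by (rule card_inj_on_le[OF inj sub fin])
  then show ?thesis using U inj_on_finite[OF inj sub fin] by (simp add: card_PiE)
qed

definition order_ge :: "nat \<Rightarrow> ('v, 'k::field) mpoly \<Rightarrow> bool" where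
  "order_ge k p \<longleftrightarrow> (\<forall>m\<in>Poly_Mapping.keys p. k \<le> wdeg (\<lambda>_. 1) m)"

definition degree_le :: "nat \<Rightarrow> ('v, 'k::field) mpoly \<Rightarrow> bool" where
  "degree_le k p \<longleftrightarrow> (\<forall>m\<in>Poly_Mapping.keys p. wdeg (\<lambda>_. 1) m \<le> k)"

lemma order_ge_mult: "order_ge k p \<Longrightarrow> order_ge l q \<Longrightarrow> order_ge (k + l) (p * q)"
  unfolding order_ge_def using keys_mult[of p q] by (fastforce simp: wdeg_add add_mono)

lemma degree_le_mult: "degree_le k p \<Longrightarrow> degree_le l q \<Longrightarrow> degree_le (k + l) (p * q)"
  unfolding degree_le_def using keys_mult[of p q] by (fastforce simp: wdeg_add add_mono)

lemma order_ge_power: "order_ge 1 p \<Longrightarrow> order_ge n (p ^ n)"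
  by (induction n) (use order_ge_mult[of 1 p] in \<open>auto simp: order_ge_def\<close>)

lemma degree_le_power: "degree_le e p \<Longrightarrow> degree_le (n * e) (p ^ n)"
  by (induction n) (use degree_le_mult[of e p] in \<open>auto simp: degree_le_def\<close>)

lemma order_ge_pmon:
  "\<forall>f\<in>set fs. order_ge 1 f \<Longrightarrow> length \<alpha> = length fs \<Longrightarrow> order_ge (sum_list \<alpha>) (pmon fs \<alpha>)"
proof (induction fs arbitrary: \<alpha>)
  case (Cons f fs)
  then obtain i \<alpha>' where "\<alpha> = i # \<alpha>'" by (auto simp: length_Suc_conv)
  then show ?case using Cons by (auto intro!: order_ge_mult order_ge_power)
qed (simp add: order_ge_def)

lemma degree_le_pmon:
  "\<forall>f\<in>set fs. degree_le e f \<Longrightarrow> length \<alpha> = length fs \<Longrightarrow> degree_le (sum_list \<alpha> * e) (pmon fs \<alpha>)"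
proof (induction fs arbitrary: \<alpha>)
  case (Cons f fs)
  then obtain i \<alpha>' where "\<alpha> = i # \<alpha>'" by (auto simp: length_Suc_conv)
  then show ?case using Cons by (auto simp: distrib_right intro!: degree_le_mult degree_le_power)
qed (simp add: degree_le_def)

lemma pmon_in_polys: "set fs \<subseteq> polys V \<Longrightarrow> pmon fs \<alpha> \<in> polys V"
  by (induction fs \<alpha> rule: pmon.induct) (auto intro: polys_intros)

lemma order_ge_1: "Poly_Mapping.lookup p 0 = 0 \<Longrightarrow> order_ge 1 p"
proof -
  assume p: "Poly_Mapping.lookup p 0 = 0"
  have "wdeg (\<lambda>_. 1) m \<noteq> 0" if "m \<in> Poly_Mapping.keys p" for m
  proof
    assume "wdeg (\<lambda>_. 1) m = 0"
    then have "\<forall>v\<in>Poly_Mapping.keys m. Poly_Mapping.lookup m v = 0" by (simp add: wdeg_def)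
    then have "m = 0" by (intro poly_mapping_eqI) (auto simp: in_keys_iff)
    then show False using that p by (simp add: in_keys_iff)
  qed
  then show ?thesis by (auto simp: order_ge_def Suc_le_eq)
qed

text \<open>This is the bound of the depth by the dimension of a nonzero cyclic submodule, the
  dimension being read off as the exponent \<open>d\<close> of polynomial growth. The elements of
  \<open>fs\<close> only need vanishing constant terms.\<close>

lemma regular_list_length_le:
  fixes u :: "('v, 'k::field) mpoly"
  assumes A: "homog_ideal (\<lambda>_. 1) A" and r: "regular_list A fs"
    and fs: "set fs \<subseteq> polys V" "\<And>f. f \<in> set fs \<Longrightarrow> Poly_Mapping.lookup f 0 = 0"
    and u: "homog (\<lambda>_. 1) e0 u" "u \<notin> A"
    and W: "\<And>N. finite (W N)" "\<And>N. card (W N) \<le> L * Suc N ^ d"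
    and red: "\<And>m N. Poly_Mapping.keys m \<subseteq> V \<Longrightarrow> wdeg (\<lambda>_. 1) m \<le> N \<Longrightarrow>
      \<exists>y\<in>mpoly_vs.span ((\<lambda>m. monom m * u) ` W N). monom m * u - y \<in> A"
  shows "length fs \<le> d"
proof (rule ccontr)
  assume "\<not> length fs \<le> d"
  then have d: "Suc d \<le> length fs" by simp
  have iA: "is_ideal A" using A by (simp add: homog_ideal_def)
  let ?n = "length fs"
  define gs where "gs = rev fs"
  have gs: "set gs = set fs" "length gs = ?n" by (auto simp: gs_def)
  have q: "quasi_regular A gs" unfolding gs_def by (rule quasi_regular_rev[OF iA r])
  \<comment> \<open>A product of \<open>e0 + 1\<close> elements without constant term has no term of
    degree \<open>e0\<close>. If \<open>u\<close> were such a combination modulo \<open>A\<close>,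
    its part of degree \<open>e0\<close>, which is \<open>u\<close>, would lie in
    \<open>A\<close>.\<close>
  have "u \<notin> powers A gs (Suc e0)"
  proof
    assume "u \<in> powers A gs (Suc e0)"
    then obtain c where c: "u - (\<Sum>\<alpha>\<in>exps ?n (Suc e0). c \<alpha> * pmon gs \<alpha>) \<in> A" by (auto simp: powers_def gs)
    have "hpart (\<lambda>_. 1) e0 (c \<alpha> * pmon gs \<alpha>) = 0" if "\<alpha> \<in> exps ?n (Suc e0)" for \<alpha>
    proof -
      have "order_ge (Suc e0) (pmon gs \<alpha>)"
        using order_ge_pmon[of gs \<alpha>] that order_ge_1 fs(2) by (auto simp: gs exps_def)
      then have "order_ge (0 + Suc e0) (c \<alpha> * pmon gs \<alpha>)"
        by (intro order_ge_mult) (auto simp: order_ge_def)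
      then have "lin (\<lambda>k. if wdeg (\<lambda>_. 1) k = e0 then monom k else 0) (c \<alpha> * pmon gs \<alpha>) =
          lin (\<lambda>_. 0 :: ('v, 'k) mpoly) (c \<alpha> * pmon gs \<alpha>)"
        by (intro lin_cong) (auto simp: order_ge_def)
      then show ?thesis by (simp add: hpart_def lin_def)
    qed
    then have "hpart (\<lambda>_. 1) e0 (u - (\<Sum>\<alpha>\<in>exps ?n (Suc e0). c \<alpha> * pmon gs \<alpha>)) = hpart (\<lambda>_. 1) e0 u"
      by (simp add: hpart_def lin_diff lin_sum)
    moreover have "hpart (\<lambda>_. 1) e0 (u - (\<Sum>\<alpha>\<in>exps ?n (Suc e0). c \<alpha> * pmon gs \<alpha>)) \<in> A"
      using A c by (simp add: homog_ideal_def)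
    ultimately show False using u(2) hpart_homog[OF u(1)] by simp
  qed
  note uK = this
  obtain e where e: "\<forall>f\<in>set fs. degree_le e f"
  proof
    let ?e = "Max (wdeg (\<lambda>_. 1) ` (\<Union>f\<in>set fs. Poly_Mapping.keys f))"
    show "\<forall>f\<in>set fs. degree_le ?e f"
      unfolding degree_le_def by (intro ballI Max_ge) auto
  qed
  \<comment> \<open>\<open>N\<close> is linear in \<open>t\<close> with
    \<open>N + 1 \<le> (n e + 1) (t + 1)\<close>. For this \<open>t\<close> it follows that
    \<open>L (N + 1)^d \<le> t (t + 1)^d < (t + 1)^n\<close>: there are more monomials in
    \<open>fs\<close> with exponents up to \<open>t\<close> than vectors to span their values on
    \<open>u\<close>.\<close>
  define t where "t = L * Suc (?n * e) ^ d"
  define N where "N = ?n * t * e"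
  define Bx where "Bx = {\<alpha>. set \<alpha> \<subseteq> {..t} \<and> length \<alpha> = ?n}"
  have Bx: "finite Bx" "card Bx = Suc t ^ ?n"
    by (simp_all add: Bx_def finite_lists_length_eq card_lists_length_eq)
  let ?S = "(\<lambda>m. monom m * u) ` W N"
  have "card ?S \<le> L * Suc N ^ d" using card_image_le[OF W(1)] W(2) le_trans by blast
  also have "Suc N \<le> Suc (?n * e) * Suc t" by (simp add: N_def)
  then have "L * Suc N ^ d \<le> L * (Suc (?n * e) * Suc t) ^ d" by (intro mult_le_mono power_mono) auto
  also have "\<dots> = t * Suc t ^ d" by (simp only: power_mult_distrib t_def mult.assoc)
  also have "\<dots> < Suc t ^ Suc d" by simp
  also have "\<dots> \<le> Suc t ^ ?n" using d by (intro power_increasing) auto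
  finally have card: "card ?S < card Bx" by (simp add: Bx)
  let ?R = "{x. \<exists>y\<in>mpoly_vs.span ?S. x * u - y \<in> A}"
  have R0: "0 \<in> ?R" using idl.subspace_0[OF iA] by (auto intro!: bexI[of _ 0] mpoly_vs.span_zero)
  have R: "p \<in> ?R" if p: "p \<in> polys V" "degree_le N p" for p
  proof -
    have "(\<Sum>m\<in>M. Poly_Mapping.single m (Poly_Mapping.lookup p m)) \<in> ?R"
      if "M \<subseteq> Poly_Mapping.keys p" "finite M" for M
      using that(2,1)
    proof (induction M rule: finite_induct)
      case (insert m M)
      then obtain x where x: "x \<in> mpoly_vs.span ?S"
        "(\<Sum>m\<in>M. Poly_Mapping.single m (Poly_Mapping.lookup p m)) * u - x \<in> A" by auto
      obtain y where y: "y \<in> mpoly_vs.span ?S" "monom m * u - y \<in> A"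
        using red[of m N] p insert.prems by (auto simp: polys_def degree_le_def)
      let ?c = "cst (Poly_Mapping.lookup p m) :: ('v, 'k) mpoly"
      have "?c * (monom m * u - y) + ((\<Sum>m\<in>M. Poly_Mapping.single m (Poly_Mapping.lookup p m)) * u - x) \<in> A"
        by (rule idl.subspace_add[OF iA ideal_mem_comb(1)[OF iA y(2)] x(2)])
      also have "?c * (monom m * u - y) = Poly_Mapping.single m (Poly_Mapping.lookup p m) * u - ?c * y"
        by (simp add: right_diff_distrib cst_mult_monom flip: mult.assoc)
      finally have "(\<Sum>m\<in>insert m M. Poly_Mapping.single m (Poly_Mapping.lookup p m)) * u - (?c * y + x) \<in> A"
        using insert by (simp add: algebra_simps)
      moreover have "?c * y + x \<in> mpoly_vs.span ?S"
        by (rule mpoly_vs.span_add[OF mpoly_vs.span_scale[OF y(1)] x(1)])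
      ultimately show ?case by blast
    qed (use R0 in simp)
    from this[of "Poly_Mapping.keys p"] show ?thesis using mpoly_eq_sum[of p] by simp
  qed
  have "\<exists>y. y \<in> mpoly_vs.span ?S \<and> pmon gs \<alpha> * u - y \<in> A" if \<alpha>: "\<alpha> \<in> Bx" for \<alpha>
  proof -
    have "sum_list \<alpha> \<le> ?n * t"
      using \<alpha> sum_list_mono[of \<alpha> "\<lambda>x. x" "\<lambda>_. t"] by (fastforce simp: Bx_def sum_list_triv)
    then have "sum_list \<alpha> * e \<le> N" by (simp add: N_def)
    then have "degree_le N (pmon gs \<alpha>)"
      using degree_le_pmon[of gs e \<alpha>] e \<alpha> by (fastforce simp: gs Bx_def degree_le_def)
    moreover have "pmon gs \<alpha> \<in> polys V" using fs(1) by (intro pmon_in_polys) (simp add: gs)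
    ultimately show ?thesis using R by blast
  qed
  then obtain \<rho> where \<rho>: "\<And>\<alpha>. \<alpha> \<in> Bx \<Longrightarrow> \<rho> \<alpha> \<in> mpoly_vs.span ?S" "\<And>\<alpha>. \<alpha> \<in> Bx \<Longrightarrow> pmon gs \<alpha> * u - \<rho> \<alpha> \<in> A"
    by metis
  obtain c where c: "\<exists>\<alpha>\<in>Bx. c \<alpha> \<noteq> 0" "(\<Sum>\<alpha>\<in>Bx. cst (c \<alpha>) * \<rho> \<alpha>) = 0"
    using ex_linear_dependence[OF Bx(1) finite_imageI[OF W(1)] card, of \<rho>] \<rho>(1) by blast
  have "(\<Sum>\<alpha>\<in>Bx. cst (c \<alpha>) * (pmon gs \<alpha> * u - \<rho> \<alpha>)) \<in> A"
    using \<rho>(2) by (intro idl.subspace_sum[OF iA] ideal_mem_comb(1)[OF iA])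
  also have "(\<Sum>\<alpha>\<in>Bx. cst (c \<alpha>) * (pmon gs \<alpha> * u - \<rho> \<alpha>)) = (\<Sum>\<alpha>\<in>Bx. cst (c \<alpha>) * pmon gs \<alpha>) * u"
    using c(2) by (simp add: right_diff_distrib sum_subtractf sum_distrib_right mult.assoc)
  also have "(\<Sum>\<alpha>\<in>Bx. cst (c \<alpha>) * pmon gs \<alpha>) = (\<Sum>\<alpha>\<in>{\<alpha>\<in>Bx. c \<alpha> \<noteq> 0}. cst (c \<alpha>) * pmon gs \<alpha>)"
    using Bx by (intro sum.mono_neutral_right) auto
  finally have "(\<Sum>\<alpha>\<in>{\<alpha>\<in>Bx. c \<alpha> \<noteq> 0}. cst (c \<alpha>) * pmon gs \<alpha>) * u \<in> A" .
  moreover have "(\<Sum>\<alpha>\<in>{\<alpha>\<in>Bx. c \<alpha> \<noteq> 0}. cst (c \<alpha>) * pmon gs \<alpha>) * u \<notin> A"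
  proof (rule quasi_regular_independent[OF iA q uK])
    show "finite {\<alpha>\<in>Bx. c \<alpha> \<noteq> 0}" using Bx by simp
    show "\<exists>d. d * cst (c \<beta>) = 1" if "\<beta> \<in> {\<alpha>\<in>Bx. c \<alpha> \<noteq> 0}" for \<beta>
      using that by (intro exI[of _ "cst (inverse (c \<beta>))"]) (simp add: mult_single)
  qed (use c in \<open>auto simp: Bx_def gs\<close>)
  ultimately show False by blast
qed

text \<open>Evaluation at the point with coordinate 0 on \<open>Z\<close> and 1 elsewhere. The value
  is kept as a constant polynomial so that \<open>lin_mult\<close> applies; \<open>Z = UNIV\<close>
  yields the constant term.\<close>

definition eval01 :: "'v set \<Rightarrow> ('v, 'k::field) mpoly \<Rightarrow> ('v, 'k) mpoly" where
  "eval01 Z = lin (\<lambda>m. if Poly_Mapping.keys m \<inter> Z = {} then 1 else 0)"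

lemma eval01_mult: "eval01 Z (p * q) = eval01 Z p * eval01 Z q"
  unfolding eval01_def
proof (rule lin_mult)
  fix n k :: "'a \<Rightarrow>\<^sub>0 nat"
  have "Poly_Mapping.keys (n + k) = Poly_Mapping.keys n \<union> Poly_Mapping.keys k"
    by (auto simp: in_keys_iff lookup_add)
  then show "(if Poly_Mapping.keys (n + k) \<inter> Z = {} then 1 else 0) =
      (if Poly_Mapping.keys n \<inter> Z = {} then 1 else 0) * (if Poly_Mapping.keys k \<inter> Z = {} then 1 else (0 :: ('a, 'b) mpoly))"
    by auto
qed

lemma eval01_simps:
  "eval01 Z (p + q) = eval01 Z p + eval01 Z q" "eval01 Z (p - q) = eval01 Z p - eval01 Z q"
  "eval01 Z 0 = 0" "eval01 Z 1 = 1" "eval01 Z (X v) = (if v \<in> Z then 0 else 1)"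
  unfolding eval01_def by (simp_all add: lin_add lin_diff X_def lin_single lin_single[of _ 0 1, simplified])

lemma eval01_span:
  assumes "x \<in> idl.span G" "\<And>g. g \<in> G \<Longrightarrow> eval01 Z g = 0" shows "eval01 Z x = 0"
  using assms(1) by (induction rule: idl.span_induct_alt) (simp_all add: eval01_simps eval01_mult assms(2))

lemma eval01_prod: "eval01 Z (prod f I) = (\<Prod>i\<in>I. eval01 Z (f i))"
  by (induction I rule: infinite_finite_induct) (simp_all add: eval01_simps eval01_mult)

lemma monom_split:
  fixes m :: "'v \<Rightarrow>\<^sub>0 nat"
  assumes "v \<in> Poly_Mapping.keys m" obtains n where "m = Poly_Mapping.single v 1 + n"
proof
  show "m = Poly_Mapping.single v 1 + (m - Poly_Mapping.single v 1)"
    using assms by (intro poly_mapping_eqI) (auto simp: lookup_add lookup_minus lookup_single when_def in_keys_iff)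
qed

lemma monom_add: "monom (m + n) = monom m * monom n"
  by (simp add: mult_single)

lemma homog_prod: "(\<And>i. i \<in> I \<Longrightarrow> homog \<omega> (d i) (f i)) \<Longrightarrow> homog \<omega> (sum d I) (prod f I)"
  by (induction I rule: infinite_finite_induct) (auto intro: homog_mult simp: homog_one)

lemma cross_upper:
  fixes fs :: "(vertex, 'k::field) mpoly list"
  assumes p: "p < i0" "Suc i0 < q" "p' < j0" "Suc j0 < q'"
  defines "V \<equiv> {p..q} \<times> {j0, Suc j0} \<union> {i0, Suc i0} \<times> {p'..q'}"
  assumes r: "regular_list (idl.span (cell_binomial ` cross i0 j0 p q p' q')) fs"
    and fs: "set fs \<subseteq> polys V" "\<And>f. f \<in> set fs \<Longrightarrow> Poly_Mapping.lookup f 0 = 0"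
  shows "length fs \<le> card V - ((q - p) + (q' - p') - 1)"
proof -
  let ?b = "cell_binomial :: cell \<Rightarrow> (vertex, 'k) mpoly"
  define A where "A = idl.span (?b ` cross i0 j0 p q p' q')"
  obtain j1 where j1: "j0 = Suc j1" using p by (cases j0) auto
  have iA: "is_ideal A" by (simp add: A_def)
  note sc = ideal_mem_comb(1)[OF iA] and add = idl.subspace_add[OF iA] and diff = idl.subspace_diff[OF iA]
  have cell: "?b c \<in> A" if "c \<in> cross i0 j0 p q p' q'" for c
    unfolding A_def using that by (intro idl.span_base) auto
  have hom: "homog (\<lambda>_. 1) 2 (?b c)" for c
    by (cases c) (auto intro!: homog_diff homog_mult homog_X)
  then have hA: "homog_ideal (\<lambda>_. 1) A" unfolding A_def by (intro homog_ideal_span) blast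
  \<comment> \<open>The element \<open>u\<close> is nonzero modulo \<open>A\<close> and killed by all variables of the row \<open>j0\<close>.\<close>
  define w :: "(vertex, 'k) mpoly" where "w = X (i0, j1) * X (Suc i0, Suc j0) - X (Suc i0, j1) * X (i0, Suc j0)"
  define T :: "nat set \<Rightarrow> (vertex, 'k) mpoly" where "T I = (\<Prod>i\<in>I. X (i, Suc j0))" for I
  define u where "u = w * T {p..q}"

  have D: "X (i0, j0) * X (Suc i0, Suc j0) - X (Suc i0, j0) * X (i0, Suc j0) \<in> A"
    and Bt: "X (i0, j1) * X (Suc i0, j0) - X (Suc i0, j1) * X (i0, j0) \<in> A"
    using cell[of "(i0, j0)"] cell[of "(i0, j1)"] p by (auto simp: cross_def j1)
  \<comment> \<open>A three-term relation between the minors on the rows \<open>j1\<close>,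
    \<open>j0\<close>, \<open>Suc j0\<close> shows that \<open>w\<close> is killed by both column
    vertices in row \<open>j0\<close>. Each further cell of the row moves the killed vertex by one,
    at the cost of one factor \<open>X (i, Suc j0)\<close>.\<close>
  have right: "X (i, j0) * (w * T {Suc i0..<i}) \<in> A" if "Suc i0 \<le> i" "i \<le> q" for i
    using that
  proof (induction i rule: dec_induct)
    case base
    have "X (Suc i0, j0) * (w * T {Suc i0..<Suc i0}) =
        X (Suc i0, Suc j0) * (X (i0, j1) * X (Suc i0, j0) - X (Suc i0, j1) * X (i0, j0))
        + X (Suc i0, j1) * (X (i0, j0) * X (Suc i0, Suc j0) - X (Suc i0, j0) * X (i0, Suc j0))"
      by (simp add: w_def T_def algebra_simps)
    then show ?case by (simp only: add[OF sc[OF Bt] sc[OF D]])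
  next
    case (step i)
    have c: "X (i, j0) * X (Suc i, Suc j0) - X (Suc i, j0) * X (i, Suc j0) \<in> A"
      using cell[of "(i, j0)"] step p by (auto simp: cross_def)
    have "{Suc i0..<Suc i} = insert i {Suc i0..<i}" using step by auto
    then have "X (Suc i, j0) * (w * T {Suc i0..<Suc i}) = X (Suc i, Suc j0) * (X (i, j0) * (w * T {Suc i0..<i}))
        - (w * T {Suc i0..<i}) * (X (i, j0) * X (Suc i, Suc j0) - X (Suc i, j0) * X (i, Suc j0))"
      by (simp add: T_def algebra_simps)
    moreover have "X (i, j0) * (w * T {Suc i0..<i}) \<in> A" using step by simp
    ultimately show ?case by (simp only: diff[OF sc sc[OF c]])
  qed
  have left: "X (i, j0) * (w * T {Suc i..i0}) \<in> A" if "i \<le> i0" "p \<le> i" for i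
    using that
  proof (induction i rule: inc_induct)
    case base
    have "X (i0, j0) * (w * T {Suc i0..i0}) =
        X (i0, Suc j0) * (X (i0, j1) * X (Suc i0, j0) - X (Suc i0, j1) * X (i0, j0))
        + X (i0, j1) * (X (i0, j0) * X (Suc i0, Suc j0) - X (Suc i0, j0) * X (i0, Suc j0))"
      by (simp add: w_def T_def algebra_simps)
    then show ?case by (simp only: add[OF sc[OF Bt] sc[OF D]])
  next
    case (step i)
    have c: "X (i, j0) * X (Suc i, Suc j0) - X (Suc i, j0) * X (i, Suc j0) \<in> A"
      using cell[of "(i, j0)"] step p by (auto simp: cross_def)
    have "{Suc i..i0} = insert (Suc i) {Suc (Suc i)..i0}" using step by auto
    then have "X (i, j0) * (w * T {Suc i..i0}) = X (i, Suc j0) * (X (Suc i, j0) * (w * T {Suc (Suc i)..i0}))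
        + (w * T {Suc (Suc i)..i0}) * (X (i, j0) * X (Suc i, Suc j0) - X (Suc i, j0) * X (i, Suc j0))"
      by (simp add: T_def algebra_simps)
    moreover have "X (Suc i, j0) * (w * T {Suc (Suc i)..i0}) \<in> A" using step by simp
    ultimately show ?case by (simp only: add[OF sc sc[OF c]])
  qed
  have T_sub: "T {p..q} = T I * T ({p..q} - I)" if "I \<subseteq> {p..q}" for I
    using that unfolding T_def by (simp add: prod.subset_diff[of I "{p..q}"] mult.commute)
  have bottom: "X (i, j0) * u \<in> A" if i: "i \<in> {p..q}" for i
  proof (cases "i \<le> i0")
    case True
    have "X (i, j0) * u = T ({p..q} - {Suc i..i0}) * (X (i, j0) * (w * T {Suc i..i0}))"
      using T_sub[of "{Suc i..i0}"] i p by (simp add: u_def mult_ac)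
    then show ?thesis using left[OF True] i sc by simp
  next
    case False
    have "{Suc i0..<i} \<subseteq> {p..q}" using i p by auto
    then have "X (i, j0) * u = T ({p..q} - {Suc i0..<i}) * (X (i, j0) * (w * T {Suc i0..<i}))"
      using T_sub[of "{Suc i0..<i}"] by (simp add: u_def mult_ac)
    then show ?thesis using right[of i] False i sc by simp
  qed
  have "u \<notin> A"
  proof
    \<comment> \<open>The point is a common zero of all minors at which \<open>u\<close> is 1. Row
      \<open>j0\<close> vanishes, and so does the right side of the column below it; all other
      coordinates are 1.\<close>
    define Z where "Z = UNIV \<times> {j0} \<union> {Suc i0} \<times> {..<j0}"
    assume "u \<in> A"
    then have "eval01 Z u = 0"
      unfolding A_def
    proof (rule eval01_span)
      fix g assume "g \<in> ?b ` cross i0 j0 p q p' q'"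
      then obtain i j where "g = ?b (i, j)" "(i, j) \<in> cross i0 j0 p q p' q'" by auto
      then show "eval01 Z g = 0"
        by (auto simp: cross_def eval01_simps eval01_mult Z_def)
    qed
    moreover have "eval01 Z u = 1"
      by (simp add: u_def w_def T_def eval01_simps eval01_mult eval01_prod Z_def j1)
    ultimately show False by simp
  qed
  have hu: "homog (\<lambda>_. 1) (2 + sum (\<lambda>_. 1) {p..q}) u"
    unfolding u_def w_def T_def
    by (intro homog_mult[OF homog_diff homog_prod refl] homog_mult homog_X) auto

  define Bot where "Bot = {p..q} \<times> {j0}"
  \<comment> \<open>The column cells at \<open>j0\<close> and \<open>j1\<close> meet row
    \<open>j0\<close>, so both terms of their minors already kill \<open>u\<close>. Row
    \<open>j0\<close> and the remaining column cells account for
    \<open>(q - p + 1) + (q' - p' - 2)\<close> variables, exactly the number of cells.\<close>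
  define Jc where "Jc = {p'..<q'} - {j0, j1}"
  define W where "W N = {m :: vertex \<Rightarrow>\<^sub>0 nat. Poly_Mapping.keys m \<subseteq> V \<and> wdeg (\<lambda>_. 1) m \<le> N \<and>
    Poly_Mapping.keys m \<inter> Bot = {} \<and> (\<forall>j\<in>Jc. \<not> {(i0, j), (Suc i0, Suc j)} \<subseteq> Poly_Mapping.keys m)}" for N
  have finV: "finite V" by (simp add: V_def)
  let ?d = "card V - ((q - p) + (q' - p') - 1)"
  have cardW: "card (Poly_Mapping.keys m) \<le> ?d" if m: "m \<in> W N" for m N
  proof -
    let ?K = "Poly_Mapping.keys m"
    \<comment> \<open>A normal monomial misses a diagonal vertex of every cell in \<open>Jc\<close>,
      and these diagonals are pairwise disjoint.\<close>
    have "\<forall>j\<in>Jc. \<exists>v. v \<in> {(i0, j), (Suc i0, Suc j)} \<and> v \<notin> ?K" using m unfolding W_def by blast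
    then obtain g where g: "\<And>j. j \<in> Jc \<Longrightarrow> g j \<in> {(i0, j), (Suc i0, Suc j)} \<and> g j \<notin> ?K" by metis
    have inj: "inj_on g Jc"
    proof (rule inj_onI)
      fix j j' assume "j \<in> Jc" "j' \<in> Jc" "g j = g j'"
      then show "j = j'" using g[of j] g[of j'] by auto
    qed
    have disj: "g ` Jc \<inter> Bot = {}" using g by (fastforce simp: Bot_def Jc_def j1)
    have sub: "g ` Jc \<subseteq> V" using g by (fastforce simp: V_def Jc_def)
    have "Bot \<subseteq> V" by (auto simp: Bot_def V_def)
    have fin: "finite Bot" "finite Jc" by (auto simp: Bot_def Jc_def)
    have "?K \<subseteq> V - (Bot \<union> g ` Jc)" using m g by (auto simp: W_def)
    then have "card ?K \<le> card (V - (Bot \<union> g ` Jc))" using finV by (intro card_mono) auto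
    also have "\<dots> = card V - card (Bot \<union> g ` Jc)"
      using sub \<open>Bot \<subseteq> V\<close> fin by (intro card_Diff_subset) auto
    also have "card (Bot \<union> g ` Jc) = card Bot + card Jc"
      using disj fin card_image[OF inj] by (subst card_Un_disjoint) (auto simp: Int_commute)
    also have "card Bot = Suc q - p" by (simp add: Bot_def)
    also have "card Jc = q' - p' - 2"
      unfolding Jc_def using p by (subst card_Diff_subset) (auto simp: j1)
    also have "Suc q - p + (q' - p' - 2) = (q - p) + (q' - p') - 1" using p by auto
    finally show ?thesis .
  qed
  have W: "finite (W N) \<and> card (W N) \<le> 2 ^ card V * Suc N ^ ?d" for N
  proof -
    let ?\<U> = "{U. U \<subseteq> V \<and> card U \<le> ?d}"
    let ?M = "\<lambda>U. {m :: vertex \<Rightarrow>\<^sub>0 nat. Poly_Mapping.keys m \<subseteq> U \<and> (\<forall>v. Poly_Mapping.lookup m v \<le> N)}"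
    have lookup_le: "Poly_Mapping.lookup m v \<le> wdeg (\<lambda>_. 1) m" for m :: "vertex \<Rightarrow>\<^sub>0 nat" and v
      using member_le_sum[of v "Poly_Mapping.keys m" "Poly_Mapping.lookup m"]
      by (cases "v \<in> Poly_Mapping.keys m") (auto simp: wdeg_def in_keys_iff)
    have sub: "W N \<subseteq> (\<Union>U\<in>?\<U>. ?M U)"
    proof
      fix m assume m: "m \<in> W N"
      then have "Poly_Mapping.keys m \<in> ?\<U>" using cardW by (auto simp: W_def)
      moreover have "Poly_Mapping.lookup m v \<le> N" for v
        using lookup_le[of m v] m by (simp add: W_def)
      then have "m \<in> ?M (Poly_Mapping.keys m)" by simp
      ultimately show "m \<in> (\<Union>U\<in>?\<U>. ?M U)" by blast
    qed
    have fU: "finite ?\<U>" using finV by simp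
    have fM: "finite (?M U)" "card (?M U) \<le> Suc N ^ ?d" if "U \<in> ?\<U>" for U
    proof -
      have "finite U" using that finV finite_subset by blast
      from card_monomials[OF this, of N] show "finite (?M U)" by blast
      have "card (?M U) \<le> Suc N ^ card U" using card_monomials[OF \<open>finite U\<close>, of N] by blast
      also have "\<dots> \<le> Suc N ^ ?d" using that by (intro power_increasing) auto
      finally show "card (?M U) \<le> Suc N ^ ?d" .
    qed
    have fin: "finite (\<Union>U\<in>?\<U>. ?M U)" using fU fM by blast
    have "card (W N) \<le> card (\<Union>U\<in>?\<U>. ?M U)" by (rule card_mono[OF fin sub])
    also have "\<dots> \<le> (\<Sum>U\<in>?\<U>. card (?M U))" by (rule card_UN_le[OF fU])
    also have "\<dots> \<le> (\<Sum>U\<in>?\<U>. Suc N ^ ?d)" using fM(2) by (rule sum_mono)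
    also have "\<dots> = card ?\<U> * Suc N ^ ?d" by simp
    also have "card ?\<U> \<le> card (Pow V)" using finV by (intro card_mono) auto
    then have "card ?\<U> * Suc N ^ ?d \<le> 2 ^ card V * Suc N ^ ?d" using finV by (simp add: card_Pow)
    finally show ?thesis using finite_subset[OF sub fin] by blast
  qed
  show ?thesis
  proof (rule regular_list_length_le[OF hA _ fs hu \<open>u \<notin> A\<close>, where W = W and L = "2 ^ card V"])
    show "regular_list A fs" using r by (simp add: A_def)
    show "finite (W N)" "card (W N) \<le> 2 ^ card V * Suc N ^ ?d" for N using W by blast+
    fix m :: "vertex \<Rightarrow>\<^sub>0 nat" and N
    assume "Poly_Mapping.keys m \<subseteq> V" "wdeg (\<lambda>_. 1) m \<le> N"
    then show "\<exists>y\<in>mpoly_vs.span ((\<lambda>m. monom m * u) ` W N). monom m * u - y \<in> A"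
    \<comment> \<open>Rewriting the diagonal of a column cell into its antidiagonal lowers the total
      of \<open>i * j\<close> by one and preserves the degree, so the reduction ends within degree
      \<open>N\<close>.\<close>
    proof (induction "wdeg (\<lambda>(i, j). i * j) m" arbitrary: m rule: less_induct)
      case less
      let ?K = "Poly_Mapping.keys m"
      consider (bot) v where "v \<in> ?K" "v \<in> Bot" | (cell) j where "j \<in> Jc" "{(i0, j), (Suc i0, Suc j)} \<subseteq> ?K"
        | (std) "m \<in> W N"
        using less.prems unfolding W_def by blast
      then show ?case
      proof cases
        case bot
        obtain i where v: "v = (i, j0)" "i \<in> {p..q}" using bot by (auto simp: Bot_def)
        obtain n where "m = Poly_Mapping.single v 1 + n" using monom_split[OF bot(1)] .
        then have "monom m * u = monom n * (X v * u)" unfolding X_def by (simp add: monom_add mult_ac)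
        then have "monom m * u - 0 \<in> A" using bottom[OF v(2)] v sc by simp
        then show ?thesis using mpoly_vs.span_zero by blast
      next
        case cell
        obtain n1 where n1: "m = Poly_Mapping.single (i0, j) 1 + n1" using cell by (auto elim: monom_split)
        have k1: "(Suc i0, Suc j) \<in> Poly_Mapping.keys n1"
          using cell by (auto simp: n1 in_keys_iff lookup_add lookup_single when_def)
        obtain n where n: "n1 = Poly_Mapping.single (Suc i0, Suc j) 1 + n" using monom_split[OF k1] .
        define m' where "m' = Poly_Mapping.single (Suc i0, j) 1 + (Poly_Mapping.single (i0, Suc j) 1 + n)"
        have keysn: "Poly_Mapping.keys n \<subseteq> V"
        proof
          fix v assume "v \<in> Poly_Mapping.keys n"
          then have "v \<in> Poly_Mapping.keys m" by (simp add: n1 n in_keys_iff lookup_add)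
          then show "v \<in> V" using less.prems(1) by blast
        qed
        have jV: "(Suc i0, j) \<in> V" "(i0, Suc j) \<in> V" using cell(1) by (auto simp: V_def Jc_def)
        have "Poly_Mapping.keys m' \<subseteq> {(Suc i0, j), (i0, Suc j)} \<union> Poly_Mapping.keys n"
          by (auto simp: m'_def in_keys_iff lookup_add lookup_single when_def split: if_splits)
        then have "Poly_Mapping.keys m' \<subseteq> V" using keysn jV by blast
        moreover have "wdeg (\<lambda>_. 1) m' \<le> N" using less.prems(2) by (simp add: m'_def n1 n wdeg_add)
        moreover have "wdeg (\<lambda>(i, j). i * j) m' < wdeg (\<lambda>(i, j). i * j) m"
          by (simp add: m'_def n1 n wdeg_add)
        ultimately obtain y where y: "y \<in> mpoly_vs.span ((\<lambda>m. monom m * u) ` W N)" "monom m' * u - y \<in> A"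
          using less.hyps[of m'] by auto
        have "?b (i0, j) \<in> A" using cell by (intro \<open>\<And>c. c \<in> cross i0 j0 p q p' q' \<Longrightarrow> ?b c \<in> A\<close>) (auto simp: cross_def Jc_def)
        then have "(monom n * u) * ?b (i0, j) + (monom m' * u - y) \<in> A" by (intro add[OF sc y(2)])
        also have "(monom n * u) * ?b (i0, j) + (monom m' * u - y) = monom m * u - y"
          by (simp add: m'_def n1 n monom_add X_def[symmetric, unfolded One_nat_def] algebra_simps)
        finally show ?thesis using y(1) by blast
      next
        case std
        then have "monom m * u \<in> mpoly_vs.span ((\<lambda>m. monom m * u) ` W N)"
          by (intro mpoly_vs.span_base) auto
        then show ?thesis using idl.subspace_0[OF iA] by (intro bexI[of _ "monom m * u"]) simp_all
      qed
    qed
  qed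
qed

section \<open>Depth and associated primes\<close>

lemma poly_ring_ops [simp]:
  "p \<oplus>\<^bsub>poly_ring V\<^esub> q = p + q" "p \<otimes>\<^bsub>poly_ring V\<^esub> q = p * q"
  "\<zero>\<^bsub>poly_ring V\<^esub> = 0" "\<one>\<^bsub>poly_ring V\<^esub> = 1"
  by (simp_all add: poly_ring_def)

lemma poly_ring_uminus: "p \<in> polys V \<Longrightarrow> \<ominus>\<^bsub>poly_ring V\<^esub> p = - p"
proof -
  assume p: "p \<in> polys V"
  interpret R: cring "poly_ring V" by (rule cring_poly_ring)
  show ?thesis
    by (rule R.minus_equality) (use p in \<open>simp_all add: carrier_poly_ring polys_ring_ops\<close>)
qed

lemma poly_ring_minus: "p \<in> polys V \<Longrightarrow> q \<in> polys V \<Longrightarrow> p \<ominus>\<^bsub>poly_ring V\<^esub> q = p - q"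
  by (simp add: a_minus_def poly_ring_uminus)

lemma ideal_span_polys: "ideal (polys V \<inter> idl.span G) (poly_ring V)"
proof (rule idealI)
  interpret R: cring "poly_ring V :: ('a, 'b) mpoly ring" by (rule cring_poly_ring)
  show "ring (poly_ring V :: ('a, 'b) mpoly ring)" by (rule R.ring_axioms)
  show "subgroup (polys V \<inter> idl.span G) (add_monoid (poly_ring V :: ('a, 'b) mpoly ring))"
  proof (rule R.add.subgroupI)
    fix p assume "p \<in> polys V \<inter> idl.span G"
    then show "\<ominus>\<^bsub>poly_ring V\<^esub> p \<in> polys V \<inter> idl.span G"
      by (auto simp: poly_ring_uminus polys_ring_ops idl.span_neg)
  qed (auto simp: carrier_poly_ring polys_ring_ops idl.span_add intro: polys_ring_ops(1) idl.span_zero)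
qed (auto simp: carrier_poly_ring polys_ring_ops ideal_mem_comb[OF idl.subspace_span])

text \<open>An element of the span may be written with coefficients in variables outside
  \<open>V\<close>. The retraction \<open>coef (- V) 0\<close> is linear over
  \<open>polys V\<close>, fixes the element and turns the coefficients into members of
  \<open>polys V\<close>.\<close>

lemma genideal_poly_ring:
  assumes G: "G \<subseteq> polys V" shows "genideal (poly_ring V) G = polys V \<inter> idl.span G"
proof
  show "genideal (poly_ring V) G \<subseteq> polys V \<inter> idl.span G"
    unfolding genideal_def using ideal_span_polys[of V G] G idl.span_superset[of G] by (intro Inter_lower) auto
next
  let ?I = "genideal (poly_ring V) G"
  interpret R: cring "poly_ring V :: ('a, 'b) mpoly ring" by (rule cring_poly_ring)
  interpret I: ideal ?I "poly_ring V" by (rule R.genideal_ideal) (use G in \<open>simp add: carrier_poly_ring\<close>)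
  have GI: "G \<subseteq> ?I" by (rule R.genideal_self) (use G in \<open>simp add: carrier_poly_ring\<close>)
  have "coef (- V) 0 x \<in> ?I" if "x \<in> idl.span G" for x
    using that
  proof (induction rule: idl.span_induct_alt)
    case base
    then show ?case using I.zero_closed by (simp add: coef_def)
  next
    case (step c g y)
    have "coef (- V) 0 (g * c + y) = coef (- V) 0 (g * c) + coef (- V) 0 y" by (simp add: coef_def lin_add)
    also have "coef (- V) 0 (g * c) = g * coef (- V) 0 c" using G step(1) by (intro coef_mult) auto
    finally have "coef (- V) 0 (c * g + y) = g * coef (- V) 0 c + coef (- V) 0 y" by (simp add: mult.commute)
    moreover have "g * coef (- V) 0 c \<in> ?I"
      using I.I_r_closed[of g "coef (- V) 0 c"] GI step(1) coef_in_polys[of "- V" 0 c] by (auto simp: carrier_poly_ring)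
    ultimately show ?case using I.a_closed[of "g * coef (- V) 0 c" "coef (- V) 0 y"] step by simp
  qed
  then show "polys V \<inter> idl.span G \<subseteq> ?I" using coef_0[of _ "- V"] by fastforce
qed

text \<open>A dictionary from the module \<open>S/I\<close> to ideals in the large polynomial
  ring.\<close>

locale quotient =
  fixes V :: "'v set" and G :: "('v, 'k::field) mpoly set"
  assumes G: "G \<subseteq> polys V"
begin

abbreviation "S \<equiv> poly_ring V :: ('v, 'k) mpoly ring"
abbreviation "I \<equiv> genideal S G"
abbreviation "M \<equiv> quot_module S I"

sublocale R: cring S by (rule cring_poly_ring)
sublocale I: ideal I S by (rule R.genideal_ideal) (use G in \<open>simp add: carrier_poly_ring\<close>)

lemma mem_I: "x \<in> I \<longleftrightarrow> x \<in> polys V \<and> x \<in> idl.span G"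
  using genideal_poly_ring[OF G] by auto

lemma carrier_M: "carrier M = (\<lambda>r. I +>\<^bsub>S\<^esub> r) ` polys V"
  by (auto simp: quot_module_def FactRing_def A_RCOSETS_def' carrier_poly_ring)

lemma smult_M: "r \<in> polys V \<Longrightarrow> x \<in> polys V \<Longrightarrow> r \<odot>\<^bsub>M\<^esub> (I +>\<^bsub>S\<^esub> x) = I +>\<^bsub>S\<^esub> (r * x)"
  using I.rcoset_mult_add[of r x] by (simp add: quot_module_def FactRing_def carrier_poly_ring)

lemma add_M: "x \<in> polys V \<Longrightarrow> y \<in> polys V \<Longrightarrow> (I +>\<^bsub>S\<^esub> x) \<oplus>\<^bsub>M\<^esub> (I +>\<^bsub>S\<^esub> y) = I +>\<^bsub>S\<^esub> (x + y)"
  using I.a_rcos_sum[of x y] by (simp add: quot_module_def FactRing_def carrier_poly_ring)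

lemma coset_eq_iff: "x \<in> polys V \<Longrightarrow> y \<in> polys V \<Longrightarrow> I +>\<^bsub>S\<^esub> x = I +>\<^bsub>S\<^esub> y \<longleftrightarrow> x - y \<in> idl.span G"
  using R.quotient_eq_iff_same_a_r_cos[OF I.ideal_axioms, of x y]
  by (auto simp: carrier_poly_ring poly_ring_minus mem_I polys_ring_ops)

lemma zero_M: "\<zero>\<^bsub>M\<^esub> = I +>\<^bsub>S\<^esub> 0"
  using R.a_coset_add_zero[OF I.a_subset] by (simp add: quot_module_def FactRing_def)

lemma seq_submodule_M:
  "set fs \<subseteq> polys V \<Longrightarrow> seq_submodule M fs = (\<lambda>r. I +>\<^bsub>S\<^esub> r) ` {r \<in> polys V. r \<in> idl.span (G \<union> set fs)}"
proof (induction fs)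
  case Nil
  have "I +>\<^bsub>S\<^esub> r = I +>\<^bsub>S\<^esub> 0" if "r \<in> polys V" "r \<in> idl.span G" for r
    using that coset_eq_iff[of r 0] by (simp add: polys_ring_ops)
  then show ?case using idl.span_zero[of G] polys_ring_ops(1)[of V] by (auto simp: zero_M intro!: image_eqI[of _ _ 0])
next
  case (Cons f fs)
  let ?c = "\<lambda>r. I +>\<^bsub>S\<^esub> r"
  have f: "f \<in> polys V" using Cons.prems by simp
  have IH: "seq_submodule M fs = ?c ` {r \<in> polys V. r \<in> idl.span (G \<union> set fs)}" using Cons by simp
  have GV: "G \<union> set fs \<subseteq> polys (- (- V))" using G Cons.prems by auto
  show ?case
  proof (intro equalityI subsetI)
    fix \<xi> assume "\<xi> \<in> seq_submodule M (f # fs)"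
    then obtain x y where xy: "x \<in> polys V" "y \<in> polys V" "y \<in> idl.span (G \<union> set fs)"
      "\<xi> = f \<odot>\<^bsub>M\<^esub> ?c x \<oplus>\<^bsub>M\<^esub> ?c y" by (auto simp: carrier_M IH)
    then have "\<xi> = ?c (f * x + y)" using f by (simp add: smult_M add_M polys_ring_ops)
    moreover have "f * x + y - x * f \<in> idl.span (G \<union> set fs)" using xy(3) by (simp add: mult.commute)
    then have "f * x + y \<in> idl.span (G \<union> set (f # fs))"
      unfolding list.set Un_insert_right idl.span_insert mem_Collect_eq by (rule exI)
    moreover have "f * x + y \<in> polys V" using f xy by (intro polys_ring_ops)
    ultimately show "\<xi> \<in> ?c ` {r \<in> polys V. r \<in> idl.span (G \<union> set (f # fs))}" by blast
  next
    fix \<xi> assume "\<xi> \<in> ?c ` {r \<in> polys V. r \<in> idl.span (G \<union> set (f # fs))}"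
    then obtain r where r: "r \<in> polys V" "r \<in> idl.span (insert f (G \<union> set fs))" "\<xi> = ?c r" by auto
    then obtain k where k: "r - k * f \<in> idl.span (G \<union> set fs)" by (auto simp: idl.span_insert)
    \<comment> \<open>\<open>k\<close> may involve variables outside \<open>V\<close>; its
      retraction \<open>a\<close> serves equally well.\<close>
    define a where "a = coef (- V) 0 k"
    have a: "a \<in> polys V" using coef_in_polys[of "- V" 0 k] by (simp add: a_def)
    have "coef (- V) 0 (r - f * k) \<in> idl.span (G \<union> set fs)"
      using k by (intro coef_span[OF GV]) (simp add: mult.commute)
    moreover have "coef (- V) 0 (r - f * k) = r - f * a"
      using coef_mult[of f "- V" 0 k] coef_0[of r "- V"] f r by (simp add: coef_def lin_diff a_def)
    ultimately have "r - f * a \<in> idl.span (G \<union> set fs)" by simp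
    moreover have ra: "r - f * a \<in> polys V" using r f a by (intro polys_ring_ops)
    ultimately have "?c (r - f * a) \<in> seq_submodule M fs" by (auto simp: IH)
    moreover have "\<xi> = f \<odot>\<^bsub>M\<^esub> ?c a \<oplus>\<^bsub>M\<^esub> ?c (r - f * a)"
      using r f a ra by (simp add: smult_M add_M polys_ring_ops)
    moreover have "?c a \<in> carrier M" using a by (auto simp: carrier_M)
    ultimately show "\<xi> \<in> seq_submodule M (f # fs)" by auto
  qed
qed

lemma mem_seq_submodule:
  assumes "set fs \<subseteq> polys V" "r \<in> polys V"
  shows "I +>\<^bsub>S\<^esub> r \<in> seq_submodule M fs \<longleftrightarrow> r \<in> idl.span (G \<union> set fs)"
proof
  assume "I +>\<^bsub>S\<^esub> r \<in> seq_submodule M fs"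
  then obtain r' where r': "r' \<in> polys V" "r' \<in> idl.span (G \<union> set fs)" "I +>\<^bsub>S\<^esub> r = I +>\<^bsub>S\<^esub> r'"
    by (auto simp: seq_submodule_M[OF assms(1)])
  then have "r - r' \<in> idl.span G" using coset_eq_iff assms by blast
  then have "r - r' \<in> idl.span (G \<union> set fs)" using idl.span_mono[of G "G \<union> set fs"] by blast
  from idl.span_add[OF this r'(2)] show "r \<in> idl.span (G \<union> set fs)" by simp
qed (use assms in \<open>auto simp: seq_submodule_M\<close>)

text \<open>Regularity over \<open>polys V\<close> extends to the large ring because both products
  and membership can be tested on coefficients of monomials in the variables outside
  \<open>V\<close>.\<close>

lemma nzd_iff:
  assumes "set fs \<subseteq> polys V" "f \<in> polys V"
  shows "(\<forall>x\<in>carrier M. f \<odot>\<^bsub>M\<^esub> x \<in> seq_submodule M fs \<longrightarrow> x \<in> seq_submodule M fs) \<longleftrightarrow>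
    nzd (adjoins (idl.span G) fs) f"
proof -
  have "(\<forall>x\<in>carrier M. f \<odot>\<^bsub>M\<^esub> x \<in> seq_submodule M fs \<longrightarrow> x \<in> seq_submodule M fs) \<longleftrightarrow>
      (\<forall>r\<in>polys V. f * r \<in> idl.span (G \<union> set fs) \<longrightarrow> r \<in> idl.span (G \<union> set fs))"
    using assms by (simp add: carrier_M smult_M mem_seq_submodule polys_ring_ops)
  also have "\<dots> \<longleftrightarrow> nzd (idl.span (G \<union> set fs)) f"
  proof
    assume r: "\<forall>r\<in>polys V. f * r \<in> idl.span (G \<union> set fs) \<longrightarrow> r \<in> idl.span (G \<union> set fs)"
    show "nzd (idl.span (G \<union> set fs)) f"
      unfolding nzd_def
    proof (intro allI impI)
      fix x assume x: "f * x \<in> idl.span (G \<union> set fs)"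
      have GV: "G \<union> set fs \<subseteq> polys (- (- V))" using G assms by auto
      show "x \<in> idl.span (G \<union> set fs)"
      proof (rule mem_if_coefs)
        fix m
        have "coef (- V) m (f * x) = f * coef (- V) m x" using assms by (intro coef_mult) simp
        then have "f * coef (- V) m x \<in> idl.span (G \<union> set fs)" using coef_span[OF GV x, of m] by simp
        then show "coef (- V) m x \<in> idl.span (G \<union> set fs)" using r coef_in_polys[of "- V" m x] by simp
      qed simp
    qed
  qed (auto simp: nzd_def)
  finally show ?thesis by (simp add: adjoins_span)
qed

lemma regular_sequence_iff:
  assumes fs: "set fs \<subseteq> polys V"
  shows "regular_sequence S M fs \<longleftrightarrow> regular_list (idl.span G) fs \<and> seq_submodule M fs \<noteq> carrier M"
proof -
  have "(\<forall>x\<in>carrier M. (fs ! i) \<odot>\<^bsub>M\<^esub> x \<in> seq_submodule M (take i fs) \<longrightarrow> x \<in> seq_submodule M (take i fs)) \<longleftrightarrow>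
      nzd (adjoins (idl.span G) (take i fs)) (fs ! i)" if "i < length fs" for i
  proof (rule nzd_iff)
    show "set (take i fs) \<subseteq> polys V" using fs set_take_subset[of i fs] by blast
    show "fs ! i \<in> polys V" using fs nth_mem[OF that] by blast
  qed
  then show ?thesis
    using fs by (simp add: regular_sequence_def regular_list_nth carrier_poly_ring)
qed

lemma proper:
  assumes "set fs \<subseteq> polys V" "1 \<notin> idl.span (G \<union> set fs)"
  shows "seq_submodule M fs \<noteq> carrier M"
proof
  assume "seq_submodule M fs = carrier M"
  moreover have "I +>\<^bsub>S\<^esub> 1 \<in> carrier M" by (auto simp: carrier_M polys_ring_ops)
  ultimately show False using mem_seq_submodule[OF assms(1), of 1] assms(2) by (simp add: polys_ring_ops)
qed

text \<open>If \<open>P\<close> is the annihilator of the class of \<open>x\<close> and contains a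
  nonzerodivisor modulo \<open>I\<close>, then \<open>x\<close> is in \<open>I\<close> and
  \<open>P\<close> is the whole ring.\<close>

lemma ann_proper:
  assumes P: "P \<in> associated_primes S M" and g: "nzd (idl.span G) g" "g \<in> P"
  shows False
proof -
  obtain \<xi> where \<xi>: "\<xi> \<in> carrier M" "P = ann S M \<xi>" and "primeideal P S"
    using P by (auto simp: associated_primes_def)
  obtain x where x: "x \<in> polys V" "\<xi> = I +>\<^bsub>S\<^esub> x" using \<xi> by (auto simp: carrier_M)
  have ann: "f \<in> P \<longleftrightarrow> f \<in> polys V \<and> f * x \<in> idl.span G" for f
    using x \<xi>(2) coset_eq_iff[of "f * x" 0]
    by (auto simp: ann_def carrier_poly_ring smult_M zero_M polys_ring_ops)
  then have "x \<in> idl.span G" using g nzdD by blast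
  then have "P = carrier S" using ann by (auto simp: carrier_poly_ring intro: idl.span_scale)
  then show False using \<open>primeideal P S\<close> primeideal.I_notcarr by blast
qed

end

lemma eval01_UNIV: "eval01 UNIV p = cst (Poly_Mapping.lookup p 0)"
proof -
  have "lin (\<lambda>m. if Poly_Mapping.keys m \<inter> UNIV = {} then 1 else 0) p =
      (\<Sum>m\<in>insert 0 (Poly_Mapping.keys p). cst (Poly_Mapping.lookup p m) * (if Poly_Mapping.keys m \<inter> UNIV = {} then 1 else 0))"
    by (rule lin_superset) auto
  also have "\<dots> = (\<Sum>m\<in>{0}. cst (Poly_Mapping.lookup p m) * (if Poly_Mapping.keys m \<inter> UNIV = {} then 1 else 0))"
    by (rule sum.mono_neutral_right) auto
  finally show ?thesis by (simp add: eval01_def)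
qed

lemma lookup_0_span:
  fixes G :: "('v, 'k::field) mpoly set"
  assumes "\<And>g. g \<in> G \<Longrightarrow> Poly_Mapping.lookup g 0 = 0" "x \<in> idl.span G"
  shows "Poly_Mapping.lookup x 0 = 0"
proof -
  have "eval01 UNIV x = 0" using assms by (intro eval01_span[OF assms(2)]) (simp add: eval01_UNIV)
  then show ?thesis unfolding eval01_UNIV by (metis lookup_single_eq lookup_zero)
qed

lemma homog_lookup_0:
  assumes "homog \<omega> d p" "d > 0" shows "Poly_Mapping.lookup p 0 = 0"
proof (rule ccontr)
  assume "Poly_Mapping.lookup p 0 \<noteq> 0"
  then have "0 \<in> Poly_Mapping.keys p" by (simp add: in_keys_iff)
  then have "wdeg \<omega> 0 = d" using assms(1) unfolding homog_def by blast
  then show False using assms(2) by simp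
qed

lemma irrelevant_ideal_iff:
  fixes p :: "('v, 'k::field) mpoly"
  shows "p \<in> irrelevant_ideal V \<longleftrightarrow> p \<in> polys V \<and> Poly_Mapping.lookup p 0 = 0"
proof -
  have "p \<in> idl.span (X ` V) \<longleftrightarrow> Poly_Mapping.lookup p 0 = 0" if p: "p \<in> polys V"
  proof
    assume "p \<in> idl.span (X ` V)"
    then show "Poly_Mapping.lookup p 0 = 0"
    proof (rule lookup_0_span[rotated])
      fix g assume "g \<in> X ` V"
      then obtain v where "g = X v" by blast
      then show "Poly_Mapping.lookup g 0 = 0"
        using homog_lookup_0[OF homog_X[of "\<lambda>_. 1" v 1 , OF refl]] by simp
    qed
  next
    assume p0: "Poly_Mapping.lookup p 0 = 0"
    have "Poly_Mapping.single m (Poly_Mapping.lookup p m) \<in> idl.span (X ` V)" if m: "m \<in> Poly_Mapping.keys p" for m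
    proof -
      have "m \<noteq> 0" using m p0 by (auto simp: in_keys_iff)
      have "Poly_Mapping.keys m \<noteq> {}"
      proof
        assume "Poly_Mapping.keys m = {}"
        then have "m = 0" by (intro poly_mapping_eqI) (auto simp: in_keys_iff)
        then show False using \<open>m \<noteq> 0\<close> by simp
      qed
      then obtain v where v: "v \<in> Poly_Mapping.keys m" by blast
      obtain n where n: "m = Poly_Mapping.single v 1 + n" using monom_split[OF v] .
      have "Poly_Mapping.single m (Poly_Mapping.lookup p m) = Poly_Mapping.single n (Poly_Mapping.lookup p m) * X v"
        by (simp add: n X_def mult_single add.commute)
      moreover have "v \<in> V" using m v p by (auto simp: polys_def)
      ultimately show ?thesis by (simp add: idl.span_scale idl.span_base)
    qed
    then have "(\<Sum>m\<in>Poly_Mapping.keys p. Poly_Mapping.single m (Poly_Mapping.lookup p m)) \<in> idl.span (X ` V)"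
      by (rule idl.span_sum)
    then show "p \<in> idl.span (X ` V)" using mpoly_eq_sum[of p] by simp
  qed
  moreover have "X ` V \<subseteq> (polys V :: ('v, 'k) mpoly set)" by (auto intro: X_in_polys)
  ultimately show ?thesis unfolding irrelevant_ideal_def by (auto simp: genideal_poly_ring)
qed

section \<open>Combinatorics of the cross\<close>

lemma adjacent_cases:
  assumes "adjacent (a, b) (c, d)"
  shows "c = a \<and> (d = b + 1 \<or> b = d + 1) \<or> d = b \<and> (c = a + 1 \<or> a = c + 1)"
proof -
  have "card (cell_edges (a, b) \<inter> cell_edges (c, d)) = 1" using assms by (simp only: adjacent_def)
  then obtain e where e: "cell_edges (a, b) \<inter> cell_edges (c, d) = {e}" by (rule card_1_singletonE)
  then have mem: "e \<in> cell_edges (a, b)" "e \<in> cell_edges (c, d)" by blast+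
  have ne: "(a, b) \<noteq> (c, d)"
  proof
    assume "(a, b) = (c, d)"
    then have "cell_edges (a, b) = {e}" using e by (simp only: Int_absorb)
    then have eq: "x = e" if "x \<in> cell_edges (a, b)" for x using that by (simp only: singleton_iff)
    have "{(a, b), (a + 1, b)} \<in> cell_edges (a, b)" "{(a, b + 1), (a + 1, b + 1)} \<in> cell_edges (a, b)" by simp_all
    from this[THEN eq] have "{(a, b), (a + 1, b)} = {(a, b + 1), (a + 1, b + 1)}" by (rule trans[OF _ sym])
    then have "(a, b) \<in> {(a, b + 1), (a + 1, b + 1)}" by blast
    then show False by simp
  qed
  have ab: "e = {(a, b), (a + 1, b)} \<or> e = {(a, b + 1), (a + 1, b + 1)} \<or>
      e = {(a, b), (a, b + 1)} \<or> e = {(a + 1, b), (a + 1, b + 1)}"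
    and cd: "e = {(c, d), (c + 1, d)} \<or> e = {(c, d + 1), (c + 1, d + 1)} \<or>
      e = {(c, d), (c, d + 1)} \<or> e = {(c + 1, d), (c + 1, d + 1)}"
    using mem by simp_all
  show ?thesis using ab
  proof (elim disjE)
    assume "e = {(a, b), (a + 1, b)}"
    with cd ne show ?thesis by (simp add: doubleton_eq_iff) linarith
  next
    assume "e = {(a, b + 1), (a + 1, b + 1)}"
    with cd ne show ?thesis by (simp add: doubleton_eq_iff) linarith
  next
    assume "e = {(a, b), (a, b + 1)}"
    with cd ne show ?thesis by (simp add: doubleton_eq_iff) linarith
  next
    assume "e = {(a + 1, b), (a + 1, b + 1)}"
    with cd ne show ?thesis by (simp add: doubleton_eq_iff) linarith
  qed
qed

lemma generalized_X_pentomino_cross: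
  assumes "generalized_X_pentomino \<C> D"
  obtains i0 j0 p q p' q' where "D = (i0, j0)" "\<C> = cross i0 j0 p q p' q'"
    "p < i0" "Suc i0 < q" "p' < j0" "Suc j0 < q'"
proof -
  obtain \<R> \<Q> \<P> where RQ: "row_of_cells \<R>" "column_of_cells \<Q>" "\<C> = \<R> \<union> \<Q>" "\<R> \<inter> \<Q> = {D}"
    and P: "\<P> \<subseteq> \<C>" "X_pentomino \<P>" using assms by (auto simp: generalized_X_pentomino_def)
  obtain j0 p q where R: "\<R> = {(i, j0) | i. p \<le> i \<and> i < q}" using RQ(1) by (auto simp: row_of_cells_def)
  obtain i0 p' q' where Q: "\<Q> = {(i0, j) | j. p' \<le> j \<and> j < q'}" using RQ(2) by (auto simp: column_of_cells_def)
  have "D \<in> \<R>" "D \<in> \<Q>" using RQ(4) by auto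
  then have D: "D = (i0, j0)" by (auto simp: R Q)
  have C: "\<C> = cross i0 j0 p q p' q'" unfolding RQ(3) by (auto simp: R Q cross_def)
  obtain a b where ab: "card \<P> = 5" "\<P> = insert (a, b) {C'. is_cell C' \<and> adjacent (a, b) C'}"
    using P(2) by (auto simp: X_pentomino_def)
  \<comment> \<open>The subtraction truncates, so \<open>?N\<close> has fewer than five elements
    when \<open>a\<close> or \<open>b\<close> is 0; this is how the cardinality of the pentomino
    yields that both are positive.\<close>
  let ?N = "{(a, b), (a + 1, b), (a - 1, b), (a, b + 1), (a, b - 1)}"
  have sub: "\<P> \<subseteq> ?N"
  proof
    fix e assume "e \<in> \<P>"
    then show "e \<in> ?N" using adjacent_cases[of a b "fst e" "snd e"] by (cases e) (auto simp: ab(2))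
  qed
  have "card ?N \<le> 5" by (simp add: card_insert_if)
  then have PN: "\<P> = ?N" using card_subset_eq[OF _ sub] card_mono[OF _ sub] ab(1) by simp
  have "a \<noteq> 0" "b \<noteq> 0"
  proof -
    have "card ?N = 5" using PN ab(1) by simp
    then show "a \<noteq> 0" "b \<noteq> 0" by (auto simp: card_insert_if split: if_splits)
  qed
  moreover have "?N \<subseteq> \<C>" using P(1) PN by simp
  \<comment> \<open>A row and a column contain a cell with all four neighbours only around their
    common cell, and then each of them extends past it on both sides.\<close>
  ultimately have "a = i0 \<and> b = j0 \<and> p < i0 \<and> Suc i0 < q \<and> p' < j0 \<and> Suc j0 < q'"
    by (auto simp: C cross_def)
  then show ?thesis using that D C by blast
qed

lemma vertices_cross:
  assumes p: "p < i0" "Suc i0 < q" "p' < j0" "Suc j0 < q'"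
  shows "vertices (cross i0 j0 p q p' q') = {p..q} \<times> {j0, Suc j0} \<union> {i0, Suc i0} \<times> {p'..q'}"
proof (intro equalityI subsetI)
  fix v assume "v \<in> {p..q} \<times> {j0, Suc j0} \<union> {i0, Suc i0} \<times> {p'..q'}"
  then consider (row) x y where "v = (x, y)" "p \<le> x" "x \<le> q" "y = j0 \<or> y = Suc j0"
    | (col) x y where "v = (x, y)" "p' \<le> y" "y \<le> q'" "x = i0 \<or> x = Suc i0" by force
  then show "v \<in> vertices (cross i0 j0 p q p' q')"
  proof cases
    case row
    show ?thesis
    proof (cases "x = q")
      case True
      then have "(q - 1, j0) \<in> cross i0 j0 p q p' q'" "v \<in> cell_vertices (q - 1, j0)" using row p by (auto simp: cross_def)
      then show ?thesis unfolding vertices_def by blast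
    next
      case False
      then have "(x, j0) \<in> cross i0 j0 p q p' q'" "v \<in> cell_vertices (x, j0)" using row p by (auto simp: cross_def)
      then show ?thesis unfolding vertices_def by blast
    qed
  next
    case col
    show ?thesis
    proof (cases "y = q'")
      case True
      then have "(i0, q' - 1) \<in> cross i0 j0 p q p' q'" "v \<in> cell_vertices (i0, q' - 1)" using col p by (auto simp: cross_def)
      then show ?thesis unfolding vertices_def by blast
    next
      case False
      then have "(i0, y) \<in> cross i0 j0 p q p' q'" "v \<in> cell_vertices (i0, y)" using col p by (auto simp: cross_def)
      then show ?thesis unfolding vertices_def by blast
    qed
  qed
qed (auto simp: vertices_def cross_def)

lemma card_vertices_cross:
  assumes p: "p < i0" "Suc i0 < q" "p' < j0" "Suc j0 < q'"
  shows "card (cross i0 j0 p q p' q') = (q - p) + (q' - p') - 1"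
    "card (vertices (cross i0 j0 p q p' q')) = 2 * ((q - p) + (q' - p'))"
proof -
  have "({p..<q} \<times> {j0}) \<inter> ({i0} \<times> {p'..<q'}) = {(i0, j0)}" using p by auto
  then show "card (cross i0 j0 p q p' q') = (q - p) + (q' - p') - 1"
    using card_Un_Int[of "{p..<q} \<times> {j0}" "{i0} \<times> {p'..<q'}"] by (simp add: cross_def card_cartesian_product)
  have "({p..q} \<times> {j0, Suc j0}) \<inter> ({i0, Suc i0} \<times> {p'..q'}) = {i0, Suc i0} \<times> {j0, Suc j0}" using p by auto
  then show "card (vertices (cross i0 j0 p q p' q')) = 2 * ((q - p) + (q' - p'))"
    unfolding vertices_cross[OF p]
    using card_Un_Int[of "{p..q} \<times> {j0, Suc j0}" "{i0, Suc i0} \<times> {p'..q'}"] p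
    by (simp add: card_cartesian_product)
qed

lemma free_vertexD: "free_vertex \<C> v \<Longrightarrow> c \<in> \<C> \<Longrightarrow> c' \<in> \<C> \<Longrightarrow> v \<in> cell_vertices c \<Longrightarrow> v \<in> cell_vertices c' \<Longrightarrow> c = c'"
  by (auto simp: free_vertex_def)

text \<open>The vertices shared with the central cell are not free, so the two free ones form the
  opposite edge. A further cell of the arm would contain that edge; hence the arm has length one and
  the vertices are the end vertices of its arm system.\<close>

lemma free_vertices_cross:
  assumes p: "p < i0" "Suc i0 < q" "p' < j0" "Suc j0 < q'"
  defines "\<C> \<equiv> cross i0 j0 p q p' q'"
  assumes c: "c \<in> \<C>" "adjacent c (i0, j0)"
    and v: "v \<in> cell_vertices c" "v' \<in> cell_vertices c" "v \<noteq> v'" "free_vertex \<C> v" "free_vertex \<C> v'"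
  shows "{v, v'} \<in> {{(p, j0), (p, Suc j0)}, {(i0, q'), (Suc i0, q')}, {(q, j0), (q, Suc j0)}, {(i0, p'), (Suc i0, p')}}"
proof -
  have D: "(i0, j0) \<in> \<C>" using p by (auto simp: \<C>_def cross_def)
  obtain a b where ab: "c = (a, b)" by (cases c)
  have cD: "c \<noteq> (i0, j0)" using adjacent_cases[of a b i0 j0] c ab by auto
  have free: "x \<notin> cell_vertices (i0, j0)" "c' \<in> \<C> \<Longrightarrow> x \<in> cell_vertices c' \<Longrightarrow> c' = c" if "x \<in> {v, v'}" for x c'
    using free_vertexD[of \<C> x c "(i0, j0)"] free_vertexD[of \<C> x c c'] v c D cD that by auto
  consider "b = j0" "i0 = Suc a" | "b = j0" "a = Suc i0" | "a = i0" "j0 = Suc b" | "a = i0" "b = Suc j0"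
    using adjacent_cases[of a b i0 j0] c ab by auto
  then show ?thesis
  proof cases
    case 1
    have vv: "{v, v'} = {(a, j0), (a, Suc j0)}" using v(1-3) free(1)[of v] free(1)[of v'] 1 ab by auto
    have "a = p"
    proof (rule ccontr)
      assume "a \<noteq> p"
      then have "(a - 1, j0) \<in> \<C>" "(a, j0) \<in> cell_vertices (a - 1, j0)"
        using 1 c ab p by (auto simp: \<C>_def cross_def)
      then show False using free(2)[of "(a, j0)" "(a - 1, j0)"] vv 1 ab \<open>a \<noteq> p\<close> c p by (auto simp: \<C>_def cross_def)
    qed
    then show ?thesis using vv by simp
  next
    case 2
    have vv: "{v, v'} = {(Suc a, j0), (Suc a, Suc j0)}" using v(1-3) free(1)[of v] free(1)[of v'] 2 ab by auto
    have "Suc a = q"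
    proof (rule ccontr)
      assume "Suc a \<noteq> q"
      then have "(Suc a, j0) \<in> \<C>" "(Suc a, j0) \<in> cell_vertices (Suc a, j0)"
        using 2 c ab p by (auto simp: \<C>_def cross_def)
      then show False using free(2)[of "(Suc a, j0)" "(Suc a, j0)"] vv 2 ab by auto
    qed
    then show ?thesis using vv by simp
  next
    case 3
    have vv: "{v, v'} = {(i0, b), (Suc i0, b)}" using v(1-3) free(1)[of v] free(1)[of v'] 3 ab by auto
    have "b = p'"
    proof (rule ccontr)
      assume "b \<noteq> p'"
      then have "(i0, b - 1) \<in> \<C>" "(i0, b) \<in> cell_vertices (i0, b - 1)"
        using 3 c ab p by (auto simp: \<C>_def cross_def)
      then show False using free(2)[of "(i0, b)" "(i0, b - 1)"] vv 3 ab \<open>b \<noteq> p'\<close> c p by (auto simp: \<C>_def cross_def)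
    qed
    then show ?thesis using vv by simp
  next
    case 4
    have vv: "{v, v'} = {(i0, Suc b), (Suc i0, Suc b)}" using v(1-3) free(1)[of v] free(1)[of v'] 4 ab by auto
    have "Suc b = q'"
    proof (rule ccontr)
      assume "Suc b \<noteq> q'"
      then have "(i0, Suc b) \<in> \<C>" "(i0, Suc b) \<in> cell_vertices (i0, Suc b)"
        using 4 c ab p by (auto simp: \<C>_def cross_def)
      then show False using free(2)[of "(i0, Suc b)" "(i0, Suc b)"] vv 4 ab by auto
    qed
    then show ?thesis using vv by simp
  qed
qed

text \<open>The first element of a regular list is a nonzerodivisor modulo the starting ideal, and
  rotation brings any arm to the front.\<close>

lemma arm_system_nzd:
  assumes s: "arm_system \<omega> V G Ps F" and m: "(x, y, w) \<in> set Ps"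
  shows "nzd (idl.span G) (X y - w * X x)"
proof -
  obtain Ps1 Ps2 where Ps: "Ps = Ps1 @ (x, y, w) # Ps2" using m by (meson split_list)
  have "arm_system \<omega> V G (Ps2' @ Ps1') F" if "arm_system \<omega> V G (Ps1' @ Ps2') F" for Ps1' Ps2'
    using that
  proof (induction Ps1' arbitrary: Ps2')
    case (Cons P Ps1')
    from arm_system_rotate[OF Cons.prems[simplified]] have "arm_system \<omega> V G (Ps1' @ Ps2' @ [P]) F" by simp
    then show ?case using Cons.IH[of "Ps2' @ [P]"] by simp
  qed simp
  then have "arm_system \<omega> V G (((x, y, w) # Ps2) @ Ps1) F" using s unfolding Ps .
  from arm_systemD(10)[OF this] show ?thesis by simp
qed

theorem theorem1p4:
  fixes \<C> :: "cell set" and D :: cell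
    and S :: "(vertex, 'k::field) mpoly ring"
    and I :: "(vertex, 'k) mpoly set"
  defines "S \<equiv> poly_ring (vertices \<C>)"
    and "I \<equiv> I_adj \<C>"
  assumes "generalized_X_pentomino \<C> D"
  shows "depth S (irrelevant_ideal (vertices \<C>)) (quot_module S I)
           = enat (card (vertices \<C>) - card \<C>) \<and>
         (\<forall>C i j. C \<in> \<C> \<and> adjacent C D \<and>
            i \<in> cell_vertices C \<and> j \<in> cell_vertices C \<and> i \<noteq> j \<and>
            free_vertex \<C> i \<and> free_vertex \<C> j \<longrightarrow>
            (\<forall>P \<in> associated_primes S (quot_module S I). X i \<notin> P \<or> X j \<notin> P))"
proof -
  obtain i0 j0 p q p' q' where D: "D = (i0, j0)" and C: "\<C> = cross i0 j0 p q p' q'"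
    and p: "p < i0" "Suc i0 < q" "p' < j0" "Suc j0 < q'"
    using generalized_X_pentomino_cross[OF assms(3)] .
  define V where "V = vertices \<C>"
  have V: "V = {p..q} \<times> {j0, Suc j0} \<union> {i0, Suc i0} \<times> {p'..q'}"
    unfolding V_def C by (rule vertices_cross[OF p])
  define G where "G = (cell_binomial ` \<C> :: (vertex, 'k) mpoly set)"
  obtain \<omega> w1 w2 w3 w4 F where
    sys: "arm_system \<omega> V G [((p, Suc j0), (p, j0), w1), ((Suc i0, q'), (i0, q'), w2),
      ((q, Suc j0), (q, j0), w3), ((Suc i0, p'), (i0, p'), w4)] F"
    and len: "length F + 2 = (q - p) + (q' - p') - 1"
    using cross_system[OF p, where 'k = 'k] unfolding V G_def C by metis
  define Ps where "Ps = [((p, Suc j0), (p, j0), w1), ((Suc i0, q'), (i0, q'), w2),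
      ((q, Suc j0), (q, j0), w3), ((Suc i0, p'), (i0, p'), w4)]"
  note sys = sys[folded Ps_def]
  note s = arm_systemD[OF sys]
  interpret q: quotient V G by unfold_locales (rule s(2))
  have SI: "S = poly_ring V" "I = genideal (poly_ring V) G"
    by (simp_all add: assms(1,2) V_def I_adj_def G_def)
  let ?M = "quot_module S I" and ?m = "irrelevant_ideal V :: (vertex, 'k) mpoly set"
  let ?d = "card V - card \<C>"
  \<comment> \<open>As \<open>|V| = 2 |\<C>| + 2\<close>, the difference is
    \<open>|\<C>| + 2\<close>: the four arm forms together with the \<open>|\<C>| - 2\<close> forms
    in \<open>F\<close>.\<close>
  have d: "?d = card V - ((q - p) + (q' - p') - 1)" "?d = (q - p) + (q' - p') + 1"
    unfolding V_def C card_vertices_cross[OF p] using p by auto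
  define \<theta> where "\<theta> = map (\<lambda>(x, y, w). X y - w * X x) Ps @ F"
  have \<theta>V: "set \<theta> \<subseteq> polys V"
  proof
    fix f assume "f \<in> set \<theta>"
    then consider "f \<in> set F" | x y w where "(x, y, w) \<in> set Ps" "f = X y - w * X x"
      by (auto simp: \<theta>_def)
    then show "f \<in> polys V"
      using s(4) s(6-8) by cases (blast, auto intro!: polys_ring_ops X_in_polys)
  qed
  have \<theta>0: "Poly_Mapping.lookup f 0 = 0" if "f \<in> set \<theta>" for f
  proof -
    consider "f \<in> set F" | x y w where "(x, y, w) \<in> set Ps" "f = X y - w * X x"
      using \<open>f \<in> set \<theta>\<close> by (auto simp: \<theta>_def)
    then obtain e where "homog \<omega> e f" "e > 0"
    proof cases
      case 1
      then show ?thesis using s(5) that by (auto simp: homog_list_def)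
    next
      case 2
      obtain k where "homog \<omega> k w" "\<omega> y = k + \<omega> x" using s(9)[OF 2(1)] by blast
      then have "homog \<omega> (\<omega> y) f" unfolding 2(2) by (intro homog_diff homog_X homog_mult) auto
      then show ?thesis using s(1) that by blast
    qed
    then show ?thesis by (rule homog_lookup_0)
  qed
  have G0: "Poly_Mapping.lookup g 0 = 0" if "g \<in> G" for g
  proof (rule homog_lookup_0)
    show "homog (\<lambda>_. 1) 2 g" using that by (auto simp: G_def intro!: homog_diff homog_mult homog_X)
  qed simp
  have "enat (length fs) \<le> enat ?d" if "set fs \<subseteq> ?m" "regular_sequence S ?M fs" for fs
  proof -
    have fs: "set fs \<subseteq> polys V" "\<And>f. f \<in> set fs \<Longrightarrow> Poly_Mapping.lookup f 0 = 0"
      using that(1) by (auto simp: irrelevant_ideal_iff)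
    then have rl: "regular_list (idl.span G) fs" using that(2) q.regular_sequence_iff by (simp add: SI)
    have "length fs \<le> card V - ((q - p) + (q' - p') - 1)"
      using cross_upper[OF p, of fs] fs rl unfolding G_def C V by simp
    then show ?thesis using d(1) by simp
  qed
  moreover have "\<exists>fs. set fs \<subseteq> ?m \<and> regular_sequence S ?M fs \<and> length fs = ?d"
  proof (intro exI conjI)
    show "set \<theta> \<subseteq> ?m" using \<theta>V \<theta>0 by (auto simp: irrelevant_ideal_iff)
    \<comment> \<open>Properness: all generators have constant term 0, hence so has every element of
      the ideal.\<close>
    have "1 \<notin> idl.span (G \<union> set \<theta>)"
      using lookup_0_span[of "G \<union> set \<theta>" 1] \<theta>0 G0 by (auto simp: lookup_one)
    then show "regular_sequence S ?M \<theta>"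
      using q.regular_sequence_iff[OF \<theta>V] q.proper[OF \<theta>V] s(10) by (simp add: SI \<theta>_def)
    show "length \<theta> = ?d" using len p by (simp add: \<theta>_def d(2) Ps_def)
  qed
  ultimately have "depth S ?m ?M = enat ?d"
    unfolding depth_def by (intro antisym Sup_least Sup_upper) (auto, metis)
  moreover have "X i \<notin> P \<or> X j \<notin> P"
    if c: "c \<in> \<C>" "adjacent c D" "i \<in> cell_vertices c" "j \<in> cell_vertices c" "i \<noteq> j"
      "free_vertex \<C> i" "free_vertex \<C> j" and P: "P \<in> associated_primes S ?M" for c i j P
  proof (rule ccontr)
    assume "\<not> (X i \<notin> P \<or> X j \<notin> P)"
    then have ij: "X v \<in> P" if "v \<in> {i, j}" for v using that by blast
    have "{i, j} \<in> {{(p, j0), (p, Suc j0)}, {(i0, q'), (Suc i0, q')}, {(q, j0), (q, Suc j0)}, {(i0, p'), (Suc i0, p')}}"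
      by (rule free_vertices_cross[OF p c[unfolded C D]])
    then have "\<exists>(x, y, w) \<in> set Ps. {i, j} = {y, x}" unfolding Ps_def by auto
    then obtain x y w where xy: "(x, y, w) \<in> set Ps" "{i, j} = {y, x}" by blast
    interpret P: ideal P "poly_ring V :: (vertex, 'k) mpoly ring"
      using P by (auto simp: associated_primes_def SI primeideal_def)
    have "X y \<in> P" "w * X x \<in> P"
      using ij[of y] ij[of x] P.I_l_closed[of "X x" w] s(8)[OF xy(1)] unfolding xy(2)
      by (simp_all add: carrier_poly_ring)
    then have "X y - w * X x \<in> P"
      using P.a_closed[of "X y" "\<ominus>\<^bsub>poly_ring V\<^esub> (w * X x)"] P.a_inv_closed[of "w * X x"] P.Icarr[of "w * X x"]
      by (simp add: poly_ring_uminus carrier_poly_ring)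
    then show False using q.ann_proper arm_system_nzd[OF sys xy(1)] P by (simp add: SI)
  qed
  ultimately show ?thesis unfolding V_def by blast
qed

end
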